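(* Let $\mathcal{X}$ and $\mathcal{Y}$ be metric spaces, let $\mathcal{F}$ be the Borel $\sigma$-algebra of $\mathcal{X}$, let $\mathcal{G}$ be the Borel $\sigma$-algebra of $\mathcal{Y}$, and let $T:(\mathcal{X},\mathcal{F})\to(\mathcal{Y},\mathcal{G})$ be measurable. Suppose (i) $\mathbb{P}$ is a given Radon probability measure on $(\mathcal{X},\mathcal{F})$; (ii) the image measure $T\mathbb{P}$ is a probability measure on $(\mathcal{Y},\mathcal{G})$, where $\mathcal{G}$ is countably generated and contains all the singleton sets $\{t\}$. Then $\mathbb{P}$ has a disintegration $\{\mathbb{P}_t\}$ with respect to $T$ and $T\mathbb{P}$ consisting of probability measures, $\mathbb{P}_t=\mathbb{P}(\,\cdot\mid T=t)$, which is unique up to almost sure equivalence. For events $E$ of the form $E=\{T=t\}$, the distribution $\mathcal{L}(\mathbf{X}')=\mathcal{L}(\mathbf{X}\mid T=t)$ is well-defined and unique on events of positive $\mathbb{P}_t$ measure. Furthermore, assume (a) there are metric spaces $\mathcal{A}$ and $\mathcal{B}$ such that $\mathcal{X}=\mathcal{A}\times\mathcal{B}$; (b) with $\pi_{\mathcal{A}},\pi_{\mathcal{B}}$ the coordinate projections, the probability measures $\mathbb{P}_{\mathcal{A}}:=\pi_{\mathcal{A}}\mathbb{P}$ and $\mathbb{P}_{\mathcal{B}}:=\pi_{\mathcal{B}}\mathbb{P}$ satisfy $\mathbb{P}=\mathbb{P}_{\mathcal{A}}\times\mathbb{P}_{\mathcal{B}}$, corresponding to independent random variables $A\in\mathcal{A}$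 and $B\in\mathcal{B}$ with distributions $\mathcal{L}(A)=\mathbb{P}_{\mathcal{A}}$ and $\mathcal{L}(B)=\mathbb{P}_{\mathcal{B}}$; (c) for each $a\in\mathcal{A}$ the map $T_a(\cdot):=T(a,\cdot)$ on $\mathcal{B}$ is measurable, and $t_a$ denotes the set of values such that $\{T=t,\ A=a\}=\{A=a,\ T_a(B)\in t_a\}$. Then the distributions $$\mathcal{L}(X):=\mathcal{L}(A\mid T=t),\qquad \mathcal{L}(Y\mid X=a):=\mathcal{L}(B\mid T=t,\ A=a)=\mathcal{L}(B\mid T_a(B)\in t_a)$$ exist and are unique up to almost sure equivalence. Finally, $\mathcal{L}(X,Y)=\mathcal{L}(\mathbf{X}')$ (for $T\mathbb{P}$-almost every $t$).
   Context: $\mathbf{X}$ is a random variable with values in $\mathcal{X}$ and distribution $\mathbb{P}$; in the second part $\mathbf{X}=(A,B)$. A Radon measure is a Borel measure $\lambda$ with $\lambda(K)<\infty$ for every compact $K$ and $\lambda(D)=\sup\{\lambda(K):K\subseteq D,\ K\text{ compact}\}$ for every Borel set $D$. $T\lambda$ denotes the push-forward of $\lambda$ under $T$; similarly $\pi_{\mathcal{A}}\lambda,\pi_{\mathcal{B}}\lambda$. For a measure $\lambda$ and function $f$, $\lambda(f)=\int f\,d\lambda$. Disintegration: given $\sigma$-finite measures $\lambda$ on $\mathcal{F}$ and $\mu$ on $\mathcal{G}$, a family $\{\lambda_t\}_{t\in\mathcal{Y}}$ of measures on $\mathcal{F}$ is a $(T,\mu)$-disintegration of $\lambda$ if for every nonnegative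 measurable $f$ on $\mathcal{X}$: (i) $\lambda_t\{T\ne t\}=0$ for $\mu$-almost all $t$; (ii) $t\mapsto\lambda_t(f)$ is measurable; (iii) $\lambda(f)=\int\lambda_t(f)\,d\mu(t)$. Uniqueness up to almost sure equivalence means: if $\{\lambda_t^*\}$ is another such disintegration, then $\mu\{t:\lambda_t\neq\lambda_t^*\}=0$. Conditional distributions are understood as disintegrations: $\mathcal{L}(\mathbf{X}\mid T=t)=\mathbb{P}_t$; $\mathcal{L}(A\mid T=t)$ is the push-forward of $\mathbb{P}_t$ under $\pi_{\mathcal{A}}$; $\mathcal{L}(B\mid T=t,A=a)$ is the push-forward under $\pi_{\mathcal{B}}$ of the member at $a$ of the disintegration of $\mathbb{P}_t$ with respect to $\pi_{\mathcal{A}}$ and $\pi_{\mathcal{A}}\mathbb{P}_t$; $\mathcal{L}(B\mid T_a(B)\in t_a)$ is the member at $t$ of the disintegration of $\mathbb{P}_{\mathcal{B}}$ with respect to $T_a$ and $T_a\mathbb{P}_{\mathcal{B}}$ (here $t_a=\{t\}$), taken in a version measurable jointly in $(a,t)$. Equalities between these objects are understood up to almost sure equivalence. $\mathcal{L}(X,Y)$ is the joint law on $\mathcal{A}\times\mathcal{B}$ obtained by first drawing $X$ from $\mathcal{L}(X)$ and then, given $X=x$, drawing $Y$ from $\mathcal{L}(Y\mid X=x)$. *)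

theory Defs
  imports "HOL-Probability.Probability"
begin

definition radon_measure :: "'x::metric_space measure \<Rightarrow> bool" where
  "radon_measure M \<longleftrightarrow>
     sets M = sets borel \<and>
     (\<forall>K. compact K \<longrightarrow> emeasure M K < \<infinity>) \<and>
     (\<forall>D\<in>sets borel. emeasure M D = (SUP K\<in>{K. K \<subseteq> D \<and> compact K}. emeasure M K))"

definition countably_generated :: "'x measure \<Rightarrow> bool" where
  "countably_generated M \<longleftrightarrow>
     (\<exists>C. countable C \<and> C \<subseteq> Pow (space M) \<and> sets M = sigma_sets (space M) C)"

text \<open>Disintegration of \<open>\<Lambda>\<close> with respect to \<open>(T, \<mu>)\<close>. Nonnegative measurable functions are
  \<^typ>\<open>ennreal\<close>-valued. The members \<open>D t\<close> are arbitrary measures on the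
  \<open>\<sigma>\<close>-algebra of \<open>\<Lambda>\<close>; they are not required to be finite.\<close>

definition disintegration ::
  "'x measure \<Rightarrow> ('x \<Rightarrow> 'y) \<Rightarrow> 'y measure \<Rightarrow> ('y \<Rightarrow> 'x measure) \<Rightarrow> bool" where
  "disintegration \<Lambda> T \<mu> D \<longleftrightarrow>
     (\<forall>t\<in>space \<mu>. sets (D t) = sets \<Lambda>) \<and>
     (AE t in \<mu>. AE x in D t. T x = t) \<and>
     (\<forall>f :: 'x \<Rightarrow> ennreal. f \<in> borel_measurable \<Lambda> \<longrightarrow>
        (\<lambda>t. \<integral>\<^sup>+x. f x \<partial>D t) \<in> borel_measurable \<mu> \<and>
        (\<integral>\<^sup>+x. f x \<partial>\<Lambda>) = (\<integral>\<^sup>+t. (\<integral>\<^sup>+x. f x \<partial>D t) \<partial>\<mu>))"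

text \<open>The predicates below single out the versions of the conditional distributions, which are
  determined only up to almost sure equivalence: \<open>D t\<close> is \<open>\<L>(X | T = t)\<close>.\<close>

definition is_cond_law ::
  "'x::topological_space measure \<Rightarrow> ('x \<Rightarrow> 'y::topological_space) \<Rightarrow> ('y \<Rightarrow> 'x measure) \<Rightarrow> bool" where
  "is_cond_law P T D \<longleftrightarrow> disintegration P T (distr P borel T) D"

text \<open>\<open>\<alpha> t\<close> is \<open>\<L>(A | T = t)\<close>.\<close>

definition is_law_A_given_T ::
  "('a::metric_space \<times> 'b::metric_space) measure \<Rightarrow> ('a \<times> 'b \<Rightarrow> 'y::metric_space) \<Rightarrow>
   ('y \<Rightarrow> 'a measure) \<Rightarrow> bool" where
  "is_law_A_given_T P T \<alpha> \<longleftrightarrow>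
     (\<exists>D. is_cond_law P T D \<and> (\<forall>t. \<alpha> t = distr (D t) borel fst))"

text \<open>\<open>L t a\<close> is \<open>\<L>(B | T = t, A = a)\<close>: disintegrate \<open>D t\<close> along the first projection, then push
  forward to the second factor. The members \<open>D t\<close> are constrained only for almost every \<open>t\<close>, so
  this can only be asked of almost every \<open>t\<close>.\<close>

definition is_law_B_given_TA ::
  "('a::metric_space \<times> 'b::metric_space) measure \<Rightarrow> ('a \<times> 'b \<Rightarrow> 'y::metric_space) \<Rightarrow>
   ('y \<Rightarrow> 'a \<Rightarrow> 'b measure) \<Rightarrow> bool" where
  "is_law_B_given_TA P T L \<longleftrightarrow>
     (\<exists>D E. is_cond_law P T D \<and>
        (AE t in distr P borel T. is_cond_law (D t) fst (E t)) \<and>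
        (\<forall>t a. L t a = distr (E t a) borel snd))"

text \<open>\<open>\<kappa> a t\<close> is the conditional law of \<open>B\<close> given \<open>T\<^sub>a(B) = t\<close>, in a version that is
  measurable jointly in \<open>(a, t)\<close> with respect to the product \<open>\<sigma>\<close>-algebra.\<close>

definition is_law_B_given_section ::
  "('a::metric_space \<times> 'b::metric_space) measure \<Rightarrow> ('a \<times> 'b \<Rightarrow> 'y::metric_space) \<Rightarrow>
   ('a \<Rightarrow> 'y \<Rightarrow> 'b measure) \<Rightarrow> bool" where
  "is_law_B_given_section P T \<kappa> \<longleftrightarrow>
     (\<forall>a. is_cond_law (distr P borel snd) (\<lambda>b. T (a, b)) (\<kappa> a)) \<and>
     (\<forall>f :: 'b \<Rightarrow> ennreal. f \<in> borel_measurable borel \<longrightarrow>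
        (\<lambda>(a, t). \<integral>\<^sup>+b. f b \<partial>\<kappa> a t) \<in> borel_measurable (borel \<Otimes>\<^sub>M borel))"

text \<open>Joint law of \<open>(X, Y)\<close> when \<open>X\<close> has law \<open>\<alpha>\<close> and, given \<open>X = a\<close>, \<open>Y\<close> has law \<open>L a\<close>.
  It lives on the Borel sets of the product space, like the measures it is compared with.
  The monadic \<^const>\<open>bind\<close> is unsuitable because it demands a kernel that is measurable and
  subprobability-valued everywhere, not just almost everywhere.\<close>

definition joint_law ::
  "'a::metric_space measure \<Rightarrow> ('a \<Rightarrow> 'b::metric_space measure) \<Rightarrow> ('a \<times> 'b) measure" where
  "joint_law \<alpha> L =
     measure_of UNIV (sets borel) (\<lambda>S. \<integral>\<^sup>+a. (\<integral>\<^sup>+b. indicator S (a, b) \<partial>L a) \<partial>\<alpha>)"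

text \<open>\<open>P = P\<^sub>A \<times> P\<^sub>B\<close>. If the factors are not separable, the Borel \<open>\<sigma>\<close>-algebra of the product may
  be strictly finer than the product \<open>\<sigma>\<close>-algebra, on which the product measure is defined; hence
  the restriction of \<open>P\<close> on the left-hand side.\<close>

definition is_product_law :: "('a::metric_space \<times> 'b::metric_space) measure \<Rightarrow> bool" where
  "is_product_law P \<longleftrightarrow>
     distr P (borel \<Otimes>\<^sub>M borel) (\<lambda>x. x) = distr P borel fst \<Otimes>\<^sub>M distr P borel snd"

end

theory Submission
  imports Defs
begin

text \<open>Up to null sets, a Radon measure is carried by the unit interval through a Borel map with a Borel
  inverse, so it suffices to disintegrate measures on the real line. There the conditional distribution
  functions are Radon-Nikodym densities. The law of \<open>B\<close> given \<open>T\<^sub>a(B) = t\<close> has to be jointly measurable in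
  \<open>(a, t)\<close> and correct for every \<open>a\<close>; the densities are therefore constructed as limits of a martingale
  along finite partitions of the countably generated target, with a subsequence depending measurably on
  \<open>a\<close>. Finally \<open>\<L>(A | T = t)\<close> followed by the kernel \<open>\<L>(B | T\<^sub>a(B) = t)\<close> is, by independence, itself a
  disintegration of \<open>P\<close>, and uniqueness identifies it with \<open>P\<^sub>t\<close>.\<close>

section \<open>Radon measures and the unit interval\<close>

text \<open>The factors may be non-separable, so Borel sets of \<open>'a \<times> 'b\<close> need
  not be product measurable. Radon measures escape this because they are carried by a sigma-compact,
  hence separable, set; the space \<open>'a\<close> enters only as a parameter and is never
  standardised on its own. A second obstacle is the order of the null sets. For each fixed
  \<open>a\<close> the law of \<open>B\<close> given \<open>T_a(B) = t\<close> is determined off a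
  null set of values \<open>t\<close> that depends on \<open>a\<close>, whereas the conclusion
  speaks of almost every \<open>t\<close> and then almost every \<open>a\<close>. Both kinds of
  negligibility are nullity under the joint law of \<open>(A, T)\<close>, but the exchange requires
  a product measurable exceptional set. Radon-Nikodym densities chosen separately for each
  \<open>a\<close> would lose this measurability, while ratios over the cells of finite partitions
  are explicit in \<open>a\<close>. Members of a disintegration are a priori arbitrary measures.
  That almost all of them are probabilities follows by comparing total masses, and versions are then
  compared through countably many rational half-lines, so that a single null set suffices.\<close>

lemma radon_measure_inner:
  fixes P :: "'x::metric_space measure"
  assumes P: "radon_measure P" and fin: "finite_measure P" and S: "S \<in> sets borel" and e: "(e::real) > 0"
  obtains K where "compact K" "K \<subseteq> S" "measure P (S - K) < e"
proof -
  interpret finite_measure P by fact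
  have sets: "sets P = sets borel" and
    sup: "emeasure P S = (SUP K\<in>{K. K \<subseteq> S \<and> compact K}. emeasure P K)"
    using P S by (auto simp: radon_measure_def)
  have "\<exists>K. compact K \<and> K \<subseteq> S \<and> measure P S - e < measure P K"
  proof (rule ccontr)
    assume neg: "\<not> ?thesis"
    have le: "measure P K \<le> measure P S - e" if "compact K" "K \<subseteq> S" for K
      using neg that by (meson leI)
    \<comment> \<open>Taking the empty set rules out a negative bound, which \<open>ennreal\<close>
      would truncate to 0.\<close>
    have nonneg: "measure P S - e \<ge> 0" using le[of "{}"] by simp
    have "emeasure P S \<le> ennreal (measure P S - e)"
      unfolding sup by (rule SUP_least) (auto simp: emeasure_eq_measure intro!: ennreal_leI le)
    with nonneg have "measure P S \<le> measure P S - e"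
      by (simp add: emeasure_eq_measure)
    with e show False by simp
  qed
  then obtain K where K: "compact K" "K \<subseteq> S" "measure P S - e < measure P K" by blast
  have "measure P (S - K) = measure P S - measure P K"
    using K S by (intro finite_measure_Diff) (auto simp: sets borel_compact)
  with K show ?thesis by (intro that[of K]) auto
qed

text \<open>Lusin's theorem for a second countable target. For each basic open set
  \<open>V i\<close>, compact sets \<open>K1 i\<close> and \<open>K2 i\<close> approximate its
  preimage and the complement of that preimage from inside; on the intersection \<open>L\<close> of
  the unions, the preimage of \<open>V i\<close> is the trace of the open set
  \<open>- K2 i\<close>.\<close>

lemma radon_lusin:
  fixes P :: "'x::metric_space measure" and \<phi> :: "'x \<Rightarrow> 'y::second_countable_topology"
  assumes P: "radon_measure P" and fin: "finite_measure P"
    and \<phi>[measurable]: "\<phi> \<in> borel \<rightarrow>\<^sub>M borel" and e: "(e::real) > 0"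
  obtains L where "compact L" "continuous_on L \<phi>" "measure P (UNIV - L) < e"
proof -
  interpret finite_measure P by fact
  have sets[measurable_cong]: "sets P = sets borel"
    using P by (auto simp: radon_measure_def)
  obtain B :: "'y set set" where B: "countable B" "topological_basis B"
    using ex_countable_basis by blast
  \<comment> \<open>Adding the empty set makes nonemptiness, required by
    \<open>range_from_nat_into\<close>, immediate.\<close>
  define V where "V = from_nat_into (insert {} B)"
  have rangeV: "range V = insert {} B"
    unfolding V_def using B by (intro range_from_nat_into) auto
  have openV: "open (V i)" for i
    using rangeV B(2) by (metis insert_iff open_empty rangeI topological_basis_open)
  \<comment> \<open>Two errors \<open>d i\<close> per index amount to \<open>e / 2\<close> in total,
    which leaves room for the strict inequality.\<close>
  define d where "d i = e / 4 * (1/2)^Suc i" for i :: nat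
  have d: "d i > 0" for i using e by (simp add: d_def)
  have m: "\<phi> -` V i \<in> sets borel" "- (\<phi> -` V i) \<in> sets borel" for i
    using openV[of i] measurable_sets[OF \<phi>, of "V i"] by (auto simp: Compl_eq_Diff_UNIV)
  have "\<exists>K. compact K \<and> K \<subseteq> \<phi> -` V i \<and> measure P (\<phi> -` V i - K) < d i" for i
    by (rule radon_measure_inner[OF P fin m(1) d]) blast
  then obtain K1 where K1: "\<And>i. compact (K1 i)" "\<And>i. K1 i \<subseteq> \<phi> -` V i"
      "\<And>i. measure P (\<phi> -` V i - K1 i) < d i" by metis
  have "\<exists>K. compact K \<and> K \<subseteq> - (\<phi> -` V i) \<and> measure P (- (\<phi> -` V i) - K) < d i" for i
    by (rule radon_measure_inner[OF P fin m(2) d]) blast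
  then obtain K2 where K2: "\<And>i. compact (K2 i)" "\<And>i. K2 i \<subseteq> - (\<phi> -` V i)"
      "\<And>i. measure P (- (\<phi> -` V i) - K2 i) < d i" by metis
  define L where "L = (\<Inter>i. K1 i \<union> K2 i)"
  have "compact ((K1 0 \<union> K2 0) \<inter> L)"
    unfolding L_def using K1(1) K2(1)
    by (intro compact_Int_closed closed_INT compact_Un ballI compact_imp_closed) auto
  moreover have "(K1 0 \<union> K2 0) \<inter> L = L" by (auto simp: L_def)
  ultimately have "compact L" by simp
  moreover have "continuous_on L \<phi>"
    unfolding continuous_on_open_invariant
  proof (intro allI impI)
    fix W :: "'y set" assume W: "open W"
    have "\<exists>B'\<subseteq>B. \<Union> B' = W"
      using B(2) W by (simp add: topological_basis_def)
    then obtain B' where B': "B' \<subseteq> B" "\<Union> B' = W" by blast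
    have in_W: "\<exists>i. y \<in> V i \<and> V i \<subseteq> W" if y: "y \<in> W" for y
    proof -
      from y B' obtain U where U: "U \<in> B'" "y \<in> U" by auto
      with B' rangeV have "U \<in> range V" by auto
      then show ?thesis using U B' by auto
    qed
    have sub: "K2 i \<inter> K1 i = {}" "x \<in> L \<Longrightarrow> x \<in> K1 i \<or> x \<in> K2 i" for i x
      using K1(2)[of i] K2(2)[of i] by (auto simp: L_def)
    show "\<exists>A. open A \<and> A \<inter> L = \<phi> -` W \<inter> L"
    proof (intro exI conjI)
      show "open (\<Union>i\<in>{i. V i \<subseteq> W}. - K2 i)"
        using K2(1) by (intro open_UN ballI) (auto intro: compact_imp_closed)
      show "(\<Union>i\<in>{i. V i \<subseteq> W}. - K2 i) \<inter> L = \<phi> -` W \<inter> L"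
      proof (intro equalityI subsetI)
        fix x assume "x \<in> (\<Union>i\<in>{i. V i \<subseteq> W}. - K2 i) \<inter> L"
        then obtain i where i: "V i \<subseteq> W" "x \<notin> K2 i" "x \<in> L" by auto
        with sub(2)[of x i] K1(2)[of i] show "x \<in> \<phi> -` W \<inter> L" by auto
      next
        fix x assume x: "x \<in> \<phi> -` W \<inter> L"
        then obtain i where i: "\<phi> x \<in> V i" "V i \<subseteq> W" using in_W by auto
        with K2(2)[of i] have "x \<notin> K2 i" by auto
        with i x show "x \<in> (\<Union>i\<in>{i. V i \<subseteq> W}. - K2 i) \<inter> L" by auto
      qed
    qed
  qed
  moreover have "measure P (UNIV - L) < e"
  proof -
    have [measurable]: "K1 i \<in> sets borel" "K2 i \<in> sets borel" for i
      using K1(1) K2(1) by (auto intro: borel_compact)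
    have le: "measure P (UNIV - (K1 i \<union> K2 i)) \<le> e / 2 * (1/2)^Suc i" for i
    proof -
      have "measure P (UNIV - (K1 i \<union> K2 i)) \<le> measure P ((\<phi> -` V i - K1 i) \<union> (- (\<phi> -` V i) - K2 i))"
        using m[of i] by (intro finite_measure_mono) (auto simp: sets)
      also have "\<dots> \<le> measure P (\<phi> -` V i - K1 i) + measure P (- (\<phi> -` V i) - K2 i)"
        using m[of i] by (intro measure_Un_le) (auto simp: sets)
      also have "\<dots> \<le> d i + d i"
        using K1(3)[of i] K2(3)[of i] by linarith
      finally show ?thesis by (simp add: d_def)
    qed
    have sums: "(\<lambda>i. e / 2 * (1/2)^Suc i) sums (e / 2 * 1)"
      by (intro sums_mult power_half_series)
    have "summable (\<lambda>i. measure P (UNIV - (K1 i \<union> K2 i)))"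
      by (rule summable_comparison_test'[OF sums_summable[OF sums], of 0]) (use le in auto)
    then have "measure P (\<Union>i. UNIV - (K1 i \<union> K2 i)) \<le> (\<Sum>i. measure P (UNIV - (K1 i \<union> K2 i)))"
      by (intro finite_measure_subadditive_countably) (auto simp: sets)
    also have "\<dots> \<le> (\<Sum>i. e / 2 * (1/2)^Suc i)"
      using le sums 
      by (intro suminf_le sums_summable[OF sums] \<open>summable _\<close>) auto
    also have "\<dots> = e / 2" using sums by (simp add: sums_iff)
    also have "(\<Union>i. UNIV - (K1 i \<union> K2 i)) = UNIV - L" by (auto simp: L_def)
    finally show ?thesis using e by simp
  qed
  ultimately show ?thesis by (rule that)
qed

text \<open>The first differing digit decides, because the tail behind it is at most half the weight
  of digit \<open>n\<close>. Base 3 with digits 0 and 1 guarantees this gap; in base 2 a tail of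
  ones would equal the digit before it.\<close>

lemma ternary_suminf_less:
  fixes s s' :: "nat \<Rightarrow> bool"
  assumes eq: "\<And>i. i < n \<Longrightarrow> s i = s' i" and n: "s n" "\<not> s' n"
  shows "(\<Sum>i. of_bool (s' i) * (1/3::real)^Suc i) < (\<Sum>i. of_bool (s i) * (1/3)^Suc i)"
proof -
  have sm: "summable (\<lambda>i. of_bool (u i) * (1/3::real)^Suc i)" for u :: "nat \<Rightarrow> bool"
    by (rule summable_comparison_test'[of "\<lambda>i. (1/3)^Suc i" 0]) (auto intro: summable_geometric)
  have "(\<Sum>i. of_bool (s' i) * (1/3::real)^Suc i)
      = (\<Sum>i. of_bool (s' (i + Suc n)) * (1/3)^Suc (i + Suc n)) + (\<Sum>i<Suc n. of_bool (s' i) * (1/3)^Suc i)"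
    by (rule suminf_split_initial_segment[OF sm])
  also have "(\<Sum>i. of_bool (s' (i + Suc n)) * (1/3::real)^Suc (i + Suc n)) \<le> (\<Sum>i. (1/3)^(n+2) * (1/3)^i)"
    using sm[of s'] by (intro suminf_le summable_ignore_initial_segment summable_mult summable_geometric)
       (auto simp: power_add of_bool_def)
  also have "(\<Sum>i. (1/3)^(n+2) * (1/3::real)^i) = (1/3)^(n+2) * (3/2)"
    by (subst suminf_mult) (auto simp: suminf_geometric intro: summable_geometric)
  also have "(\<Sum>i<Suc n. of_bool (s' i) * (1/3::real)^Suc i) = (\<Sum>i<n. of_bool (s i) * (1/3)^Suc i)"
    using eq n by simp
  also have "(1/3)^(n+2) * (3/2) + (\<Sum>i<n. of_bool (s i) * (1/3)^Suc i)
      < (\<Sum>i<Suc n. of_bool (s i) * (1/3::real)^Suc i)"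
    using n by simp
  also have "\<dots> \<le> (\<Sum>i. of_bool (s i) * (1/3::real)^Suc i)"
    by (rule sum_le_suminf[OF sm]) auto
  finally show ?thesis by simp
qed

lemma inj_ternary_suminf:
  "inj (\<lambda>s :: nat \<Rightarrow> bool. \<Sum>i. of_bool (s i) * (1/3::real)^Suc i)"
proof (rule injI)
  fix s s' :: "nat \<Rightarrow> bool"
  assume eq: "(\<Sum>i. of_bool (s i) * (1/3::real)^Suc i) = (\<Sum>i. of_bool (s' i) * (1/3)^Suc i)"
  show "s = s'"
  proof (rule ccontr)
    assume "s \<noteq> s'"
    then have ex: "\<exists>n. s n \<noteq> s' n" by auto
    define n where "n = (LEAST n. s n \<noteq> s' n)"
    have n: "s n \<noteq> s' n" unfolding n_def by (rule LeastI_ex[OF ex])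
    have lt: "s i = s' i" if "i < n" for i using not_less_Least[OF that[unfolded n_def]] by simp
    show False
      using ternary_suminf_less[of n s s'] ternary_suminf_less[of n s' s] lt n eq by (cases "s n") auto
  qed
qed

text \<open>A one-sided substitute for a Borel isomorphism with a subset of the unit interval: a
  measure that does not charge \<open>- X0\<close> is recovered from its image under
  \<open>\<phi>\<close> by pushing it forward along \<open>\<psi>\<close>.\<close>

locale standard_pair =
  fixes \<phi> :: "'x::topological_space \<Rightarrow> real" and \<psi> :: "real \<Rightarrow> 'x" and X0 :: "'x set"
  assumes \<phi>_measurable[measurable]: "\<phi> \<in> borel_measurable borel"
    and \<phi>_bounds: "\<And>x. \<phi> x \<in> {0..1}"
    and \<psi>_measurable[measurable]: "\<psi> \<in> borel \<rightarrow>\<^sub>M borel"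
    and X0_borel[measurable]: "X0 \<in> sets borel"
    and \<psi>\<phi>: "\<And>x. x \<in> X0 \<Longrightarrow> \<psi> (\<phi> x) = x"

text \<open>The indicators of countably many balls separate the points of a \<open>\<sigma>\<close>-compact set of full measure,
  and their ternary code \<open>\<phi>\<close> is injective there. By Lusin's theorem \<open>\<phi>\<close> is a homeomorphism on compact
  sets that exhaust the space up to a null set, so its inverse is Borel. The countable set \<open>Q\<close> records
  that \<open>\<psi>\<close> has separable range.\<close>

lemma radon_standard:
  fixes P :: "'x::metric_space measure"
  assumes P: "radon_measure P" and prob: "prob_space P"
  obtains \<phi> :: "'x \<Rightarrow> real" and \<psi> :: "real \<Rightarrow> 'x" and X0 Q
  where "standard_pair \<phi> \<psi> X0" "emeasure P (- X0) = 0"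
    "countable Q" "\<And>r e. e > 0 \<Longrightarrow> \<exists>q\<in>Q. dist q (\<psi> r) < e"
proof -
  interpret prob_space P by fact
  have fin: "finite_measure P" by unfold_locales
  have sets[measurable_cong]: "sets P = sets borel"
    using P by (auto simp: radon_measure_def)
  have sp: "space P = UNIV" using sets_eq_imp_space_eq[OF sets] by simp
  have "\<exists>K. compact K \<and> measure P (UNIV - K) < inverse (Suc n)" for n
    by (rule radon_measure_inner[OF P fin, of UNIV "inverse (Suc n)"]) auto
  then obtain K where K: "\<And>n. compact (K n)" "\<And>n. measure P (UNIV - K n) < inverse (Suc n)"
    by metis
  have "\<exists>F. finite F \<and> K n \<subseteq> (\<Union>x\<in>F. ball x (inverse (Suc m)))" for n m
    using K(1)[of n, unfolded compact_eq_totally_bounded] by simp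
  then obtain F where F: "\<And>n m. finite (F n m)" "\<And>n m. K n \<subseteq> (\<Union>x\<in>F n m. ball x (inverse (Suc m)))"
    by metis
  define Q where "Q = (\<Union>n m. F n m)"
  have Q: "countable Q" unfolding Q_def using F(1) by (intro countable_UN countableI_type countable_finite) auto
  have dense: "\<exists>q\<in>Q. dist q x < inverse (Suc m)" if "x \<in> K n" for x n m
  proof -
    from that F(2)[of n m] obtain q where "q \<in> F n m" "x \<in> ball q (inverse (Suc m))" by blast
    then show ?thesis by (intro bexI[of _ q]) (auto simp: Q_def)
  qed
  define \<U> where "\<U> = insert {} ((\<lambda>(q, m). ball q (inverse (real (Suc m)))) ` (Q \<times> UNIV))"
  have \<U>: "countable \<U>" unfolding \<U>_def using Q by auto
  define U where "U = from_nat_into \<U>"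
  have rangeU: "range U = \<U>"
    unfolding U_def using \<U> by (intro range_from_nat_into) (auto simp: \<U>_def)
  have openU: "open (U i)" for i
  proof -
    have "U i \<in> \<U>" using rangeU by auto
    then show ?thesis by (auto simp: \<U>_def)
  qed
  \<comment> \<open>A ball around a net point near \<open>x\<close>, of radius below half the
    distance, cannot reach \<open>y\<close>.\<close>
  have sep: "\<exists>i. x \<in> U i \<and> y \<notin> U i" if x: "x \<in> K n" and ne: "x \<noteq> y" for x y n
  proof -
    obtain m where m: "inverse (real (Suc m)) < dist x y / 2"
      using reals_Archimedean[of "dist x y / 2"] ne by auto
    obtain q where q: "q \<in> Q" "dist q x < inverse (Suc m)" using dense[OF x] by blast
    have "ball q (inverse (real (Suc m))) \<in> \<U>" using q by (auto simp: \<U>_def)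
    then obtain i where i: "U i = ball q (inverse (real (Suc m)))" using rangeU by (metis rangeE)
    have "dist x y \<le> dist q x + dist q y" by (metis dist_triangle3)
    with m q have "y \<notin> U i" by (auto simp: i)
    with q i show ?thesis by (intro exI[of _ i]) auto
  qed
  define \<phi> where "\<phi> x = (\<Sum>i. of_bool (x \<in> U i) * (1/3::real)^Suc i)" for x
  have [measurable]: "U i \<in> sets borel" for i using openU by auto
  have \<phi>[measurable]: "\<phi> \<in> borel_measurable borel"
    unfolding \<phi>_def by measurable
  have sm: "summable (\<lambda>i. of_bool (u i) * (1/3::real)^Suc i)" for u :: "nat \<Rightarrow> bool"
    by (rule summable_comparison_test'[of "\<lambda>i. (1/3)^Suc i" 0]) (auto intro: summable_geometric)
  have \<phi>01: "\<phi> x \<in> {0..1}" for x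
  proof -
    have "\<phi> x \<le> (\<Sum>i. (1/3) * (1/3)^i)"
      unfolding \<phi>_def by (intro suminf_le sm summable_mult summable_geometric) auto
    also have "\<dots> \<le> 1"
      by (subst suminf_mult) (auto simp: suminf_geometric intro: summable_geometric)
    finally have "\<phi> x \<le> 1" .
    moreover have "\<phi> x \<ge> 0" unfolding \<phi>_def by (intro suminf_nonneg sm) auto
    ultimately show ?thesis by simp
  qed
  have inj: "inj_on \<phi> (\<Union>n. K n)"
  proof (rule inj_onI, rule ccontr)
    fix x y assume xy: "x \<in> (\<Union>n. K n)" "\<phi> x = \<phi> y" "x \<noteq> y"
    have "(\<lambda>i. x \<in> U i) = (\<lambda>i. y \<in> U i)"
      using xy(2) unfolding \<phi>_def by (rule injD[OF inj_ternary_suminf])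
    with sep xy show False by (metis UN_E)
  qed
  have "\<exists>L. compact L \<and> continuous_on L \<phi> \<and> measure P (UNIV - L) < inverse (Suc n)" for n
    by (rule radon_lusin[OF P fin \<phi>, of "inverse (Suc n)"]) auto
  then obtain L where L: "\<And>n. compact (L n)" "\<And>n. continuous_on (L n) \<phi>"
      "\<And>n. measure P (UNIV - L n) < inverse (Suc n)" by metis
  \<comment> \<open>\<open>K n\<close> contributes injectivity of \<open>\<phi>\<close>,
    \<open>L n\<close> its continuity; for large \<open>n\<close> both miss little mass.\<close>
  define X where "X n = K n \<inter> L n" for n
  define X0 where "X0 = (\<Union>n. X n)"
  have Xc: "compact (X n)" for n
    unfolding X_def using K(1) L(1) by (auto intro: compact_Int)
  have [measurable]: "K n \<in> sets borel" "L n \<in> sets borel" "X n \<in> sets borel" for n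
    using K(1) L(1) Xc by (auto intro: borel_compact)
  have X0[measurable]: "X0 \<in> sets borel" unfolding X0_def by measurable
  have injX: "inj_on \<phi> X0" using inj by (rule inj_on_subset) (auto simp: X0_def X_def)
  have "measure P (- X0) \<le> e" if e: "e > 0" for e
  proof -
    obtain n where n: "inverse (real (Suc n)) < e / 2" using reals_Archimedean[of "e/2"] e by auto
    have "measure P (- X0) \<le> measure P ((UNIV - K n) \<union> (UNIV - L n))"
      by (intro finite_measure_mono) (auto simp: X0_def X_def)
    also have "\<dots> \<le> measure P (UNIV - K n) + measure P (UNIV - L n)"
      by (intro measure_Un_le) auto
    finally show ?thesis using K(2)[of n] L(3)[of n] n by linarith
  qed
  then have "measure P (- X0) \<le> 0" using field_le_epsilon[of "measure P (- X0)" 0] by auto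
  then have null: "emeasure P (- X0) = 0" by (simp add: emeasure_eq_measure measure_le_0_iff)
  have "X0 \<noteq> {}"
    using null emeasure_space_1 by (auto simp: sp)
  then obtain x0 where x0: "x0 \<in> X0" by blast
  \<comment> \<open>The default value lies in \<open>X0\<close>, so that the whole range of
    \<open>\<psi>\<close> stays in the separable set approximated by \<open>Q\<close>.\<close>
  define \<psi> where "\<psi> r = (if r \<in> \<phi> ` X0 then the_inv_into X0 \<phi> r else x0)" for r
  have \<psi>\<phi>: "\<psi> (\<phi> x) = x" if "x \<in> X0" for x
    using that injX by (simp add: \<psi>_def the_inv_into_f_f)
  have \<psi>X: "\<psi> r \<in> X0" for r
    using x0 injX by (auto simp: \<psi>_def the_inv_into_f_f)
  have "\<phi> ` (X n \<inter> S) \<in> sets borel" if "closed S" for S n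
    using that Xc[of n] L(2)[of n]
    by (intro borel_compact compact_continuous_image compact_Int_closed)
       (auto intro: continuous_on_subset simp: X_def)
  then have img: "\<phi> ` (X0 \<inter> S) \<in> sets borel" if "closed S" for S
  proof -
    have "\<phi> ` (X0 \<inter> S) = (\<Union>n. \<phi> ` (X n \<inter> S))" by (auto simp: X0_def)
    with that \<open>\<And>S n. closed S \<Longrightarrow> \<phi> ` (X n \<inter> S) \<in> sets borel\<close> show ?thesis by auto
  qed
  have \<psi>: "\<psi> \<in> borel \<rightarrow>\<^sub>M borel"
    unfolding borel_eq_closed[where 'a='x]
  proof (rule measurable_measure_of)
    fix S :: "'x set" assume "S \<in> {S. closed S}"
    then have S: "closed S" by simp
    have "\<psi> -` S \<inter> space borel = \<phi> ` (X0 \<inter> S) \<union> (if x0 \<in> S then - \<phi> ` (X0 \<inter> UNIV) else {})"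
      using injX by (auto simp: \<psi>_def the_inv_into_f_f split: if_splits)
    also have "\<dots> \<in> sets borel"
      using img[OF S] img[OF closed_UNIV] by (auto simp: Compl_eq_Diff_UNIV)
    finally show "\<psi> -` S \<inter> space borel \<in> sets borel" .
  qed auto
  have dense_\<psi>: "\<exists>q\<in>Q. dist q (\<psi> r) < e" if e: "e > 0" for r e
  proof -
    obtain m where m: "inverse (real (Suc m)) < e" using reals_Archimedean[OF e] by auto
    obtain n where "\<psi> r \<in> K n" using \<psi>X[of r] by (auto simp: X0_def X_def)
    then obtain q where "q \<in> Q" "dist q (\<psi> r) < inverse (Suc m)" using dense by blast
    with m show ?thesis by (intro bexI[of _ q]) auto
  qed
  have "standard_pair \<phi> \<psi> X0"
    using \<phi> \<phi>01 \<psi> X0 \<psi>\<phi> by (rule standard_pair.intro)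
  from this null Q dense_\<psi> show ?thesis by (rule that)
qed

section \<open>Densities depending measurably on a parameter\<close>

text \<open>Names the cell of \<open>y\<close> in the partition generated by the first
  \<open>n\<close> sets. A shorter code is a prefix of a longer one, which expresses that the
  partitions refine each other.\<close>

definition membership :: "(nat \<Rightarrow> 'b set) \<Rightarrow> nat \<Rightarrow> 'b \<Rightarrow> bool list" where
  "membership C n y = map (\<lambda>i. y \<in> C i) [0..<n]"

lemma membership_measurable:
  assumes [measurable]: "\<And>i. C i \<in> sets M"
  shows "membership C n \<in> M \<rightarrow>\<^sub>M count_space UNIV"
proof -
  have "{y \<in> space M. membership C n y = l}
      = {y \<in> space M. length l = n \<and> (\<forall>i\<in>{..<n}. (y \<in> C i) = l ! i)}" for l
    by (auto simp: membership_def list_eq_iff_nth_eq)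
  then have "{y \<in> space M. membership C n y = l} \<in> sets M" for l by simp
  then show ?thesis
    by (auto simp: measurable_count_space_eq2_countable vimage_def Int_def conj_commute)
qed

text \<open>Setwise domination places the density of \<open>\<nu>\<close> in the unit interval, so
  that the martingale below is bounded and convergence in mean square is available.\<close>

locale dominated_pair = prob_space \<mu> for \<mu> :: "'b measure" +
  fixes \<nu> :: "'b measure" and C :: "nat \<Rightarrow> 'b set"
  assumes sets_\<nu>: "sets \<nu> = sets \<mu>"
    and \<nu>_le: "\<And>S. S \<in> sets \<mu> \<Longrightarrow> emeasure \<nu> S \<le> emeasure \<mu> S"
    and C_generates: "sets \<mu> = sigma_sets (space \<mu>) (range C)"
begin

abbreviation code :: "nat \<Rightarrow> 'b \<Rightarrow> bool list" where
  "code \<equiv> membership C"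

text \<open>The ratios form the martingale of densities of \<open>\<nu>\<close> with respect to \<open>\<mu>\<close> along the finite partitions
  given by \<open>code\<close>. In Isabelle \<open>0 / 0 = 0\<close>, which is harmless since \<open>\<nu>\<close> vanishes where \<open>\<mu>\<close> does.\<close>

definition ratio :: "nat \<Rightarrow> bool list \<Rightarrow> real" where
  "ratio n l = measure \<nu> {x \<in> space \<mu>. code n x = l} / measure \<mu> {x \<in> space \<mu>. code n x = l}"

lemma sets_\<nu>_cong[measurable_cong]: "sets \<nu> = sets \<mu>" by (rule sets_\<nu>)

lemma space_\<nu>: "space \<nu> = space \<mu>" using sets_\<nu> by (rule sets_eq_imp_space_eq)

lemma C_sets[measurable]: "C i \<in> sets \<mu>"
  unfolding C_generates by (rule sigma_sets.Basic) auto

lemma finite_measure_\<nu>: "finite_measure \<nu>"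
proof
  have "emeasure \<nu> (space \<mu>) \<le> emeasure \<mu> (space \<mu>)" by (rule \<nu>_le) auto
  then show "emeasure \<nu> (space \<nu>) \<noteq> \<infinity>" by (auto simp: space_\<nu> emeasure_space_1 top_unique)
qed

lemma measure_\<nu>_le: "S \<in> sets \<mu> \<Longrightarrow> measure \<nu> S \<le> measure \<mu> S"
  using \<nu>_le[of S] finite_measure_\<nu>
  by (simp add: emeasure_eq_measure finite_measure.emeasure_eq_measure)

lemma code_measurable[measurable]: "code n \<in> \<mu> \<rightarrow>\<^sub>M count_space UNIV"
  by (rule membership_measurable) (rule C_sets)

lemma length_code: "length (code n y) = n"
  by (simp add: membership_def)

lemma take_code: "n \<le> m \<Longrightarrow> take n (code m y) = code n y"
  by (simp add: membership_def take_map)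

lemma ratio_bounds: "0 \<le> ratio n l" "ratio n l \<le> 1"
proof -
  have "measure \<nu> {x \<in> space \<mu>. code n x = l} \<le> measure \<mu> {x \<in> space \<mu>. code n x = l}"
    by (rule measure_\<nu>_le) measurable
  then show "ratio n l \<le> 1" unfolding ratio_def by (intro divide_le_eq_1[THEN iffD2]) (auto simp: zero_less_measure_iff)
qed (simp add: ratio_def)

lemma finite_length: "finite {l :: bool list. length l = n}"
  using finite_lists_length_eq[of "UNIV :: bool set" n] by simp

lemma bounded_code: "\<exists>B. \<forall>y. \<bar>h (code n y)\<bar> \<le> (B::real)"
proof (intro exI allI)
  fix y show "\<bar>h (code n y)\<bar> \<le> (\<Sum>l\<in>{l. length l = n}. \<bar>h l\<bar>)"
    by (rule member_le_sum) (auto simp: length_code finite_length)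
qed

lemma integrable_code:
  assumes "finite_measure M" "sets M = sets \<mu>"
  shows "integrable M (\<lambda>y. h (code n y) :: real)"
proof -
  note [measurable_cong] = assms(2)
  obtain B where "\<And>y. \<bar>h (code n y)\<bar> \<le> B" using bounded_code by blast
  then show ?thesis
    by (intro finite_measure.integrable_const_bound[OF assms(1), where B=B]) auto
qed

lemma integral_code:
  assumes "finite_measure M" "sets M = sets \<mu>"
  shows "(\<integral>y. h (code n y) \<partial>M) = (\<Sum>l\<in>{l. length l = n}. h l * measure M {x \<in> space \<mu>. code n x = l})"
proof -
  interpret M: finite_measure M by fact
  note [measurable_cong] = assms(2)
  have sp: "space M = space \<mu>" using assms(2) by (rule sets_eq_imp_space_eq)
  have "(\<integral>y. h (code n y) \<partial>M)
      = (\<integral>y. (\<Sum>l\<in>{l. length l = n}. h l * indicator {x \<in> space \<mu>. code n x = l} y) \<partial>M)"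
  proof (rule Bochner_Integration.integral_cong)
    fix y assume "y \<in> space M"
    then have "(\<Sum>l\<in>{l. length l = n}. h l * indicator {x \<in> space \<mu>. code n x = l} y)
        = (\<Sum>l\<in>{l. length l = n}. if l = code n y then h l else 0)"
      by (intro sum.cong) (auto simp: sp)
    also have "\<dots> = h (code n y)"
      by (simp add: finite_length length_code)
    finally show "h (code n y) = (\<Sum>l\<in>{l. length l = n}. h l * indicator {x \<in> space \<mu>. code n x = l} y)" ..
  qed simp
  also have "\<dots> = (\<Sum>l\<in>{l. length l = n}. \<integral>y. h l * indicator {x \<in> space \<mu>. code n x = l} y \<partial>M)"
    by (rule Bochner_Integration.integral_sum) (auto simp: less_top[symmetric])
  also have "\<dots> = (\<Sum>l\<in>{l. length l = n}. h l * measure M {x \<in> space \<mu>. code n x = l})"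
    by (intro sum.cong) (auto simp: sp intro!: arg_cong[where f="measure M"])
  finally show ?thesis .
qed

text \<open>The martingale property in weak form: against a function of the coarser code,
  \<open>ratio m\<close> acts as the density of \<open>\<nu>\<close>. On each cell
  \<open>ratio\<close> times the \<open>\<mu>\<close>-mass is the \<open>\<nu>\<close>-mass, also on
  null cells by domination.\<close>

lemma integral_code_ratio:
  assumes "n \<le> m"
  shows "(\<integral>y. u (code n y) * ratio m (code m y) \<partial>\<mu>) = (\<integral>y. u (code n y) \<partial>\<nu>)"
proof -
  have "(\<integral>y. u (code n y) * ratio m (code m y) \<partial>\<mu>) = (\<integral>y. (\<lambda>l. u (take n l) * ratio m l) (code m y) \<partial>\<mu>)"
    using assms by (simp add: take_code)
  also have "\<dots> = (\<Sum>l\<in>{l. length l = m}. u (take n l) * ratio m l * measure \<mu> {x \<in> space \<mu>. code m x = l})"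
    by (rule integral_code) (auto intro: finite_measure_axioms)
  also have "\<dots> = (\<Sum>l\<in>{l. length l = m}. u (take n l) * measure \<nu> {x \<in> space \<mu>. code m x = l})"
  proof (rule sum.cong[OF refl])
    fix l :: "bool list"
    have "measure \<nu> {x \<in> space \<mu>. code m x = l} \<le> measure \<mu> {x \<in> space \<mu>. code m x = l}"
      by (rule measure_\<nu>_le) measurable
    then have "ratio m l * measure \<mu> {x \<in> space \<mu>. code m x = l} = measure \<nu> {x \<in> space \<mu>. code m x = l}"
      using measure_nonneg[of \<nu> "{x \<in> space \<mu>. code m x = l}"] 
      unfolding ratio_def by (cases "measure \<mu> {x \<in> space \<mu>. code m x = l} = 0") auto
    then show "u (take n l) * ratio m l * measure \<mu> {x \<in> space \<mu>. code m x = l}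
        = u (take n l) * measure \<nu> {x \<in> space \<mu>. code m x = l}" by simp
  qed
  also have "\<dots> = (\<integral>y. (\<lambda>l. u (take n l)) (code m y) \<partial>\<nu>)"
    by (rule integral_code[symmetric, OF finite_measure_\<nu> sets_\<nu>])
  also have "\<dots> = (\<integral>y. u (code n y) \<partial>\<nu>)"
    using assms by (simp add: take_code)
  finally show ?thesis .
qed

definition energy :: "nat \<Rightarrow> real" where
  "energy n = (\<integral>y. (ratio n (code n y))\<^sup>2 \<partial>\<mu>)"

text \<open>Orthogonality of martingale increments: testing the finer ratio against the coarser one
  yields \<open>energy n\<close>, so expanding the square leaves a difference of energies.\<close>

lemma integral_ratio_diff:
  assumes "n \<le> m"
  shows "(\<integral>y. (ratio m (code m y) - ratio n (code n y))\<^sup>2 \<partial>\<mu>) = energy m - energy n"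
proof -
  have int: "integrable \<mu> (\<lambda>y. ratio n (code n y) * ratio m (code m y))" if "n \<le> m" for n m
    using integrable_code[of \<mu> "\<lambda>l. ratio n (take n l) * ratio m l" m] finite_measure_axioms that
    by (simp add: take_code)
  have cross: "(\<integral>y. ratio n (code n y) * ratio m (code m y) \<partial>\<mu>) = energy n"
    using integral_code_ratio[OF assms, of "ratio n"] integral_code_ratio[OF order_refl, of "ratio n" n]
    by (simp add: energy_def power2_eq_square)
  have "(\<integral>y. (ratio m (code m y) - ratio n (code n y))\<^sup>2 \<partial>\<mu>)
      = (\<integral>y. ratio m (code m y) * ratio m (code m y) - 2 * (ratio n (code n y) * ratio m (code m y))
             + ratio n (code n y) * ratio n (code n y) \<partial>\<mu>)"
    by (intro Bochner_Integration.integral_cong) (auto simp: power2_eq_square algebra_simps)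
  also have "\<dots> = energy m - 2 * (\<integral>y. ratio n (code n y) * ratio m (code m y) \<partial>\<mu>) + energy n"
    using int[OF order_refl] int[OF assms] by (simp add: energy_def power2_eq_square)
  finally show ?thesis by (simp add: cross)
qed

lemma energy_mono: "n \<le> m \<Longrightarrow> energy n \<le> energy m"
proof -
  assume "n \<le> m"
  have "0 \<le> (\<integral>y. (ratio m (code m y) - ratio n (code n y))\<^sup>2 \<partial>\<mu>)"
    by (rule Bochner_Integration.integral_nonneg) simp
  with integral_ratio_diff[OF \<open>n \<le> m\<close>] show ?thesis by simp
qed

lemma energy_le_1: "energy n \<le> 1"
proof -
  have "energy n \<le> (\<integral>y. 1 \<partial>\<mu>)"
    unfolding energy_def using integrable_code[of \<mu> "\<lambda>l. (ratio n l)\<^sup>2" n] finite_measure_axioms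
    by (intro integral_mono) (auto simp: ratio_bounds power_le_one)
  then show ?thesis by (simp add: prob_space)
qed

text \<open>Consecutive terms are within 2^-k in mean square. Their mean absolute differences are
  therefore summable, and the telescoping series converges absolutely almost everywhere.\<close>

lemma ratio_AE_convergent:
  assumes K: "\<And>k m. K k \<le> m \<Longrightarrow> energy m - energy (K k) \<le> (1/4)^k"
  shows "AE y in \<mu>. convergent (\<lambda>k. ratio (K k) (code (K k) y))"
proof -
  define g where "g k y = ratio (K k) (code (K k) y)" for k y
  have [measurable]: "g k \<in> borel_measurable \<mu>" for k unfolding g_def by measurable
  have g_bounds: "0 \<le> g k y" "g k y \<le> 1" for k y by (auto simp: g_def ratio_bounds)
  \<comment> \<open>\<open>K\<close> is not assumed monotone. If it decreases at \<open>k\<close>,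
    the coarser level is \<open>K (Suc k)\<close> and its sharper bound applies.\<close>
  have sq: "(\<integral>y. (g (Suc k) y - g k y)\<^sup>2 \<partial>\<mu>) \<le> (1/4)^k" for k
  proof (cases "K k \<le> K (Suc k)")
    case True
    then show ?thesis using integral_ratio_diff[OF True] K[of k "K (Suc k)"] by (simp add: g_def)
  next
    case False
    have "(\<integral>y. (g (Suc k) y - g k y)\<^sup>2 \<partial>\<mu>) = (\<integral>y. (g k y - g (Suc k) y)\<^sup>2 \<partial>\<mu>)"
      by (simp add: power2_commute)
    also have "\<dots> \<le> (1/4)^Suc k"
      using integral_ratio_diff[of "K (Suc k)" "K k"] K[of "Suc k" "K k"] False by (simp add: g_def)
    also have "\<dots> \<le> (1/4)^k" by simp
    finally show ?thesis .
  qed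
  have bnd: "\<bar>g (Suc k) y - g k y\<bar> \<le> 1" for k y
    using g_bounds[of k y] g_bounds[of "Suc k" y] by (auto simp: abs_le_iff)
  have int1: "integrable \<mu> (\<lambda>y. \<bar>g (Suc k) y - g k y\<bar>)" for k
    using bnd by (intro integrable_const_bound[where B=1]) auto
  have int2: "integrable \<mu> (\<lambda>y. (g (Suc k) y - g k y)\<^sup>2)" for k
    using bnd by (intro integrable_const_bound[where B=1]) (auto simp: abs_square_le_1)
  have abs: "(\<integral>y. \<bar>g (Suc k) y - g k y\<bar> \<partial>\<mu>) \<le> 2 * (1/2)^k" for k
  proof -
    \<comment> \<open>AM-GM: \<open>\<bar>d\<bar> \<le> 2\<^sup>-\<^sup>k + 2\<^sup>k d\<^sup>2\<close>\<close>
    have amgm: "\<bar>d\<bar> \<le> (1/2)^k + 2^k * d\<^sup>2" for d :: real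
    proof -
      have "0 \<le> (1 - 2^k * \<bar>d\<bar>)\<^sup>2" by simp
      then have "2 * (2^k * \<bar>d\<bar>) \<le> 1 + (2^k)\<^sup>2 * d\<^sup>2"
        by (simp add: power2_diff power_mult_distrib)
      moreover have "0 \<le> 2^k * \<bar>d\<bar>" by simp
      ultimately have "2^k * \<bar>d\<bar> \<le> 1 + (2^k)\<^sup>2 * d\<^sup>2" by linarith
      then have "2^k * \<bar>d\<bar> \<le> 2^k * ((1/2)^k + 2^k * d\<^sup>2)"
        by (simp add: distrib_left power2_eq_square power_one_over)
      then show ?thesis by simp
    qed
    have "(\<integral>y. \<bar>g (Suc k) y - g k y\<bar> \<partial>\<mu>) \<le> (\<integral>y. (1/2)^k + 2^k * (g (Suc k) y - g k y)\<^sup>2 \<partial>\<mu>)"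
      using int1 int2 amgm by (intro integral_mono) auto
    also have "\<dots> = (1/2)^k + 2^k * (\<integral>y. (g (Suc k) y - g k y)\<^sup>2 \<partial>\<mu>)"
      using int2 by (simp add: prob_space)
    also have "\<dots> \<le> (1/2)^k + 2^k * (1/4)^k" using sq by (intro add_left_mono mult_left_mono) auto
    also have "\<dots> = 2 * (1/2)^k" by (simp flip: power_mult_distrib)
    finally show ?thesis .
  qed
  have "(\<integral>\<^sup>+y. (\<Sum>k. ennreal \<bar>g (Suc k) y - g k y\<bar>) \<partial>\<mu>) = (\<Sum>k. \<integral>\<^sup>+y. ennreal \<bar>g (Suc k) y - g k y\<bar> \<partial>\<mu>)"
    by (rule nn_integral_suminf) measurable
  also have "\<dots> \<le> (\<Sum>k. ennreal (2 * (1/2)^k))"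
    using abs int1 by (intro suminf_le) (auto simp: nn_integral_eq_integral intro!: ennreal_leI)
  also have "\<dots> = ennreal (\<Sum>k. 2 * (1/2)^k)"
    by (rule suminf_ennreal2) (auto intro: summable_mult summable_geometric)
  also have "\<dots> < \<infinity>" by simp
  finally have "AE y in \<mu>. (\<Sum>k. ennreal \<bar>g (Suc k) y - g k y\<bar>) \<noteq> \<infinity>"
    by (intro nn_integral_PInf_AE) auto
  then show ?thesis
  proof (eventually_elim)
    fix y assume "(\<Sum>k. ennreal \<bar>g (Suc k) y - g k y\<bar>) \<noteq> \<infinity>"
    then have "summable (\<lambda>k. \<bar>g (Suc k) y - g k y\<bar>)"
      by (intro summable_suminf_not_top) auto
    then have "summable (\<lambda>k. g (Suc k) y - g k y)" by (rule summable_rabs_cancel)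
    then have "convergent (\<lambda>n. \<Sum>k<n. g (Suc k) y - g k y)" by (simp add: summable_iff_convergent)
    then have "convergent (\<lambda>n. g n y - g 0 y)" by (simp add: sum_lessThan_telescope[of "\<lambda>n. g n y"])
    then have "convergent (\<lambda>n. (g n y - g 0 y) + g 0 y)" by (intro convergent_add convergent_const)
    then show "convergent (\<lambda>k. ratio (K k) (code (K k) y))" by (simp add: g_def)
  qed
qed

text \<open>On a set determined by \<open>code n\<close> the integrals of the ratios equal its
  \<open>\<nu>\<close>-mass as soon as \<open>K k\<close> reaches \<open>n\<close>, which
  \<open>k \<le> K k\<close> ensures. Dominated convergence carries this to the limit, and these
  sets form an intersection-stable generator. The truncation to the unit interval keeps the density
  bounded where \<open>lim\<close> is unspecified.\<close>

lemma emeasure_eq_lim_ratio: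
  assumes K: "\<And>k m. K k \<le> m \<Longrightarrow> energy m - energy (K k) \<le> (1/4)^k" and le: "\<And>k. k \<le> K k"
    and S: "S \<in> sets \<mu>"
  shows "emeasure \<nu> S = (\<integral>\<^sup>+y\<in>S. ennreal (max 0 (min 1 (lim (\<lambda>k. ratio (K k) (code (K k) y))))) \<partial>\<mu>)"
proof -
  define g where "g k y = ratio (K k) (code (K k) y)" for k y
  have [measurable]: "g k \<in> borel_measurable \<mu>" for k unfolding g_def by measurable
  have g_bounds: "0 \<le> g k y" "g k y \<le> 1" for k y by (auto simp: g_def ratio_bounds)
  define G where "G y = max 0 (min 1 (lim (\<lambda>k. g k y)))" for y
  have [measurable]: "G \<in> borel_measurable \<mu>" unfolding G_def by measurable
  have AE_conv: "AE y in \<mu>. convergent (\<lambda>k. ratio (K k) (code (K k) y))"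
    by (rule ratio_AE_convergent) (rule K)
  have conv: "AE y in \<mu>. (\<lambda>k. g k y) \<longlonglongrightarrow> G y"
    using AE_conv
  proof eventually_elim
    fix y assume "convergent (\<lambda>k. ratio (K k) (code (K k) y))"
    then have lim: "(\<lambda>k. g k y) \<longlonglongrightarrow> lim (\<lambda>k. g k y)" by (simp add: g_def convergent_LIMSEQ_iff)
    have "0 \<le> lim (\<lambda>k. g k y)" by (rule LIMSEQ_le_const[OF lim]) (auto simp: g_bounds)
    moreover have "lim (\<lambda>k. g k y) \<le> 1" by (rule LIMSEQ_le_const2[OF lim]) (auto simp: g_bounds)
    ultimately have "G y = lim (\<lambda>k. g k y)" by (simp add: G_def)
    with lim show "(\<lambda>k. g k y) \<longlonglongrightarrow> G y" by simp
  qed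
  have G_bounds: "0 \<le> G y" "G y \<le> 1" for y by (auto simp: G_def)
  interpret \<nu>: finite_measure \<nu> by (rule finite_measure_\<nu>)
  define E where "E = (\<Union>n. (\<lambda>U. code n -` U \<inter> space \<mu>) ` UNIV)"
  have EI: "code n -` U \<inter> space \<mu> \<in> E" for n U by (auto simp: E_def)
  have E_sets: "E \<subseteq> sets \<mu>"
    unfolding E_def by (auto intro: measurable_sets)
  have eqE: "emeasure \<nu> X = emeasure (density \<mu> (\<lambda>y. ennreal (G y))) X" if "X \<in> E" for X
  proof -
    obtain n U where X: "X = code n -` U \<inter> space \<mu>" using \<open>X \<in> E\<close> by (auto simp: E_def)
    have [measurable]: "X \<in> sets \<mu>" using \<open>X \<in> E\<close> E_sets by auto
    have ind: "indicator X y = (indicator U (code n y) :: real)" if "y \<in> space \<mu>" for y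
      using that by (auto simp: X indicator_def)
    have "(\<lambda>k. \<integral>y. indicator X y * g k y \<partial>\<mu>) \<longlonglongrightarrow> (\<integral>y. indicator X y * G y \<partial>\<mu>)"
    proof (rule integral_dominated_convergence[where w="\<lambda>_. 1"])
      show "AE y in \<mu>. (\<lambda>k. indicator X y * g k y) \<longlonglongrightarrow> indicator X y * G y"
        using conv by eventually_elim (intro tendsto_mult tendsto_const)
      show "AE y in \<mu>. norm (indicator X y * g k y) \<le> 1" for k
        using g_bounds by (auto simp: indicator_def)
    qed auto
    moreover have "eventually (\<lambda>k. (\<integral>y. indicator X y * g k y \<partial>\<mu>) = measure \<nu> X) sequentially"
      using eventually_ge_at_top[of n]
    proof eventually_elim
      fix k assume "n \<le> k"
      then have nK: "n \<le> K k" using le[of k] by simp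
      have "(\<integral>y. indicator X y * g k y \<partial>\<mu>) = (\<integral>y. indicator U (code n y) * ratio (K k) (code (K k) y) \<partial>\<mu>)"
        by (intro Bochner_Integration.integral_cong) (auto simp: ind g_def)
      also have "\<dots> = (\<integral>y. indicator U (code n y) \<partial>\<nu>)" by (rule integral_code_ratio[OF nK])
      also have "\<dots> = (\<integral>y. indicator X y \<partial>\<nu>)"
        by (intro Bochner_Integration.integral_cong) (auto simp: ind space_\<nu>)
      also have "\<dots> = measure \<nu> X" using sets.sets_into_space[of X \<mu>] by (simp add: Int_absorb1 space_\<nu> Int_commute)
      finally show "(\<integral>y. indicator X y * g k y \<partial>\<mu>) = measure \<nu> X" .
    qed
    ultimately have "(\<integral>y. indicator X y * G y \<partial>\<mu>) = measure \<nu> X"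
      using LIMSEQ_unique[OF _ tendsto_eventually] by blast
    then have "emeasure \<nu> X = ennreal (\<integral>y. indicator X y * G y \<partial>\<mu>)"
      by (simp add: \<nu>.emeasure_eq_measure)
    also have "\<dots> = (\<integral>\<^sup>+y. ennreal (indicator X y * G y) \<partial>\<mu>)"
      using G_bounds by (intro nn_integral_eq_integral[symmetric] integrable_const_bound[where B=1])
        (auto simp: indicator_def)
    also have "\<dots> = emeasure (density \<mu> (\<lambda>y. ennreal (G y))) X"
      by (subst emeasure_density) (auto intro!: nn_integral_cong simp: indicator_def)
    finally show ?thesis .
  qed
  have stable: "Int_stable E"
  proof (rule Int_stableI)
    fix a b assume "a \<in> E" "b \<in> E"
    then obtain n U m V where ab: "a = code n -` U \<inter> space \<mu>" "b = code m -` V \<inter> space \<mu>"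
      by (auto simp: E_def)
    have "a \<inter> b = code (max n m) -` {l. take n l \<in> U \<and> take m l \<in> V} \<inter> space \<mu>"
      by (auto simp: ab take_code)
    then show "a \<inter> b \<in> E" by (simp only: EI)
  qed
  have gen: "sets \<mu> = sigma_sets (space \<mu>) E"
  proof
    have "C i \<in> E" for i
    proof -
      have "C i = code (Suc i) -` {l. l ! i} \<inter> space \<mu>"
        using sets.sets_into_space[OF C_sets[of i]] by (auto simp: membership_def nth_append)
      then show ?thesis by (simp only: EI)
    qed
    then show "sets \<mu> \<subseteq> sigma_sets (space \<mu>) E"
      unfolding C_generates by (intro sigma_sets_mono') auto
    show "sigma_sets (space \<mu>) E \<subseteq> sets \<mu>" by (rule sets.sigma_sets_subset[OF E_sets])
  qed
  have "\<nu> = density \<mu> (\<lambda>y. ennreal (G y))"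
  proof (rule measure_eqI_generator_eq[OF stable _ eqE, where A="\<lambda>_. space \<mu>" and \<Omega>="space \<mu>"])
    have "space \<mu> = code 0 -` UNIV \<inter> space \<mu>" by auto
    then show "range (\<lambda>_. space \<mu>) \<subseteq> E" by (auto simp: E_def)
    show "emeasure \<nu> (space \<mu>) \<noteq> \<infinity>" by (auto simp: \<nu>.emeasure_eq_measure)
    show "E \<subseteq> Pow (space \<mu>)" by (auto simp: E_def)
  qed (auto simp: gen sets_\<nu>)
  then have "emeasure \<nu> S = emeasure (density \<mu> (\<lambda>y. ennreal (G y))) S" by simp
  also have "\<dots> = (\<integral>\<^sup>+y\<in>S. ennreal (G y) \<partial>\<mu>)" using S by (subst emeasure_density) auto
  finally show ?thesis by (simp add: G_def g_def)
qed

end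

text \<open>The martingale of ratios converges in \<open>L\<^sup>2\<close> for each parameter \<open>a\<close>. The indices \<open>K a k\<close> of an
  almost surely convergent subsequence can be chosen measurably in \<open>a\<close>, because the \<open>L\<^sup>2\<close> distances
  are differences of energies.\<close>

lemma kernel_density:
  fixes \<mu> \<nu> :: "'a \<Rightarrow> 'b measure" and C :: "nat \<Rightarrow> 'b set"
  assumes C: "sets N = sigma_sets (space N) (range C)"
    and sets_\<mu>: "\<And>a. a \<in> space M \<Longrightarrow> sets (\<mu> a) = sets N"
    and sets_\<nu>: "\<And>a. a \<in> space M \<Longrightarrow> sets (\<nu> a) = sets N"
    and \<mu>[measurable]: "\<And>S. S \<in> sets N \<Longrightarrow> (\<lambda>a. emeasure (\<mu> a) S) \<in> borel_measurable M"
    and \<nu>[measurable]: "\<And>S. S \<in> sets N \<Longrightarrow> (\<lambda>a. emeasure (\<nu> a) S) \<in> borel_measurable M"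
    and prob: "\<And>a. a \<in> space M \<Longrightarrow> prob_space (\<mu> a)"
    and le: "\<And>a S. a \<in> space M \<Longrightarrow> S \<in> sets N \<Longrightarrow> emeasure (\<nu> a) S \<le> emeasure (\<mu> a) S"
  obtains g :: "'a \<times> 'b \<Rightarrow> real" where "g \<in> borel_measurable (M \<Otimes>\<^sub>M N)"
    "\<And>x. 0 \<le> g x" "\<And>x. g x \<le> 1"
    "\<And>a S. a \<in> space M \<Longrightarrow> S \<in> sets N \<Longrightarrow> emeasure (\<nu> a) S = (\<integral>\<^sup>+y\<in>S. ennreal (g (a, y)) \<partial>\<mu> a)"
proof -
  let ?code = "membership C"
  define cell where "cell n l = {x \<in> space N. ?code n x = l}" for n l
  define r where "r n l a = measure (\<nu> a) (cell n l) / measure (\<mu> a) (cell n l)" for n l a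
  define L where "L n = {l :: bool list. length l = n}" for n
  \<comment> \<open>The energy as a finite sum over cells, the form in which measurability in
    \<open>a\<close> is visible.\<close>
  define e where "e n a = (\<Sum>l\<in>L n. (r n l a)\<^sup>2 * measure (\<mu> a) (cell n l))" for n a
  have [measurable]: "C i \<in> sets N" for i unfolding C by (rule sigma_sets.Basic) auto
  have dp: "dominated_pair (\<mu> a) (\<nu> a) C" if "a \<in> space M" for a
    using that prob sets_\<mu> sets_\<nu> le sets_eq_imp_space_eq[OF sets_\<mu>] C
    by (auto simp: dominated_pair_def dominated_pair_axioms_def)
  have sp: "space (\<mu> a) = space N" if "a \<in> space M" for a
    using sets_eq_imp_space_eq[OF sets_\<mu>[OF that]] .
  have ratio_eq: "dominated_pair.ratio (\<mu> a) (\<nu> a) C n l = r n l a" if "a \<in> space M" for a n l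
    using dominated_pair.ratio_def[OF dp[OF that]] that by (simp add: r_def cell_def sp)
  have energy_eq: "dominated_pair.energy (\<mu> a) (\<nu> a) C n = e n a" if a: "a \<in> space M" for a n
  proof -
    interpret dominated_pair "\<mu> a" "\<nu> a" C by (rule dp[OF a])
    show ?thesis
      unfolding energy_def using integral_code[of "\<mu> a" "\<lambda>l. (ratio n l)\<^sup>2" n] finite_measure_axioms a
      by (simp add: e_def L_def cell_def ratio_eq sp)
  qed
  have code_meas[measurable]: "?code n \<in> N \<rightarrow>\<^sub>M count_space UNIV" for n
    by (rule membership_measurable) measurable
  have cell[measurable]: "cell n l \<in> sets N" for n l unfolding cell_def by measurable
  have r_meas[measurable]: "r n l \<in> borel_measurable M" for n l
    unfolding r_def measure_def by measurable
  have e_meas[measurable]: "e n \<in> borel_measurable M" for n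
    unfolding e_def measure_def by measurable
  \<comment> \<open>The clause \<open>k \<le> n\<close> drives the indices to infinity; the rest is
    a countable conjunction, so the least good index is measurable in \<open>a\<close>.\<close>
  define good where "good a k n \<longleftrightarrow> k \<le> n \<and> (\<forall>m\<ge>n. e m a - e n a \<le> (1/4)^k)" for a k n
  define K where "K a k = (LEAST n. good a k n)" for a k
  have [measurable]: "Measurable.pred M (\<lambda>a. good a k n)" for k n
    unfolding good_def by measurable
  have K_meas[measurable]: "(\<lambda>a. K a k) \<in> M \<rightarrow>\<^sub>M count_space UNIV" for k
    unfolding K_def by measurable
  have good: "good a k (K a k)" if a: "a \<in> space M" for a k
  proof -
    interpret dominated_pair "\<mu> a" "\<nu> a" C by (rule dp[OF a])
    have "incseq (\<lambda>n. e n a)" using energy_mono by (auto simp: incseq_def energy_eq[OF a])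
    moreover have "\<forall>n. e n a \<le> 1" using energy_le_1 by (auto simp: energy_eq[OF a])
    ultimately obtain E where E: "(\<lambda>n. e n a) \<longlonglongrightarrow> E" "\<And>n. e n a \<le> E" 
      using incseq_convergent by metis
    have "eventually (\<lambda>n. e n a > E - (1/4)^k) sequentially"
      using E(1) by (intro order_tendstoD) auto
    then obtain n where n: "\<And>m. n \<le> m \<Longrightarrow> e m a > E - (1/4)^k"
      by (auto simp: eventually_sequentially)
    have "good a k (max n k)"
      unfolding good_def using n[of "max n k"] E(2) by (auto simp: algebra_simps) (smt (verit))
    then show ?thesis unfolding K_def by (rule LeastI)
  qed
  define g where "g x = max 0 (min 1 (lim (\<lambda>k. r (K (fst x) k) (?code (K (fst x) k) (snd x)) (fst x))))" for x
  show ?thesis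
  proof (rule that[of g])
    \<comment> \<open>Index and code range over countable types, so substituting them into a family
      of measurable functions preserves measurability.\<close>
    have "(\<lambda>x. r (K (fst x) k) (?code (K (fst x) k) (snd x)) (fst x)) \<in> borel_measurable (M \<Otimes>\<^sub>M N)" for k
    proof (rule measurable_compose_countable[of "\<lambda>n x. r n (?code n (snd x)) (fst x)" _ _ "\<lambda>x. K (fst x) k"])
      fix n show "(\<lambda>x. r n (?code n (snd x)) (fst x)) \<in> borel_measurable (M \<Otimes>\<^sub>M N)"
        by (rule measurable_compose_countable[of "\<lambda>l x. r n l (fst x)" _ _ "\<lambda>x. ?code n (snd x)"]) measurable
    qed measurable
    then show "g \<in> borel_measurable (M \<Otimes>\<^sub>M N)" unfolding g_def by measurable
    show "0 \<le> g x" "g x \<le> 1" for x by (auto simp: g_def)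
    fix a S assume a: "a \<in> space M" and S: "S \<in> sets N"
    interpret dominated_pair "\<mu> a" "\<nu> a" C by (rule dp[OF a])
    have "emeasure (\<nu> a) S = (\<integral>\<^sup>+y\<in>S. ennreal (max 0 (min 1 (lim (\<lambda>k. ratio (K a k) (?code (K a k) y))))) \<partial>\<mu> a)"
      using good[OF a] S by (intro emeasure_eq_lim_ratio) (auto simp: good_def energy_eq[OF a] sets_\<mu>[OF a])
    then show "emeasure (\<nu> a) S = (\<integral>\<^sup>+y\<in>S. ennreal (g (a, y)) \<partial>\<mu> a)"
      by (simp add: g_def ratio_eq[OF a])
  qed
qed

section \<open>Disintegration of kernels on the real line\<close>

lemma countably_generated_sequence:
  assumes "countably_generated N"
  obtains C :: "nat \<Rightarrow> 'b set" where "sets N = sigma_sets (space N) (range C)"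
proof -
  obtain \<C> where \<C>: "countable \<C>" "\<C> \<subseteq> Pow (space N)" "sets N = sigma_sets (space N) \<C>"
    using assms by (auto simp: countably_generated_def)
  have "range (from_nat_into (insert {} \<C>)) = insert {} \<C>"
    using \<C>(1) by (intro range_from_nat_into) auto
  moreover have "sigma_sets (space N) (insert {} \<C>) = sigma_sets (space N) \<C>"
    by (intro sigma_sets_eqI) (auto intro: sigma_sets.Empty)
  ultimately show ?thesis using \<C>(3) that by metis
qed

text \<open>The test set is where the inequality fails; finiteness of the integral of
  \<open>g\<close> makes the comparison there strict.\<close>

lemma AE_le_of_set_nn_integral_le:
  assumes [measurable]: "f \<in> borel_measurable M" "g \<in> borel_measurable M"
    and fin: "(\<integral>\<^sup>+x. g x \<partial>M) < \<infinity>"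
    and le: "\<And>A. A \<in> sets M \<Longrightarrow> (\<integral>\<^sup>+x\<in>A. f x \<partial>M) \<le> (\<integral>\<^sup>+x\<in>A. g x \<partial>M)"
  shows "AE x in M. f x \<le> (g x :: ennreal)"
proof -
  define A where "A = {x \<in> space M. g x < f x}"
  have [measurable]: "A \<in> sets M" unfolding A_def by measurable
  have "(\<integral>\<^sup>+x\<in>A. g x \<partial>M) \<le> (\<integral>\<^sup>+x. g x \<partial>M)"
    by (intro nn_integral_mono) (auto simp: indicator_def)
  with fin have finA: "(\<integral>\<^sup>+x\<in>A. g x \<partial>M) \<noteq> \<infinity>" by (auto simp: top_unique)
  have "AE x in M. f x * indicator A x \<le> g x * indicator A x"
  proof (rule ccontr)
    assume "\<not> ?thesis"
    then have "(\<integral>\<^sup>+x\<in>A. g x \<partial>M) < (\<integral>\<^sup>+x\<in>A. f x \<partial>M)"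
      using finA by (intro nn_integral_less) (auto simp: A_def indicator_def intro!: AE_I2)
    with le[of A] show False by simp
  qed
  then show ?thesis
    by (rule AE_mp) (auto simp: A_def indicator_def not_less[symmetric] intro!: AE_I2 split: if_splits)
qed

lemma AE_eq_of_set_nn_integral_eq:
  assumes "f \<in> borel_measurable M" "g \<in> borel_measurable M"
    and "(\<integral>\<^sup>+x. g x \<partial>M) < \<infinity>"
    and "\<And>A. A \<in> sets M \<Longrightarrow> (\<integral>\<^sup>+x\<in>A. f x \<partial>M) = (\<integral>\<^sup>+x\<in>A. g x \<partial>M)"
  shows "AE x in M. f x = (g x :: ennreal)"
proof -
  have "(\<integral>\<^sup>+x. f x \<partial>M) = (\<integral>\<^sup>+x. g x \<partial>M)"
    using assms(4)[OF sets.top] by (simp cong: nn_integral_cong)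
  then have "AE x in M. f x \<le> g x" "AE x in M. g x \<le> f x"
    using assms by (auto intro!: AE_le_of_set_nn_integral_le)
  then show ?thesis by eventually_elim auto
qed

text \<open>Right-continuity: rationals above \<open>x\<close> come arbitrarily close to it.\<close>

lemma le_cdf_of_rational:
  assumes m: "finite_borel_measure m" and le: "\<And>q. q \<in> \<rat> \<Longrightarrow> x < q \<Longrightarrow> c \<le> cdf m q"
  shows "c \<le> cdf m x"
proof (rule field_le_epsilon)
  interpret finite_borel_measure m by fact
  fix e :: real assume "e > 0"
  then obtain d where d: "d > 0" "cdf m (x + d) - cdf m x < e"
    using cdf_is_right_cont[of x] cdf_nondecreasing
    by (subst (asm) continuous_at_right_real_increasing) auto
  obtain q where q: "q \<in> \<rat>" "x < q" "q < x + d"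
    using Rats_dense_in_real[of x "x + d"] d by auto
  have "cdf m q \<le> cdf m (x + d)" using q by (intro cdf_nondecreasing) auto
  with le[OF q(1,2)] d show "c \<le> cdf m x + e" by simp
qed

lemma finite_borel_measure_eqI_rational:
  assumes m: "finite_borel_measure m" and m': "finite_borel_measure m'"
    and eq: "\<And>q. q \<in> \<rat> \<Longrightarrow> emeasure m {..q} = emeasure m' {..q}"
  shows "m = m'"
proof (rule cdf_unique'[OF m m'], rule ext, rule antisym)
  interpret m: finite_borel_measure m by fact
  interpret m': finite_borel_measure m' by fact
  have eq': "cdf m q = cdf m' q" if "q \<in> \<rat>" for q
    using eq[OF that] by (simp add: cdf_def measure_def)
  fix x
  have "cdf m x \<le> cdf m' q" if "q \<in> \<rat>" "x < q" for q
    unfolding eq'[OF that(1), symmetric] using that(2) by (intro m.cdf_nondecreasing) simp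
  then show "cdf m x \<le> cdf m' x" by (rule le_cdf_of_rational[OF m'])
  have "cdf m' x \<le> cdf m q" if "q \<in> \<rat>" "x < q" for q
    unfolding eq'[OF that(1)] using that(2) by (intro m'.cdf_nondecreasing) simp
  then show "cdf m' x \<le> cdf m x" by (rule le_cdf_of_rational[OF m])
qed

text \<open>Freezing the event \<open>B\<close> in the second coordinate turns a statement about
  rectangles into one about measures on the line, which distribution functions decide.\<close>

lemma finite_borel_measure_section:
  fixes J :: "(real \<times> 'b) measure"
  assumes J: "finite_measure J" and sets_J[measurable_cong]: "sets J = sets (borel \<Otimes>\<^sub>M N)" and [measurable]: "B \<in> sets N"
  defines "m \<equiv> distr (density J (indicator (UNIV \<times> B))) borel fst"
  shows "finite_borel_measure m" "\<And>S. S \<in> sets borel \<Longrightarrow> emeasure m S = emeasure J (S \<times> B)"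
proof -
  interpret finite_measure J by fact
  have sp: "space J = UNIV \<times> space N"
    using sets_eq_imp_space_eq[OF sets_J] by (simp add: space_pair_measure)
  have B: "B \<subseteq> space N" using \<open>B \<in> sets N\<close> by (rule sets.sets_into_space)
  show eq: "emeasure m S = emeasure J (S \<times> B)" if [measurable]: "S \<in> sets borel" for S
  proof -
    have "emeasure m S = emeasure (density J (indicator (UNIV \<times> B))) (S \<times> space N)"
      unfolding m_def by (subst emeasure_distr) (auto simp: sp intro!: arg_cong2[where f=emeasure])
    also have "\<dots> = (\<integral>\<^sup>+z. indicator (UNIV \<times> B) z * indicator (S \<times> space N) z \<partial>J)"
      by (subst emeasure_density) auto
    also have "\<dots> = (\<integral>\<^sup>+z. indicator (S \<times> B) z \<partial>J)"
      using B by (intro nn_integral_cong) (auto simp: indicator_def)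
    also have "\<dots> = emeasure J (S \<times> B)" by (rule nn_integral_indicator) measurable
    finally show ?thesis .
  qed
  have "finite_measure m"
    by (intro finite_measureI) (simp add: m_def[symmetric] eq, simp add: m_def eq[unfolded m_def])
  then show "finite_borel_measure m"
    by (intro finite_borel_measure.intro finite_borel_measure_axioms.intro) (auto simp: m_def)
qed

text \<open>Taking the infimum over rational arguments makes the family of conditional distribution functions
  monotone and right-continuous for every \<open>z\<close>, without discarding a null set.\<close>

definition rational_inf :: "(real \<Rightarrow> 'z \<Rightarrow> real) \<Rightarrow> 'z \<Rightarrow> real \<Rightarrow> real" where
  "rational_inf G z x = (INF q\<in>{q \<in> \<rat>. x < q}. G q z)"

lemma rational_above_nonempty: "{q \<in> \<rat>. x < (q::real)} \<noteq> {}"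
  using Rats_dense_in_real[of x "x + 1"] by auto

text \<open>Since the infimum runs over \<open>q\<close> strictly above \<open>x\<close>, a rational
  nearly attaining it at \<open>a\<close> also bounds the function on the interval from
  \<open>a\<close> up to that rational; this is right-continuity. The fixed values of
  \<open>G\<close> below 0 and from 1 on give the limits.\<close>

lemma real_distribution_rational_inf:
  fixes G :: "real \<Rightarrow> 'z \<Rightarrow> real"
  assumes ge: "\<And>q z. 0 \<le> G q z" and le: "\<And>q z. G q z \<le> 1"
    and G0: "\<And>q z. q < 0 \<Longrightarrow> G q z = 0" and G1: "\<And>q z. 1 \<le> q \<Longrightarrow> G q z = 1"
  shows "real_distribution (interval_measure (rational_inf G z))"
    and "emeasure (interval_measure (rational_inf G z)) {..x} = ennreal (rational_inf G z x)"
proof -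
  let ?F = "rational_inf G z"
  have bdd: "bdd_below ((\<lambda>q. G q z) ` A)" for A
    using ge by (intro bdd_belowI[of _ 0]) auto
  have F_le: "?F x \<le> G q z" if "q \<in> \<rat>" "x < q" for x q
    unfolding rational_inf_def using that by (intro cINF_lower bdd) auto
  have F_ge: "c \<le> ?F x" if "\<And>q. q \<in> \<rat> \<Longrightarrow> x < q \<Longrightarrow> c \<le> G q z" for c x
    unfolding rational_inf_def using that by (intro cINF_greatest rational_above_nonempty) auto
  have mono: "?F x \<le> ?F y" if "x \<le> y" for x y
    using that by (intro F_ge F_le) auto
  have right: "continuous (at_right a) ?F" for a
  proof (subst continuous_at_right_real_increasing)
    show "\<forall>e>0. \<exists>d>0. ?F (a + d) - ?F a < e"
    proof (intro allI impI)
      fix e :: real assume "e > 0"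
      then have "\<not> ?F a + e \<le> ?F a" by simp
      then obtain q where q: "q \<in> \<rat>" "a < q" "G q z < ?F a + e"
        using F_ge[of a "?F a + e"] by force
      then have "?F (a + (q - a) / 2) \<le> G q z" by (intro F_le) (auto simp: field_simps)
      with q show "\<exists>d>0. ?F (a + d) - ?F a < e"
        by (intro exI[of _ "(q - a) / 2"]) auto
    qed
  qed (rule mono)
  have "?F x = 0" if "x < -1" for x
  proof -
    obtain q where q: "q \<in> \<rat>" "x < q" "q < 0" using Rats_dense_in_real[of x 0] \<open>x < -1\<close> by auto
    with F_le[of q x] G0 F_ge[of x 0] ge show ?thesis by auto
  qed
  then have bot: "(?F \<longlongrightarrow> 0) at_bot"
    by (intro tendsto_eventually) (auto simp: eventually_at_bot_dense)
  have "?F x = 1" if "1 \<le> x" for x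
  proof -
    obtain q where "q \<in> \<rat>" "x < q" using rational_above_nonempty[of x] by blast
    with F_le[of q x] F_ge[of x 1] G1 le that show ?thesis by (intro antisym) (auto intro: order_trans)
  qed
  then have top: "(?F \<longlongrightarrow> 1) at_top"
    by (intro tendsto_eventually) (auto simp: eventually_at_top_linorder)
  show rd: "real_distribution (interval_measure ?F)"
    by (rule real_distribution_interval_measure[OF mono right bot top])
  interpret real_distribution "interval_measure ?F" by (rule rd)
  have "cdf (interval_measure ?F) x = ?F x"
    by (subst cdf_interval_measure[OF mono right bot]) auto
  then show "emeasure (interval_measure ?F) {..x} = ennreal (?F x)"
    by (simp add: cdf_def emeasure_eq_measure)
qed

lemma rational_inf_measurable:
  assumes "\<And>q. G q \<in> borel_measurable M" "\<And>q z. 0 \<le> G q z"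
  shows "(\<lambda>z. rational_inf G z x) \<in> borel_measurable M"
  unfolding rational_inf_def using assms
  by (intro borel_measurable_cINF) (auto intro!: countable_subset[OF _ countable_rat] bdd_belowI[of _ 0])

text \<open>For each \<open>q\<close> the density \<open>G q (a, t)\<close> is a version of the
  conditional distribution function at \<open>q\<close> given \<open>t\<close>, and
  \<open>rational_inf\<close> regularises the family. For fixed \<open>B\<close> the claim is
  equality of two measures \<open>m\<close> and \<open>m'\<close> on the line.\<close>

lemma kernel_disintegration:
  fixes J :: "'a \<Rightarrow> (real \<times> 'b) measure"
  assumes N: "countably_generated N"
    and J[measurable]: "J \<in> M \<rightarrow>\<^sub>M prob_algebra (borel \<Otimes>\<^sub>M N)"
    and supp: "\<And>a. a \<in> space M \<Longrightarrow> AE z in J a. fst z \<in> {0..1}"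
  obtains \<nu> :: "'a \<times> 'b \<Rightarrow> real measure" where "\<nu> \<in> M \<Otimes>\<^sub>M N \<rightarrow>\<^sub>M prob_algebra borel"
    "\<And>a S B. a \<in> space M \<Longrightarrow> S \<in> sets borel \<Longrightarrow> B \<in> sets N \<Longrightarrow>
       emeasure (J a) (S \<times> B) = (\<integral>\<^sup>+t\<in>B. emeasure (\<nu> (a, t)) S \<partial>distr (J a) N snd)"
proof -
  obtain C :: "nat \<Rightarrow> 'b set" where C: "sets N = sigma_sets (space N) (range C)"
    using countably_generated_sequence[OF N] by blast
  have J_prob: "prob_space (J a)" and J_sets: "sets (J a) = sets (borel \<Otimes>\<^sub>M N)" if "a \<in> space M" for a
    using measurable_space[OF J that] by (auto simp: space_prob_algebra)
  have J_space: "space (J a) = UNIV \<times> space N" if "a \<in> space M" for a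
    using sets_eq_imp_space_eq[OF J_sets[OF that]] by (simp add: space_pair_measure)
  have J_meas[measurable]: "(\<lambda>a. emeasure (J a) S) \<in> borel_measurable M" if "S \<in> sets (borel \<Otimes>\<^sub>M N)" for S
    using measurable_prob_algebraD[OF J] that by measurable
  define \<mu> where "\<mu> a = distr (J a) N snd" for a
  define low where "low x a = distr (density (J a) (indicator ({..x} \<times> space N))) N snd" for x :: real and a
  have \<mu>_eq: "emeasure (\<mu> a) B = emeasure (J a) (UNIV \<times> B)" if a: "a \<in> space M" and B: "B \<in> sets N" for a B
  proof -
    note [measurable_cong] = J_sets[OF a]
    show ?thesis
      unfolding \<mu>_def using B sets.sets_into_space[OF B]
      by (subst emeasure_distr) (auto simp: J_space[OF a] intro!: arg_cong2[where f=emeasure])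
  qed
  have low_eq: "emeasure (low x a) B = emeasure (J a) ({..x} \<times> B)" if a: "a \<in> space M" and B[measurable]: "B \<in> sets N" for x a B
  proof -
    note [measurable_cong] = J_sets[OF a]
    have "emeasure (low x a) B = emeasure (density (J a) (indicator ({..x} \<times> space N))) (UNIV \<times> B)"
      unfolding low_def using sets.sets_into_space[OF B]
      by (subst emeasure_distr) (auto simp: J_space[OF a] intro!: arg_cong2[where f=emeasure])
    also have "\<dots> = (\<integral>\<^sup>+z. indicator ({..x} \<times> space N) z * indicator (UNIV \<times> B) z \<partial>J a)"
      by (subst emeasure_density) auto
    also have "\<dots> = (\<integral>\<^sup>+z. indicator ({..x} \<times> B) z \<partial>J a)"
      using sets.sets_into_space[OF B] by (intro nn_integral_cong) (auto simp: indicator_def)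
    also have "\<dots> = emeasure (J a) ({..x} \<times> B)" by (rule nn_integral_indicator) measurable
    finally show ?thesis .
  qed
  have \<mu>_prob: "prob_space (\<mu> a)" if a: "a \<in> space M" for a
    unfolding \<mu>_def using J_sets[OF a]
    by (intro prob_space.prob_space_distr J_prob a) (simp cong: measurable_cong_sets)
  have "\<exists>g. g \<in> borel_measurable (M \<Otimes>\<^sub>M N) \<and> (\<forall>z. 0 \<le> g z \<and> g z \<le> 1) \<and>
     (\<forall>a\<in>space M. \<forall>B\<in>sets N. emeasure (low x a) B = (\<integral>\<^sup>+y\<in>B. ennreal (g (a, y)) \<partial>\<mu> a))" for x
  proof (rule kernel_density[OF C, of M \<mu> "low x"])
    fix B assume B[measurable]: "B \<in> sets N"
    show "(\<lambda>a. emeasure (\<mu> a) B) \<in> borel_measurable M"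
      by (subst measurable_cong[OF \<mu>_eq]) (use B in auto)
    show "(\<lambda>a. emeasure (low x a) B) \<in> borel_measurable M"
      by (subst measurable_cong[OF low_eq]) (use B in auto)
    show "emeasure (low x a) B \<le> emeasure (\<mu> a) B" if a: "a \<in> space M" for a
      unfolding \<mu>_eq[OF a B] low_eq[OF a B] by (intro emeasure_mono) (auto simp: J_sets[OF a])
  next
    fix g :: "'a \<times> 'b \<Rightarrow> real"
    assume "g \<in> borel_measurable (M \<Otimes>\<^sub>M N)" "\<And>x. 0 \<le> g x" "\<And>x. g x \<le> 1"
      "\<And>a S. a \<in> space M \<Longrightarrow> S \<in> sets N \<Longrightarrow> emeasure (low x a) S = (\<integral>\<^sup>+y\<in>S. ennreal (g (a, y)) \<partial>\<mu> a)"
    then show ?thesis by (intro exI[of _ g]) auto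
  qed (auto simp: \<mu>_def low_def \<mu>_prob[unfolded \<mu>_def])
  then obtain g where g[measurable]: "\<And>x. g x \<in> borel_measurable (M \<Otimes>\<^sub>M N)"
    and g_bounds: "\<And>x z. 0 \<le> g x z" "\<And>x z. g x z \<le> 1"
    and g_eq: "\<And>x a B. a \<in> space M \<Longrightarrow> B \<in> sets N \<Longrightarrow> emeasure (low x a) B = (\<integral>\<^sup>+y\<in>B. ennreal (g x (a, y)) \<partial>\<mu> a)"
    by metis
  \<comment> \<open>Overwriting the density outside the interval from 0 to 1 agrees with
    \<open>J a\<close> by the support hypothesis, and gives the boundary values at every
    \<open>z\<close> rather than almost everywhere.\<close>
  define G where "G q z = (if 1 \<le> q then 1 else if q < 0 then 0 else g q z)" for q z
  have G_meas[measurable]: "G q \<in> borel_measurable (M \<Otimes>\<^sub>M N)" for q unfolding G_def by measurable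
  have G_ge: "0 \<le> G q z" and G_le: "G q z \<le> 1" and G0: "q < 0 \<Longrightarrow> G q z = 0" and G1: "1 \<le> q \<Longrightarrow> G q z = 1" for q z
    using g_bounds by (auto simp: G_def)
  have G_eq: "emeasure (J a) ({..q} \<times> B) = (\<integral>\<^sup>+t\<in>B. ennreal (G q (a, t)) \<partial>\<mu> a)"
    if a: "a \<in> space M" and B: "B \<in> sets N" for a B q
  proof -
    note [measurable_cong] = J_sets[OF a]
    have [measurable]: "B \<in> sets (\<mu> a)" using B by (simp add: \<mu>_def)
    consider "1 \<le> q" | "q < 0" | "0 \<le> q" "q < 1" by linarith
    then show ?thesis
    proof cases
      case 1
      have "emeasure (J a) ({..q} \<times> B) = emeasure (J a) (UNIV \<times> B)"
      proof (rule emeasure_eq_AE)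
        show "AE z in J a. (z \<in> {..q} \<times> B) = (z \<in> UNIV \<times> B)"
          using supp[OF a] by eventually_elim (use 1 in auto)
      qed (use B in auto)
      with 1 show ?thesis by (simp add: G1 \<mu>_eq[OF a B, symmetric])
    next
      case 2
      have "emeasure (J a) ({..q} \<times> B) = emeasure (J a) {}"
      proof (rule emeasure_eq_AE)
        show "AE z in J a. (z \<in> {..q} \<times> B) = (z \<in> {})"
          using supp[OF a] by eventually_elim (use 2 in auto)
      qed (use B in auto)
      with 2 show ?thesis by (simp add: G0)
    next
      case 3
      then show ?thesis using g_eq[OF a B] low_eq[OF a B] by (simp add: G_def)
    qed
  qed
  define \<nu> where "\<nu> z = interval_measure (rational_inf G z)" for z
  have \<nu>_dist: "real_distribution (\<nu> z)" and \<nu>_Iic: "emeasure (\<nu> z) {..x} = ennreal (rational_inf G z x)" for z x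
    unfolding \<nu>_def by (rule real_distribution_rational_inf[OF G_ge G_le G0 G1]; assumption)+
  have inf_meas[measurable]: "(\<lambda>z. rational_inf G z x) \<in> borel_measurable (M \<Otimes>\<^sub>M N)" for x
    by (rule rational_inf_measurable) (auto simp: G_ge)
  have \<nu>_meas[measurable]: "\<nu> \<in> M \<Otimes>\<^sub>M N \<rightarrow>\<^sub>M prob_algebra borel"
  proof (rule measurable_prob_algebra_generated[where \<Omega>=UNIV and G="range (\<lambda>x::real. {..x})"])
    show "sets borel = sigma_sets UNIV (range (\<lambda>x::real. {..x}))"
      by (simp add: borel_eq_atMost)
    show "Int_stable (range (\<lambda>x::real. {..x}))" by (auto simp: Int_stable_def)
    show "prob_space (\<nu> z)" for z using \<nu>_dist[of z] by (simp add: real_distribution_def)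
    show "sets (\<nu> z) = sets borel" for z using \<nu>_dist[of z] by (simp add: \<nu>_def)
    show "(\<lambda>z. emeasure (\<nu> z) A) \<in> borel_measurable (M \<Otimes>\<^sub>M N)" if "A \<in> range (\<lambda>x::real. {..x})" for A
      using that by (auto simp: \<nu>_Iic)
  qed auto
  show ?thesis
  proof (rule that[OF \<nu>_meas])
    fix a :: 'a and S :: "real set" and B :: "'b set"
    assume a: "a \<in> space M" and S: "S \<in> sets borel" and B: "B \<in> sets N"
    interpret J: prob_space "J a" by (rule J_prob[OF a])
    interpret \<mu>: prob_space "\<mu> a" by (rule \<mu>_prob[OF a])
    have sets_\<mu>[measurable_cong]: "sets (\<mu> a) = sets N" by (simp add: \<mu>_def)
    have [measurable]: "B \<in> sets (\<mu> a)" using B by (simp add: \<mu>_def)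
    have G_a[measurable]: "(\<lambda>t. G q (a, t)) \<in> borel_measurable (\<mu> a)" for q
      using a by measurable
    have inf_a[measurable]: "(\<lambda>t. rational_inf G (a, t) x) \<in> borel_measurable (\<mu> a)" for x
      using measurable_compose[OF measurable_Pair1'[OF a] inf_meas] by measurable
    have \<nu>_a[measurable]: "(\<lambda>t. \<nu> (a, t)) \<in> \<mu> a \<rightarrow>\<^sub>M subprob_algebra borel"
      using measurable_compose[OF measurable_Pair1'[OF a] measurable_prob_algebraD[OF \<nu>_meas]] by measurable
    define m where "m = distr (density (J a) (indicator (UNIV \<times> B))) borel fst"
    have m: "finite_borel_measure m" and m_eq: "\<And>S. S \<in> sets borel \<Longrightarrow> emeasure m S = emeasure (J a) (S \<times> B)"
      unfolding m_def using J.finite_measure_axioms J_sets[OF a] B by (auto intro: finite_borel_measure_section)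
    interpret m: finite_borel_measure m by (rule m)
    \<comment> \<open>The mixture of the constructed kernel over \<open>B\<close>, to be compared
      with the section \<open>m\<close> of \<open>J a\<close>.\<close>
    define m' where "m' = density (\<mu> a) (indicator B) \<bind> (\<lambda>t. \<nu> (a, t))"
    have m'_eq: "emeasure m' S = (\<integral>\<^sup>+t\<in>B. emeasure (\<nu> (a, t)) S \<partial>\<mu> a)" if [measurable]: "S \<in> sets borel" for S
    proof -
      have "emeasure m' S = (\<integral>\<^sup>+t. emeasure (\<nu> (a, t)) S \<partial>density (\<mu> a) (indicator B))"
        unfolding m'_def using \<mu>.not_empty by (intro emeasure_bind[where N=borel]) auto
      also have "\<dots> = (\<integral>\<^sup>+t\<in>B. emeasure (\<nu> (a, t)) S \<partial>\<mu> a)"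
        by (subst nn_integral_density) (auto intro!: nn_integral_cong simp: mult.commute)
      finally show ?thesis .
    qed
    have sets_m': "sets m' = sets borel"
      unfolding m'_def using \<mu>.not_empty
      by (intro sets_bind) (use subprob_measurableD[OF \<nu>_a] in auto)
    have sp_m': "space m' = UNIV" using sets_eq_imp_space_eq[OF sets_m'] by simp
    have m'_fin: "finite_measure m'"
    proof (rule finite_measureI)
      have "emeasure (\<nu> z) UNIV \<le> 1" for z
        using \<nu>_dist[of z] by (simp add: real_distribution_def prob_space.measure_le_1)
      then have "emeasure m' (space m') \<le> (\<integral>\<^sup>+t. 1 \<partial>\<mu> a)"
        unfolding sp_m' m'_eq[OF sets.top[of borel, unfolded space_borel]]
        by (intro nn_integral_mono) (auto simp: indicator_def)
      also have "\<dots> < \<infinity>" by (simp add: \<mu>.emeasure_space_1)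
      finally show "emeasure m' (space m') \<noteq> \<infinity>" by simp
    qed
    then have m': "finite_borel_measure m'"
      using sets_m' by (intro finite_borel_measure.intro finite_borel_measure_axioms.intro) auto
    interpret m': finite_borel_measure m' by (rule m')
    have "emeasure m {..x} = emeasure m' {..x}" for x
    proof (rule antisym)
      \<comment> \<open>Monotonicity in \<open>q\<close> holds only almost surely for each pair;
        countably many rationals \<open>q\<close> share one null set, so \<open>G x\<close> lies
        below the infimum almost surely.\<close>
      have "AE t in \<mu> a. ennreal (G x (a, t)) \<le> ennreal (G q (a, t))" if "x < q" for q
      proof (rule AE_le_of_set_nn_integral_le)
        show "(\<integral>\<^sup>+t. ennreal (G q (a, t)) \<partial>\<mu> a) < \<infinity>"
        proof -
          have "(\<integral>\<^sup>+t. ennreal (G q (a, t)) \<partial>\<mu> a) \<le> (\<integral>\<^sup>+t. 1 \<partial>\<mu> a)"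
            by (intro nn_integral_mono) (simp add: G_le)
          also have "\<dots> < \<infinity>" by (simp add: \<mu>.emeasure_space_1)
          finally show ?thesis .
        qed
        show "(\<integral>\<^sup>+t\<in>A. ennreal (G x (a, t)) \<partial>\<mu> a) \<le> (\<integral>\<^sup>+t\<in>A. ennreal (G q (a, t)) \<partial>\<mu> a)"
          if "A \<in> sets (\<mu> a)" for A
        proof -
          have A: "A \<in> sets N" using that sets_\<mu> by simp
          show ?thesis unfolding G_eq[OF a A, symmetric]
            using A \<open>x < q\<close> by (intro emeasure_mono) (auto simp: J_sets[OF a])
        qed
      qed measurable
      then have "AE t in \<mu> a. \<forall>q\<in>{q \<in> \<rat>. x < q}. ennreal (G x (a, t)) \<le> ennreal (G q (a, t))"
        by (subst AE_ball_countable) (auto intro: countable_subset[OF _ countable_rat])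
      then have "AE t in \<mu> a. ennreal (G x (a, t)) \<le> ennreal (rational_inf G (a, t) x)"
        by eventually_elim (auto simp: rational_inf_def G_ge intro!: ennreal_leI cINF_greatest rational_above_nonempty)
      then have "(\<integral>\<^sup>+t\<in>B. ennreal (G x (a, t)) \<partial>\<mu> a) \<le> (\<integral>\<^sup>+t\<in>B. ennreal (rational_inf G (a, t) x) \<partial>\<mu> a)"
        by (intro nn_integral_mono_AE) (auto elim!: eventually_mono intro: mult_right_mono)
      then show "emeasure m {..x} \<le> emeasure m' {..x}"
        by (simp add: m_eq m'_eq G_eq[OF a B] \<nu>_Iic)
      \<comment> \<open>For the reverse inequality the infimum is bounded by each single
        \<open>G q\<close>; right-continuity of \<open>cdf m\<close> then lets \<open>q\<close>
        decrease to \<open>x\<close>.\<close>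
      have le: "measure m' {..x} \<le> measure m {..q}" if "q \<in> \<rat>" "x < q" for q
      proof -
        have "emeasure m' {..x} \<le> emeasure m {..q}"
          unfolding m_eq[OF borel_closed[OF closed_atMost]] m'_eq[OF borel_closed[OF closed_atMost]] G_eq[OF a B] \<nu>_Iic rational_inf_def
          using that G_ge
          by (intro nn_integral_mono mult_right_mono ennreal_leI cINF_lower) (auto intro!: bdd_belowI[of _ 0])
        then show ?thesis by (simp add: m.emeasure_eq_measure m'.emeasure_eq_measure)
      qed
      have "measure m' {..x} \<le> cdf m x"
        by (rule le_cdf_of_rational[OF m]) (simp add: cdf_def le)
      then have "measure m' {..x} \<le> measure m {..x}" by (simp add: cdf_def)
      then show "emeasure m' {..x} \<le> emeasure m {..x}"
        by (simp add: m.emeasure_eq_measure m'.emeasure_eq_measure)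
    qed
    then have "cdf m = cdf m'"
      by (simp add: cdf_def fun_eq_iff measure_def)
    then have "m = m'" by (rule cdf_unique'[OF m m'])
    then show "emeasure (J a) (S \<times> B) = (\<integral>\<^sup>+t\<in>B. emeasure (\<nu> (a, t)) S \<partial>distr (J a) N snd)"
      using m_eq[OF S] m'_eq[OF S] by (simp add: \<mu>_def)
  qed
qed

section \<open>Existence and uniqueness of conditional laws\<close>

lemma radon_measure_distr_continuous:
  fixes P :: "'x::metric_space measure" and f :: "'x \<Rightarrow> 'z::metric_space"
  assumes P: "radon_measure P" and fin: "finite_measure P" and f: "continuous_on UNIV f"
  shows "radon_measure (distr P borel f)"
proof -
  interpret finite_measure P by fact
  have sets_P[measurable_cong]: "sets P = sets borel"
    and sup: "\<And>D. D \<in> sets borel \<Longrightarrow> emeasure P D = (SUP K\<in>{K. K \<subseteq> D \<and> compact K}. emeasure P K)"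
    using P by (auto simp: radon_measure_def)
  have sp: "space P = UNIV" using sets_eq_imp_space_eq[OF sets_P] by simp
  have f_meas[measurable]: "f \<in> borel \<rightarrow>\<^sub>M borel" by (rule borel_measurable_continuous_onI[OF f])
  have distr: "emeasure (distr P borel f) D = emeasure P (f -` D)" if "D \<in> sets borel" for D
    using that by (subst emeasure_distr) (auto simp: sp)
  show ?thesis
    unfolding radon_measure_def
  proof (intro conjI allI ballI impI)
    fix K :: "'z set" assume "compact K"
    then show "emeasure (distr P borel f) K < \<infinity>"
      by (simp add: distr borel_compact emeasure_eq_measure)
  next
    fix D :: "'z set" assume D: "D \<in> sets borel"
    show "emeasure (distr P borel f) D = (SUP K\<in>{K. K \<subseteq> D \<and> compact K}. emeasure (distr P borel f) K)"
    proof (rule antisym)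
      have "f -` D \<in> sets borel" using measurable_sets[OF f_meas D] by simp
      then have "emeasure (distr P borel f) D = (SUP K\<in>{K. K \<subseteq> f -` D \<and> compact K}. emeasure P K)"
        using distr[OF D] sup by simp
      also have "\<dots> \<le> (SUP K\<in>{K. K \<subseteq> D \<and> compact K}. emeasure (distr P borel f) K)"
      proof (rule SUP_mono)
        fix K assume "K \<in> {K. K \<subseteq> f -` D \<and> compact K}"
        then have K: "K \<subseteq> f -` D" "compact K" by auto
        then have c: "compact (f ` K)" using f by (intro compact_continuous_image) (auto intro: continuous_on_subset)
        have m: "f -` (f ` K) \<in> sets borel"
          using measurable_sets[OF f_meas borel_compact[OF c]] by simp
        have "emeasure P K \<le> emeasure P (f -` (f ` K))"
          using m by (intro emeasure_mono) (auto simp: sets_P)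
        also have "\<dots> = emeasure (distr P borel f) (f ` K)" using distr[OF borel_compact[OF c]] by simp
        finally show "\<exists>L\<in>{K. K \<subseteq> D \<and> compact K}. emeasure P K \<le> emeasure (distr P borel f) L"
          using K c by (intro bexI[of _ "f ` K"]) auto
      qed
      finally show "emeasure (distr P borel f) D \<le> \<dots>" .
      show "(SUP K\<in>{K. K \<subseteq> D \<and> compact K}. emeasure (distr P borel f) K) \<le> emeasure (distr P borel f) D"
        using D by (intro SUP_least emeasure_mono) auto
    qed
  qed simp
qed

text \<open>Points that no generator separates are separated by no set of the sigma-algebra. If
  singletons are measurable, a countable generator therefore separates points.\<close>

lemma sigma_sets_mem_iff:
  assumes "A \<in> sigma_sets \<Omega> (range C)" and "y \<in> \<Omega>" "t \<in> \<Omega>" "\<And>i. y \<in> C i \<longleftrightarrow> t \<in> C i"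
  shows "y \<in> A \<longleftrightarrow> t \<in> A"
  using assms(1) by induction (use assms(2-) in auto)

text \<open>For a probability kernel the mixture identity on sets says that \<open>\<Lambda>\<close>
  is the monadic bind of \<open>\<mu>\<close> with \<open>D\<close>, which brings the formula for
  all nonnegative functions.\<close>

lemma disintegrationI_bind:
  fixes \<Lambda> :: "'a measure" and \<mu> :: "'b measure"
  assumes D: "D \<in> \<mu> \<rightarrow>\<^sub>M prob_algebra \<Lambda>" and ne: "space \<mu> \<noteq> {}"
    and conc: "AE t in \<mu>. AE x in D t. T x = t"
    and \<Lambda>: "\<And>S. S \<in> sets \<Lambda> \<Longrightarrow> (\<integral>\<^sup>+t. emeasure (D t) S \<partial>\<mu>) = emeasure \<Lambda> S"
  shows "disintegration \<Lambda> T \<mu> D"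
proof -
  have D'[measurable]: "D \<in> \<mu> \<rightarrow>\<^sub>M subprob_algebra \<Lambda>" by (rule measurable_prob_algebraD[OF D])
  have bind: "\<Lambda> = \<mu> \<bind> D"
  proof (rule measure_eqI)
    show sets_eq: "sets \<Lambda> = sets (\<mu> \<bind> D)"
      using ne subprob_measurableD(2)[OF D'] by (subst sets_bind) auto
    fix S assume "S \<in> sets \<Lambda>"
    then show "emeasure \<Lambda> S = emeasure (\<mu> \<bind> D) S"
      using ne by (subst emeasure_bind[OF _ D']) (auto simp: \<Lambda>)
  qed
  show ?thesis
    unfolding disintegration_def
  proof (intro conjI ballI allI impI)
    fix t assume "t \<in> space \<mu>" then show "sets (D t) = sets \<Lambda>" using subprob_measurableD(2)[OF D'] by auto
  next
    fix f :: "'a \<Rightarrow> ennreal" assume f: "f \<in> borel_measurable \<Lambda>"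
    show "(\<lambda>t. \<integral>\<^sup>+x. f x \<partial>D t) \<in> borel_measurable \<mu>"
      using measurable_compose[OF D' nn_integral_measurable_subprob_algebra[OF f]] .
    show "(\<integral>\<^sup>+x. f x \<partial>\<Lambda>) = (\<integral>\<^sup>+t. (\<integral>\<^sup>+x. f x \<partial>D t) \<partial>\<mu>)"
      by (subst bind, rule nn_integral_bind[OF f D'])
  qed (rule conc)
qed

text \<open>Concentration on the fibres is hidden in the rectangle identity: taking for
  \<open>S\<close> the event that \<open>T\<close> avoids \<open>B\<close> shows that
  \<open>D t\<close> ignores it for almost every \<open>t\<close> in \<open>B\<close>. Running
  \<open>B\<close> through the generators and their complements, with one null set, forces
  \<open>T x\<close> and \<open>t\<close> into the same generators, hence to be equal.\<close>

lemma disintegrationI: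
  fixes \<Lambda> :: "'a measure" and \<mu> :: "'b measure"
  assumes cg: "countably_generated \<mu>" and sing: "\<And>t. t \<in> space \<mu> \<Longrightarrow> {t} \<in> sets \<mu>"
    and T[measurable]: "T \<in> \<Lambda> \<rightarrow>\<^sub>M \<mu>"
    and D: "D \<in> \<mu> \<rightarrow>\<^sub>M prob_algebra \<Lambda>" and ne: "space \<mu> \<noteq> {}"
    and eq: "\<And>S B. S \<in> sets \<Lambda> \<Longrightarrow> B \<in> sets \<mu> \<Longrightarrow>
      (\<integral>\<^sup>+t\<in>B. emeasure (D t) S \<partial>\<mu>) = emeasure \<Lambda> (S \<inter> (T -` B \<inter> space \<Lambda>))"
  shows "disintegration \<Lambda> T \<mu> D"
proof (rule disintegrationI_bind[OF D ne])
  fix S assume S: "S \<in> sets \<Lambda>"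
  have "T -` space \<mu> \<inter> space \<Lambda> = space \<Lambda>" using measurable_space[OF T] by auto
  then have "(\<integral>\<^sup>+t\<in>space \<mu>. emeasure (D t) S \<partial>\<mu>) = emeasure \<Lambda> S"
    using eq[OF S sets.top] sets.sets_into_space[OF S] by (simp add: Int_absorb2)
  then show "(\<integral>\<^sup>+t. emeasure (D t) S \<partial>\<mu>) = emeasure \<Lambda> S"
    by (simp cong: nn_integral_cong)
next
  obtain C :: "nat \<Rightarrow> 'b set" where C: "sets \<mu> = sigma_sets (space \<mu>) (range C)"
    using countably_generated_sequence[OF cg] by blast
  have [measurable]: "C i \<in> sets \<mu>" for i unfolding C by (rule sigma_sets.Basic) auto
  have D'[measurable]: "D \<in> \<mu> \<rightarrow>\<^sub>M subprob_algebra \<Lambda>" by (rule measurable_prob_algebraD[OF D])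
  have null: "AE t in \<mu>. t \<in> B \<longrightarrow> emeasure (D t) {x \<in> space \<Lambda>. T x \<notin> B} = 0" if B[measurable]: "B \<in> sets \<mu>" for B
  proof -
    have "(\<integral>\<^sup>+t\<in>B. emeasure (D t) {x \<in> space \<Lambda>. T x \<notin> B} \<partial>\<mu>) = emeasure \<Lambda> ({x \<in> space \<Lambda>. T x \<notin> B} \<inter> (T -` B \<inter> space \<Lambda>))"
      by (rule eq) measurable
    also have "{x \<in> space \<Lambda>. T x \<notin> B} \<inter> (T -` B \<inter> space \<Lambda>) = {}" by auto
    finally have "(\<integral>\<^sup>+t. emeasure (D t) {x \<in> space \<Lambda>. T x \<notin> B} * indicator B t \<partial>\<mu>) = 0" by simp
    then have "AE t in \<mu>. emeasure (D t) {x \<in> space \<Lambda>. T x \<notin> B} * indicator B t = 0"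
      by (subst (asm) nn_integral_0_iff_AE) measurable
    then show ?thesis by eventually_elim (auto simp: indicator_def split: if_splits)
  qed
  have "AE t in \<mu>. \<forall>i. (t \<in> C i \<longrightarrow> emeasure (D t) {x \<in> space \<Lambda>. T x \<notin> C i} = 0) \<and>
      (t \<in> space \<mu> - C i \<longrightarrow> emeasure (D t) {x \<in> space \<Lambda>. T x \<notin> space \<mu> - C i} = 0)"
    unfolding AE_all_countable by (intro allI AE_conjI null) auto
  then show "AE t in \<mu>. AE x in D t. T x = t"
    using AE_space
  proof eventually_elim
    fix t
    assume *: "\<forall>i. (t \<in> C i \<longrightarrow> emeasure (D t) {x \<in> space \<Lambda>. T x \<notin> C i} = 0) \<and>
      (t \<in> space \<mu> - C i \<longrightarrow> emeasure (D t) {x \<in> space \<Lambda>. T x \<notin> space \<mu> - C i} = 0)"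
      and t: "t \<in> space \<mu>"
    have sets_D[measurable_cong]: "sets (D t) = sets \<Lambda>" using subprob_measurableD(2)[OF D' t] .
    have sp: "space (D t) = space \<Lambda>" using subprob_measurableD(1)[OF D' t] .
    have m: "{x \<in> space \<Lambda>. T x \<notin> B} \<in> sets (D t)" if [measurable]: "B \<in> sets \<mu>" for B
      unfolding sets_D by measurable
    have "AE x in D t. \<forall>i. T x \<in> C i \<longleftrightarrow> t \<in> C i"
      unfolding AE_all_countable
    proof
      fix i
      show "AE x in D t. T x \<in> C i \<longleftrightarrow> t \<in> C i"
      proof (cases "t \<in> C i")
        case True
        then have "AE x in D t. x \<notin> {x \<in> space \<Lambda>. T x \<notin> C i}"
          using * m by (intro AE_not_in null_setsI) simp_all
        with AE_space show ?thesis by eventually_elim (use True sp in auto)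
      next
        case False
        then have "AE x in D t. x \<notin> {x \<in> space \<Lambda>. T x \<notin> space \<mu> - C i}"
          using * t m by (intro AE_not_in null_setsI) simp_all
        with AE_space show ?thesis by eventually_elim (use False sp in auto)
      qed
    qed
    with AE_space show "AE x in D t. T x = t"
    proof eventually_elim
      fix x assume x: "x \<in> space (D t)" and iff: "\<forall>i. T x \<in> C i \<longleftrightarrow> t \<in> C i"
      have "T x \<in> {t} \<longleftrightarrow> t \<in> {t}"
      proof (rule sigma_sets_mem_iff)
        show "{t} \<in> sigma_sets (space \<mu>) (range C)" using sing[OF t] by (simp only: C)
        show "T x \<in> space \<mu>" using x sp measurable_space[OF T] by simp
      qed (use t iff in auto)
      then show "T x = t" by simp
    qed
  qed
qed

text \<open>The converse of \<open>disintegrationI\<close>: concentration on the fibres moves the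
  indicator of the event that \<open>T\<close> lies in \<open>B\<close> out of the inner
  integral.\<close>

lemma disintegration_set_nn_integral:
  assumes dis: "disintegration \<Lambda> T \<mu> D" and T[measurable]: "T \<in> \<Lambda> \<rightarrow>\<^sub>M \<mu>"
    and S[measurable]: "S \<in> sets \<Lambda>" and B[measurable]: "B \<in> sets \<mu>"
  shows "(\<integral>\<^sup>+t\<in>B. emeasure (D t) S \<partial>\<mu>) = emeasure \<Lambda> (S \<inter> (T -` B \<inter> space \<Lambda>))"
proof -
  let ?X = "S \<inter> (T -` B \<inter> space \<Lambda>)"
  have X[measurable]: "?X \<in> sets \<Lambda>" by measurable
  have sets_D: "sets (D t) = sets \<Lambda>" if "t \<in> space \<mu>" for t
    using dis that by (auto simp: disintegration_def)
  have conc: "AE t in \<mu>. AE x in D t. T x = t" using dis by (auto simp: disintegration_def)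
  have "emeasure \<Lambda> ?X = (\<integral>\<^sup>+x. indicator ?X x \<partial>\<Lambda>)" by simp
  also have "\<dots> = (\<integral>\<^sup>+t. (\<integral>\<^sup>+x. indicator ?X x \<partial>D t) \<partial>\<mu>)"
    using dis borel_measurable_indicator[OF X] unfolding disintegration_def by blast
  also have "\<dots> = (\<integral>\<^sup>+t\<in>B. emeasure (D t) S \<partial>\<mu>)"
  proof (rule nn_integral_cong_AE)
    show "AE t in \<mu>. (\<integral>\<^sup>+x. indicator ?X x \<partial>D t) = emeasure (D t) S * indicator B t"
      using conc AE_space
    proof eventually_elim
      fix t assume *: "AE x in D t. T x = t" and t: "t \<in> space \<mu>"
      have "(\<integral>\<^sup>+x. indicator ?X x \<partial>D t) = (\<integral>\<^sup>+x. indicator B t * indicator S x \<partial>D t)"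
        using sets_eq_imp_space_eq[OF sets_D[OF t]] sets.sets_into_space[OF S]
        by (intro nn_integral_cong_AE, use * in eventually_elim) (auto simp: indicator_def)
      also have "\<dots> = emeasure (D t) S * indicator B t"
        using sets_D[OF t] S by (subst nn_integral_cmult) (auto simp: mult.commute)
      finally show "(\<integral>\<^sup>+x. indicator ?X x \<partial>D t) = emeasure (D t) S * indicator B t" .
    qed
  qed
  finally show ?thesis ..
qed

lemma disintegration_emeasure_measurable:
  assumes dis: "disintegration \<Lambda> T \<mu> D" and S: "S \<in> sets \<Lambda>"
  shows "(\<lambda>t. emeasure (D t) S) \<in> borel_measurable \<mu>"
proof -
  have "(\<lambda>t. \<integral>\<^sup>+x. indicator S x \<partial>D t) \<in> borel_measurable \<mu>"
    using dis borel_measurable_indicator[OF S] unfolding disintegration_def by blast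
  moreover have "(\<integral>\<^sup>+x. indicator S x \<partial>D t) = emeasure (D t) S" if "t \<in> space \<mu>" for t
    using dis that S by (auto simp: disintegration_def)
  ultimately show ?thesis by (simp cong: measurable_cong)
qed

text \<open>The null set depends on \<open>S\<close>; equality of the measures themselves needs a
  countable determining family, which a standard pair provides.\<close>

lemma disintegration_AE_emeasure_eq:
  assumes fin: "finite_measure \<Lambda>" and T: "T \<in> \<Lambda> \<rightarrow>\<^sub>M \<mu>"
    and D: "disintegration \<Lambda> T \<mu> D" and D': "disintegration \<Lambda> T \<mu> D'" and S: "S \<in> sets \<Lambda>"
  shows "AE t in \<mu>. emeasure (D t) S = emeasure (D' t) S"
proof (rule AE_eq_of_set_nn_integral_eq)
  show "(\<lambda>t. emeasure (D t) S) \<in> borel_measurable \<mu>" "(\<lambda>t. emeasure (D' t) S) \<in> borel_measurable \<mu>"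
    using disintegration_emeasure_measurable D D' S by blast+
  have "(\<integral>\<^sup>+t. emeasure (D' t) S \<partial>\<mu>) = (\<integral>\<^sup>+t\<in>space \<mu>. emeasure (D' t) S \<partial>\<mu>)"
    by (simp cong: nn_integral_cong)
  also have "\<dots> = emeasure \<Lambda> (S \<inter> (T -` space \<mu> \<inter> space \<Lambda>))"
    by (rule disintegration_set_nn_integral[OF D' T S sets.top])
  also have "\<dots> < \<infinity>" using finite_measure.emeasure_finite[OF fin] by (simp add: less_top)
  finally show "(\<integral>\<^sup>+t. emeasure (D' t) S \<partial>\<mu>) < \<infinity>" .
  show "(\<integral>\<^sup>+t\<in>B. emeasure (D t) S \<partial>\<mu>) = (\<integral>\<^sup>+t\<in>B. emeasure (D' t) S \<partial>\<mu>)" if "B \<in> sets \<mu>" for B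
    using disintegration_set_nn_integral[OF D T S that] disintegration_set_nn_integral[OF D' T S that] by simp
qed

section \<open>Uniqueness and existence through a standard pair\<close>

context standard_pair
begin

text \<open>Both measures are push-forwards along \<open>\<psi>\<close> of their images on the line,
  and those are determined by rational half-lines. This yields a countable test for equality even
  where the Borel sets of \<open>'x\<close> have no countable generator.\<close>

lemma standard_measure_eqI:
  assumes sets: "sets M = sets borel" "sets M' = sets borel"
    and prob: "prob_space M" "prob_space M'"
    and null: "emeasure M (- X0) = 0" "emeasure M' (- X0) = 0"
    and eq: "\<And>q. q \<in> \<rat> \<Longrightarrow> emeasure M (\<phi> -` {..q}) = emeasure M' (\<phi> -` {..q})"
  shows "M = M'"
proof -
  note [measurable_cong] = sets
  have sp: "space M = UNIV" "space M' = UNIV"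
    using sets_eq_imp_space_eq[OF sets(1)] sets_eq_imp_space_eq[OF sets(2)] by auto
  have fbm: "finite_borel_measure (distr N borel \<phi>)" if "prob_space N" "sets N = sets borel" for N
  proof -
    note [measurable_cong] = that(2)
    interpret prob_space "distr N borel \<phi>" by (rule prob_space.prob_space_distr[OF that(1)]) measurable
    show ?thesis by unfold_locales auto
  qed
  have roundtrip: "N = distr (distr N borel \<phi>) borel \<psi>" if "sets N = sets borel" "emeasure N (- X0) = 0" for N
  proof -
    note [measurable_cong] = that(1)
    have "AE x in N. x \<notin> - X0" using that by (intro AE_not_in) (auto simp: null_sets_def)
    then have "AE x in N. \<psi> (\<phi> x) = x" by eventually_elim (simp add: \<psi>\<phi>)
    then have "distr N borel (\<lambda>x. \<psi> (\<phi> x)) = distr N borel (\<lambda>x. x)"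
      by (intro distr_cong_AE) auto
    also have "\<dots> = N" using that(1) by (simp add: distr_id2)
    finally show ?thesis by (subst distr_distr) (auto simp: comp_def)
  qed
  have "distr M borel \<phi> = distr M' borel \<phi>"
    using eq by (intro finite_borel_measure_eqI_rational fbm prob sets) (simp add: emeasure_distr sp)
  then show ?thesis using roundtrip sets null by metis
qed

end

text \<open>Over every \<open>B\<close> the total masses of the members integrate to the probability
  that \<open>T\<close> lies in \<open>B\<close>, just as the constant 1 does.\<close>

lemma is_cond_law_AE_prob:
  assumes sets_P: "sets P = sets borel" and prob: "prob_space P"
    and T[measurable]: "T \<in> borel \<rightarrow>\<^sub>M borel" and D: "is_cond_law P T D"
  shows "AE t in distr P borel T. prob_space (D t)"
proof -
  interpret prob_space P by fact
  note [measurable_cong] = sets_P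
  have sp: "space P = UNIV" using sets_eq_imp_space_eq[OF sets_P] by simp
  let ?\<mu> = "distr P borel T"
  have dis: "disintegration P T ?\<mu> D" using D by (simp add: is_cond_law_def)
  interpret \<mu>: prob_space ?\<mu> by (rule prob_space_distr) measurable
  have "AE t in ?\<mu>. emeasure (D t) UNIV = 1"
  proof (rule AE_eq_of_set_nn_integral_eq)
    show "(\<lambda>t. emeasure (D t) UNIV) \<in> borel_measurable ?\<mu>"
      using disintegration_emeasure_measurable[OF dis, of UNIV] by (simp add: sets_P)
    show "(\<integral>\<^sup>+t\<in>B. emeasure (D t) UNIV \<partial>?\<mu>) = (\<integral>\<^sup>+t\<in>B. 1 \<partial>?\<mu>)" if "B \<in> sets ?\<mu>" for B
      using disintegration_set_nn_integral[OF dis _ _ that, of UNIV] that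
      by (simp add: sets_P sp emeasure_distr)
  qed (auto simp: \<mu>.emeasure_space_1[simplified])
  then show ?thesis
    using AE_space
  proof eventually_elim
    fix t assume 1: "emeasure (D t) UNIV = 1" and t: "t \<in> space ?\<mu>"
    have "sets (D t) = sets borel" using dis t sets_P by (simp add: disintegration_def)
    from sets_eq_imp_space_eq[OF this] 1 show "prob_space (D t)" by (intro prob_spaceI) simp
  qed
qed

context standard_pair
begin

lemma is_cond_law_AE_null:
  assumes sets_P: "sets P = sets borel" and prob: "prob_space P"
    and T[measurable]: "T \<in> borel \<rightarrow>\<^sub>M borel" and D: "is_cond_law P T D"
    and null: "emeasure P (- X0) = 0"
  shows "AE t in distr P borel T. emeasure (D t) (- X0) = 0"
proof -
  note [measurable_cong] = sets_P
  have dis: "disintegration P T (distr P borel T) D" using D by (simp add: is_cond_law_def)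
  have [simp]: "- X0 \<in> sets borel" by measurable
  have "(\<integral>\<^sup>+t\<in>UNIV. emeasure (D t) (- X0) \<partial>distr P borel T) = emeasure P (- X0 \<inter> (T -` UNIV \<inter> space P))"
    by (rule disintegration_set_nn_integral[OF dis]) (auto simp: sets_P)
  also have "\<dots> = 0"
    using null sets_eq_imp_space_eq[OF sets_P] by simp
  finally show ?thesis
    using disintegration_emeasure_measurable[OF dis, of "- X0"] by (simp add: nn_integral_0_iff_AE sets_P)
qed

text \<open>For almost every \<open>t\<close> both members are probabilities that do not charge
  \<open>- X0\<close> and agree on the countably many test sets, so
  \<open>standard_measure_eqI\<close> applies.\<close>

lemma is_cond_law_unique:
  assumes sets_P: "sets P = sets borel" and prob: "prob_space P"
    and T[measurable]: "T \<in> borel \<rightarrow>\<^sub>M borel"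
    and null: "emeasure P (- X0) = 0"
    and D: "is_cond_law P T D" and D': "is_cond_law P T D'"
  shows "AE t in distr P borel T. D t = D' t"
proof -
  interpret prob_space P by fact
  note [measurable_cong] = sets_P
  have dis: "disintegration P T (distr P borel T) D" "disintegration P T (distr P borel T) D'"
    using D D' by (simp_all add: is_cond_law_def)
  have "AE t in distr P borel T. emeasure (D t) (\<phi> -` {..q}) = emeasure (D' t) (\<phi> -` {..q})" for q
    using measurable_sets[OF \<phi>_measurable, of "{..q}"]
    by (intro disintegration_AE_emeasure_eq[OF finite_measure_axioms _ dis]) (auto simp: sets_P)
  then have "AE t in distr P borel T. \<forall>q\<in>\<rat>. emeasure (D t) (\<phi> -` {..q}) = emeasure (D' t) (\<phi> -` {..q})"
    by (subst AE_ball_countable) (auto intro: countable_rat)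
  then show ?thesis
    using is_cond_law_AE_prob[OF sets_P prob T D] is_cond_law_AE_prob[OF sets_P prob T D']
      is_cond_law_AE_null[OF sets_P prob T D null] is_cond_law_AE_null[OF sets_P prob T D' null]
  proof eventually_elim
    fix t assume "\<forall>q\<in>\<rat>. emeasure (D t) (\<phi> -` {..q}) = emeasure (D' t) (\<phi> -` {..q})"
      "prob_space (D t)" "prob_space (D' t)" "emeasure (D t) (- X0) = 0" "emeasure (D' t) (- X0) = 0"
    then show "D t = D' t"
      using dis sets_P by (intro standard_measure_eqI) (auto simp: disintegration_def)
  qed
qed

text \<open>\<open>J a\<close> is the joint law of the coordinate \<open>\<phi>\<close> and the
  value of \<open>T a\<close>; it is disintegrated on the line and moved back along
  \<open>\<psi>\<close>. Joint measurability is imposed after composing with \<open>\<psi>\<close>,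
  since \<open>(a, x) \<mapsto> T a x\<close> itself may fail to be product measurable.\<close>

lemma is_cond_law_kernel_exists:
  fixes T :: "'p \<Rightarrow> 'x \<Rightarrow> 'y::metric_space"
  assumes cg: "countably_generated (borel :: 'y measure)"
    and sets_P: "sets P = sets borel" and prob: "prob_space P" and null: "emeasure P (- X0) = 0"
    and T: "\<And>a. a \<in> space M \<Longrightarrow> T a \<in> borel \<rightarrow>\<^sub>M borel"
    and T\<psi>[measurable]: "(\<lambda>(a, r). T a (\<psi> r)) \<in> M \<Otimes>\<^sub>M borel \<rightarrow>\<^sub>M borel"
  obtains \<nu> :: "'p \<times> 'y \<Rightarrow> real measure" where "\<nu> \<in> M \<Otimes>\<^sub>M borel \<rightarrow>\<^sub>M prob_algebra borel"
    "\<And>a. a \<in> space M \<Longrightarrow> is_cond_law P (T a) (\<lambda>t. distr (\<nu> (a, t)) borel \<psi>)"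
proof -
  interpret prob_space P by fact
  note [measurable_cong] = sets_P
  have sp: "space P = UNIV" using sets_eq_imp_space_eq[OF sets_P] by simp
  define \<rho> where "\<rho> = distr P borel \<phi>"
  have \<rho>: "prob_space \<rho>" unfolding \<rho>_def by (rule prob_space_distr) measurable
  define J where "J a = distr \<rho> (borel \<Otimes>\<^sub>M borel) (\<lambda>r. (r, T a (\<psi> r)))" for a
  have "(\<lambda>_. \<rho>) \<in> M \<rightarrow>\<^sub>M prob_algebra borel"
    using \<rho> by (intro measurable_const) (auto simp: space_prob_algebra \<rho>_def)
  then have J: "J \<in> M \<rightarrow>\<^sub>M prob_algebra (borel \<Otimes>\<^sub>M borel)"
    unfolding J_def by (rule measurable_distr_prob_space2) measurable
  have ae: "AE x in P. x \<in> X0" using null AE_not_in[of "- X0" P] by (auto simp: null_sets_def sets_P)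
  have Ta\<psi>: "(\<lambda>r. T a (\<psi> r)) \<in> borel \<rightarrow>\<^sub>M borel" if "a \<in> space M" for a
    using measurable_compose[OF measurable_Pair1'[OF that] T\<psi>] by simp
  have supp: "AE z in J a. fst z \<in> {0..1}" if a: "a \<in> space M" for a
  proof -
    note [measurable] = Ta\<psi>[OF a]
    show ?thesis unfolding J_def \<rho>_def
      using \<phi>_bounds by (subst AE_distr_iff; (subst AE_distr_iff)?; (measurable | simp))
  qed
  obtain \<nu> :: "'p \<times> 'y \<Rightarrow> real measure" where \<nu>[measurable]: "\<nu> \<in> M \<Otimes>\<^sub>M borel \<rightarrow>\<^sub>M prob_algebra borel"
    and \<nu>_eq: "\<And>a S B. a \<in> space M \<Longrightarrow> S \<in> sets borel \<Longrightarrow> B \<in> sets borel \<Longrightarrow>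
       emeasure (J a) (S \<times> B) = (\<integral>\<^sup>+t\<in>B. emeasure (\<nu> (a, t)) S \<partial>distr (J a) borel snd)"
    using kernel_disintegration[OF cg J supp] by blast
  show ?thesis
  proof (rule that[OF \<nu>])
    fix a assume a: "a \<in> space M"
    note [measurable] = Ta\<psi>[OF a] T[OF a]
    \<comment> \<open>\<open>\<psi>\<close> undoes \<open>\<phi>\<close> almost surely under
      \<open>P\<close>, so the detour through the line preserves the law of
      \<open>T a\<close>.\<close>
    have J_snd: "distr (J a) borel snd = distr P borel (T a)"
    proof -
      have "distr (J a) borel snd = distr P borel (\<lambda>x. T a (\<psi> (\<phi> x)))"
        unfolding J_def \<rho>_def by (simp add: distr_distr comp_def)
      also have "\<dots> = distr P borel (T a)"
        using ae by (intro distr_cong_AE) (auto simp: \<psi>\<phi> elim!: eventually_mono)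
      finally show ?thesis .
    qed
    show "is_cond_law P (T a) (\<lambda>t. distr (\<nu> (a, t)) borel \<psi>)"
      unfolding is_cond_law_def
    proof (rule disintegrationI)
      show "countably_generated (distr P borel (T a))" using cg by (simp add: countably_generated_def)
      show "(\<lambda>t. distr (\<nu> (a, t)) borel \<psi>) \<in> distr P borel (T a) \<rightarrow>\<^sub>M prob_algebra P"
      proof -
        have "(\<lambda>t. \<nu> (a, t)) \<in> borel \<rightarrow>\<^sub>M prob_algebra borel" using a by measurable
        then have "(\<lambda>t. distr (\<nu> (a, t)) borel \<psi>) \<in> borel \<rightarrow>\<^sub>M prob_algebra borel"
          using measurable_compose[OF _ measurable_distr_prob_space[OF \<psi>_measurable]] by blast
        moreover have "prob_algebra P = prob_algebra borel"
          unfolding prob_algebra_def subprob_algebra_cong[OF sets_P] ..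
        ultimately show ?thesis by simp
      qed
      fix S B assume "S \<in> sets P" "B \<in> sets (distr P borel (T a))"
      then have S[measurable]: "S \<in> sets borel" and B[measurable]: "B \<in> sets borel" by (auto simp: sets_P)
      have \<psi>S: "\<psi> -` S \<in> sets borel" using measurable_sets[OF \<psi>_measurable S] by simp
      have "(\<integral>\<^sup>+t\<in>B. emeasure (distr (\<nu> (a, t)) borel \<psi>) S \<partial>distr P borel (T a))
          = (\<integral>\<^sup>+t\<in>B. emeasure (\<nu> (a, t)) (\<psi> -` S) \<partial>distr (J a) borel snd)"
        unfolding J_snd
      proof (intro nn_integral_cong)
        fix t
        have "\<nu> (a, t) \<in> space (prob_algebra borel)"
          using measurable_space[OF \<nu>, of "(a, t)"] a by (simp add: space_pair_measure)
        then have s: "sets (\<nu> (a, t)) = sets borel" by (simp add: space_prob_algebra)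
        then have "emeasure (distr (\<nu> (a, t)) borel \<psi>) S = emeasure (\<nu> (a, t)) (\<psi> -` S)"
          using sets_eq_imp_space_eq[OF s] S \<psi>_measurable
          by (subst emeasure_distr) (auto cong: measurable_cong_sets)
        then show "emeasure (distr (\<nu> (a, t)) borel \<psi>) S * indicator B t = emeasure (\<nu> (a, t)) (\<psi> -` S) * indicator B t"
          by simp
      qed
      also have "\<dots> = emeasure (J a) (\<psi> -` S \<times> B)" by (rule \<nu>_eq[OF a \<psi>S B, symmetric])
      also have "\<dots> = emeasure P {x. \<psi> (\<phi> x) \<in> S \<and> T a (\<psi> (\<phi> x)) \<in> B}"
        unfolding J_def \<rho>_def using \<psi>S B
        by (subst emeasure_distr, measurable, subst emeasure_distr)
          (auto simp: sp vimage_def intro!: arg_cong2[where f=emeasure])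
      also have "\<dots> = emeasure P (S \<inter> (T a -` B \<inter> space P))"
        using ae by (intro emeasure_eq_AE) (auto simp: sp \<psi>\<phi> sets_P elim!: eventually_mono)
      finally show "(\<integral>\<^sup>+t\<in>B. emeasure (distr (\<nu> (a, t)) borel \<psi>) S \<partial>distr P borel (T a)) = emeasure P (S \<inter> (T a -` B \<inter> space P))" .
    qed auto
  qed
qed

end

section \<open>Conditioning a product law\<close>

text \<open>On a product of non-separable metric spaces the Borel sets need not lie in the product
  \<open>\<sigma>\<close>-algebra; separability of the range of \<open>\<psi>\<close> makes up for this.\<close>

lemma measurable_Pair_separable_range:
  fixes \<psi> :: "real \<Rightarrow> 'b::metric_space"
  assumes \<psi>[measurable]: "\<psi> \<in> borel \<rightarrow>\<^sub>M borel"
    and Q: "countable Q" "\<And>r e. e > 0 \<Longrightarrow> \<exists>q\<in>Q. dist q (\<psi> r) < e"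
  shows "(\<lambda>(a, r). (a, \<psi> r)) \<in> borel \<Otimes>\<^sub>M borel \<rightarrow>\<^sub>M (borel :: ('a::metric_space \<times> 'b) measure)"
proof (rule borel_measurableI)
  fix W :: "('a \<times> 'b) set" assume W: "open W"
  \<comment> \<open>The largest open set whose product with the given ball stays inside
    \<open>W\<close>. Being open it is Borel although the union is uncountable, and only countably
    many rectangles remain.\<close>
  define V where "V q n = \<Union>{V. open V \<and> V \<times> ball q (inverse (real (Suc n))) \<subseteq> W}" for q n
  have V_open: "open (V q n)" for q n unfolding V_def by (intro open_Union) auto
  have V_sub: "V q n \<times> ball q (inverse (real (Suc n))) \<subseteq> W" for q n unfolding V_def by auto
  have "(\<lambda>(a, r). (a, \<psi> r)) -` W \<inter> space (borel \<Otimes>\<^sub>M borel)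
      = (\<Union>q\<in>Q. \<Union>n. V q n \<times> (\<psi> -` ball q (inverse (real (Suc n)))))"
  proof (intro equalityI subsetI)
    fix z assume "z \<in> (\<lambda>(a, r). (a, \<psi> r)) -` W \<inter> space (borel \<Otimes>\<^sub>M borel)"
    then obtain a r where z: "z = (a, r)" "(a, \<psi> r) \<in> W" by (cases z) auto
    obtain U1 U2 where U: "open U1" "open U2" "a \<in> U1" "\<psi> r \<in> U2" "U1 \<times> U2 \<subseteq> W"
      using open_prod_elim[OF W z(2)] by (metis mem_Times_iff fst_conv snd_conv)
    obtain e where e: "e > 0" "ball (\<psi> r) e \<subseteq> U2" using U by (meson openE)
    obtain n where n: "inverse (real (Suc n)) < e / 2" using reals_Archimedean[of "e / 2"] e by auto
    obtain q where q: "q \<in> Q" "dist q (\<psi> r) < inverse (real (Suc n))"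
      using Q(2)[of "inverse (real (Suc n))" r] by auto
    have "ball q (inverse (real (Suc n))) \<subseteq> ball (\<psi> r) e"
    proof
      fix y assume "y \<in> ball q (inverse (real (Suc n)))"
      then have "dist q y < inverse (real (Suc n))" by simp
      moreover have "dist (\<psi> r) y \<le> dist q (\<psi> r) + dist q y" by (rule dist_triangle3)
      ultimately have "dist (\<psi> r) y < e" using q(2) n by linarith
      then show "y \<in> ball (\<psi> r) e" by simp
    qed
    then have "U1 \<times> ball q (inverse (real (Suc n))) \<subseteq> W" using e U by blast
    then have "a \<in> V q n" using U by (auto simp: V_def)
    with q z show "z \<in> (\<Union>q\<in>Q. \<Union>n. V q n \<times> (\<psi> -` ball q (inverse (real (Suc n)))))" by auto
  next
    fix z assume "z \<in> (\<Union>q\<in>Q. \<Union>n. V q n \<times> (\<psi> -` ball q (inverse (real (Suc n)))))"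
    then obtain q n a r where "z = (a, r)" "a \<in> V q n" "\<psi> r \<in> ball q (inverse (real (Suc n)))"
      by (cases z) auto
    with V_sub[of q n] show "z \<in> (\<lambda>(a, r). (a, \<psi> r)) -` W \<inter> space (borel \<Otimes>\<^sub>M borel)"
      by (auto simp: space_pair_measure)
  qed
  also have "\<dots> \<in> sets (borel \<Otimes>\<^sub>M borel)"
  proof (intro sets.countable_UN'' Q(1) sets.countable_UN' countableI_type pair_measureI)
    fix q n
    show "V q n \<in> sets borel" using V_open by simp
    show "\<psi> -` ball q (inverse (real (Suc n))) \<in> sets borel"
      using measurable_sets[OF \<psi>, of "ball q (inverse (real (Suc n)))"] by simp
  qed
  finally show "(\<lambda>(a, r). (a, \<psi> r)) -` W \<inter> space (borel \<Otimes>\<^sub>M borel) \<in> sets (borel \<Otimes>\<^sub>M borel)" .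
qed

lemma joint_law_cong_AE:
  assumes "AE a in \<alpha>. L a = L' a"
  shows "joint_law \<alpha> L = joint_law \<alpha> L'"
proof -
  have "(\<integral>\<^sup>+a. (\<integral>\<^sup>+b. indicator S (a, b) \<partial>L a) \<partial>\<alpha>) = (\<integral>\<^sup>+a. (\<integral>\<^sup>+b. indicator S (a, b) \<partial>L' a) \<partial>\<alpha>)" for S
    using assms by (intro nn_integral_cong_AE) (auto elim!: eventually_mono)
  then show ?thesis by (simp add: joint_law_def)
qed

text \<open>\<open>measure_of\<close> is meaningful only for a countably additive set function;
  agreement with \<open>emeasure D\<close> on all Borel sets settles this.\<close>

lemma joint_law_eqI:
  assumes sets: "sets D = sets borel"
    and eq: "\<And>S. S \<in> sets borel \<Longrightarrow> (\<integral>\<^sup>+a. (\<integral>\<^sup>+b. indicator S (a, b) \<partial>L a) \<partial>\<alpha>) = emeasure D S"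
  shows "joint_law \<alpha> L = D"
proof -
  have "joint_law \<alpha> L = measure_of (space D) (sets D) (emeasure D)"
    unfolding joint_law_def sets sets_eq_imp_space_eq[OF sets] space_borel
    by (rule measure_of_eq) (auto simp: eq sets.sigma_sets_eq[of borel, simplified])
  then show ?thesis by (simp add: measure_of_of_measure)
qed

text \<open>Only the second factor is standardised; \<open>a\<close> remains a parameter. Keeping
  the real-valued kernel \<open>\<nu>\<close> before its push-forward along \<open>\<psi>\<close>
  lets \<open>Pair_\<psi>\<close> supply measurability for Borel sets of the product.\<close>

locale product_conditioning = standard_pair \<phi> \<psi> B0
  for \<phi> :: "'b::metric_space \<Rightarrow> real" and \<psi> B0 +
  fixes P :: "('a::metric_space \<times> 'b) measure" and T :: "'a \<times> 'b \<Rightarrow> 'y::metric_space"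
    and \<nu> :: "'a \<times> 'y \<Rightarrow> real measure"
  assumes cg: "countably_generated (borel :: 'y measure)"
    and sets_P[measurable_cong]: "sets P = sets borel" and prob_P: "prob_space P"
    and product: "is_product_law P"
    and T_borel[measurable]: "T \<in> borel \<rightarrow>\<^sub>M borel"
    and null: "emeasure (distr P borel snd) (- B0) = 0"
    and Pair_\<psi>[measurable]: "(\<lambda>(a, r). (a, \<psi> r)) \<in> borel \<Otimes>\<^sub>M borel \<rightarrow>\<^sub>M (borel :: ('a \<times> 'b) measure)"
    and \<nu>[measurable]: "\<nu> \<in> borel \<Otimes>\<^sub>M borel \<rightarrow>\<^sub>M prob_algebra borel"
    and \<nu>_cond: "\<And>a. is_cond_law (distr P borel snd) (\<lambda>b. T (a, b)) (\<lambda>t. distr (\<nu> (a, t)) borel \<psi>)"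
begin

section \<open>Iterated integrals and null sets under independence\<close>

lemma Pair_borel[measurable]: "Pair a \<in> borel \<rightarrow>\<^sub>M (borel :: ('a \<times> 'b) measure)"
  by (intro borel_measurable_continuous_onI continuous_intros)

lemma fst_borel[measurable]: "fst \<in> (borel :: ('a \<times> 'b) measure) \<rightarrow>\<^sub>M borel"
  by (intro borel_measurable_continuous_onI continuous_intros)

lemma snd_borel[measurable]: "snd \<in> (borel :: ('a \<times> 'b) measure) \<rightarrow>\<^sub>M borel"
  by (intro borel_measurable_continuous_onI continuous_intros)

lemma section_borel[measurable]: "(\<lambda>b. T (a, b)) \<in> borel \<rightarrow>\<^sub>M borel"
  using measurable_compose[OF Pair_borel T_borel] .

lemma space_P: "space P = UNIV"
  using sets_eq_imp_space_eq[OF sets_P] by simp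

abbreviation "P_A \<equiv> distr P borel fst"
abbreviation "P_B \<equiv> distr P borel snd"
abbreviation "\<kappa> a t \<equiv> distr (\<nu> (a, t)) borel \<psi>"
text \<open>The law \<open>\<kappa> a t\<close> placed on the fibre over \<open>a\<close>; it will
  turn out to be the law of \<open>(A, B)\<close> given both \<open>T = t\<close> and
  \<open>A = a\<close>.\<close>

abbreviation "E t a \<equiv> distr (\<nu> (a, t)) borel (\<lambda>r. (a, \<psi> r))"

lemma prob_P_B: "prob_space P_B"
  by (rule prob_space.prob_space_distr[OF prob_P]) measurable

lemma AE_B0: "AE b in P_B. b \<in> B0"
  using AE_not_in[of "- B0" P_B] null by (auto simp: null_sets_def)

text \<open>Independence is known on the product sigma-algebra only, while \<open>F\<close> is
  merely Borel. Replacing \<open>b\<close> by \<open>\<psi> (\<phi> b)\<close> changes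
  \<open>F\<close> on a null set and makes it product measurable, so that Tonelli applies.\<close>

lemma nn_integral_P:
  assumes F[measurable]: "F \<in> borel_measurable borel"
  shows "(\<integral>\<^sup>+x. F x \<partial>P) = (\<integral>\<^sup>+a. \<integral>\<^sup>+b. F (a, b) \<partial>P_B \<partial>P_A)"
proof -
  interpret B: prob_space P_B by (rule prob_P_B)
  have "(\<lambda>(a, r). F (a, \<psi> r)) = F \<circ> (\<lambda>(a, r). (a, \<psi> r))" by auto
  then have F\<psi>[measurable]: "(\<lambda>(a, r). F (a, \<psi> r)) \<in> borel_measurable (borel \<Otimes>\<^sub>M borel)"
    using measurable_comp[OF Pair_\<psi> F] by simp
  define F' where "F' x = F (fst x, \<psi> (\<phi> (snd x)))" for x
  have "F' = (\<lambda>x. (\<lambda>(a, r). F (a, \<psi> r)) (fst x, \<phi> (snd x)))" by (auto simp: F'_def)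
  also have "\<dots> \<in> borel_measurable (borel \<Otimes>\<^sub>M borel)" by measurable
  finally have F'[measurable]: "F' \<in> borel_measurable (borel \<Otimes>\<^sub>M borel)" .
  have id[measurable]: "(\<lambda>x. x) \<in> P \<rightarrow>\<^sub>M (borel \<Otimes>\<^sub>M borel)"
    unfolding measurable_pair_iff by (auto simp: comp_def)
  have "AE x in P. snd x \<in> B0"
    using AE_B0 by (subst (asm) AE_distr_iff) auto
  then have "(\<integral>\<^sup>+x. F x \<partial>P) = (\<integral>\<^sup>+x. F' x \<partial>P)"
    by (intro nn_integral_cong_AE) (auto simp: F'_def \<psi>\<phi> elim!: eventually_mono)
  also have "\<dots> = (\<integral>\<^sup>+x. F' x \<partial>distr P (borel \<Otimes>\<^sub>M borel) (\<lambda>x. x))"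
    by (rule nn_integral_distr[OF id, symmetric]) simp
  also have "\<dots> = (\<integral>\<^sup>+x. F' x \<partial>(P_A \<Otimes>\<^sub>M P_B))"
    using product by (simp add: is_product_law_def)
  also have "\<dots> = (\<integral>\<^sup>+a. \<integral>\<^sup>+b. F' (a, b) \<partial>P_B \<partial>P_A)"
    using F' by (intro B.nn_integral_fst[symmetric])
      (simp add: measurable_cong_sets[OF sets_pair_measure_cong[OF sets_distr sets_distr] refl])
  also have "\<dots> = (\<integral>\<^sup>+a. \<integral>\<^sup>+b. F (a, b) \<partial>P_B \<partial>P_A)"
    using AE_B0 by (intro nn_integral_cong nn_integral_cong_AE) (auto simp: F'_def \<psi>\<phi> elim!: eventually_mono)
  finally show ?thesis .
qed

text \<open>Both sides are the expectation of \<open>H (A, T)\<close>: the left one conditions on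
  \<open>T\<close> first, the right one on \<open>A\<close>.\<close>

lemma nn_integral_cond_law_transfer:
  assumes D: "is_cond_law P T D" and H[measurable]: "H \<in> borel_measurable (borel \<Otimes>\<^sub>M borel)"
  shows "(\<integral>\<^sup>+t. \<integral>\<^sup>+x. H (fst x, t) \<partial>D t \<partial>distr P borel T)
    = (\<integral>\<^sup>+a. \<integral>\<^sup>+t. H (a, t) \<partial>distr P_B borel (\<lambda>b. T (a, b)) \<partial>P_A)"
proof -
  have dis: "disintegration P T (distr P borel T) D" using D by (simp add: is_cond_law_def)
  have HT[measurable]: "(\<lambda>x. H (fst x, T x)) \<in> borel_measurable borel" by measurable
  have "AE t in distr P borel T. AE x in D t. T x = t" using dis by (simp add: disintegration_def)
  then have "(\<integral>\<^sup>+t. \<integral>\<^sup>+x. H (fst x, t) \<partial>D t \<partial>distr P borel T) = (\<integral>\<^sup>+t. \<integral>\<^sup>+x. H (fst x, T x) \<partial>D t \<partial>distr P borel T)"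
    by (intro nn_integral_cong_AE) (auto elim!: eventually_mono intro!: nn_integral_cong_AE)
  also have "\<dots> = (\<integral>\<^sup>+x. H (fst x, T x) \<partial>P)"
    using dis HT unfolding disintegration_def by (simp cong: measurable_cong_sets)
  also have "\<dots> = (\<integral>\<^sup>+a. \<integral>\<^sup>+b. H (a, T (a, b)) \<partial>P_B \<partial>P_A)"
    by (subst nn_integral_P) auto
  also have "\<dots> = (\<integral>\<^sup>+a. \<integral>\<^sup>+t. H (a, t) \<partial>distr P_B borel (\<lambda>b. T (a, b)) \<partial>P_A)"
    by (intro nn_integral_cong nn_integral_distr[symmetric]) measurable
  finally show ?thesis .
qed

text \<open>Both almost-everywhere statements say that the joint law of \<open>(A, T)\<close> does
  not charge the complement of \<open>G\<close>; product measurability of \<open>G\<close> makes the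
  exchange legitimate.\<close>

lemma AE_cond_law_transfer:
  assumes D: "is_cond_law P T D" and D_meas[measurable]: "D \<in> borel \<rightarrow>\<^sub>M prob_algebra borel"
    and G[measurable]: "G \<in> sets (borel \<Otimes>\<^sub>M borel)"
    and ae: "\<And>a. AE t in distr P_B borel (\<lambda>b. T (a, b)). (a, t) \<in> G"
  shows "AE t in distr P borel T. AE a in distr (D t) borel fst. (a, t) \<in> G"
proof -
  let ?H = "indicator (- G) :: 'a \<times> 'y \<Rightarrow> ennreal"
  have [measurable]: "- G \<in> sets (borel \<Otimes>\<^sub>M borel)"
    using sets.compl_sets[OF G] by (simp add: space_pair_measure Compl_eq_Diff_UNIV)
  note D_sub[measurable] = measurable_prob_algebraD[OF D_meas]
  have "(\<integral>\<^sup>+t. \<integral>\<^sup>+x. ?H (fst x, t) \<partial>D t \<partial>distr P borel T)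
      = (\<integral>\<^sup>+a. \<integral>\<^sup>+t. ?H (a, t) \<partial>distr P_B borel (\<lambda>b. T (a, b)) \<partial>P_A)"
    by (rule nn_integral_cond_law_transfer[OF D]) measurable
  also have "\<dots> = (\<integral>\<^sup>+a. 0 \<partial>P_A)"
  proof (rule nn_integral_cong)
    fix a
    have "(\<integral>\<^sup>+t. ?H (a, t) \<partial>distr P_B borel (\<lambda>b. T (a, b))) = (\<integral>\<^sup>+t. 0 \<partial>distr P_B borel (\<lambda>b. T (a, b)))"
      using ae[of a] by (intro nn_integral_cong_AE) (auto elim!: eventually_mono)
    then show "(\<integral>\<^sup>+t. ?H (a, t) \<partial>distr P_B borel (\<lambda>b. T (a, b))) = 0" by simp
  qed
  finally have 0: "(\<integral>\<^sup>+t. \<integral>\<^sup>+x. ?H (fst x, t) \<partial>D t \<partial>distr P borel T) = 0" by simp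
  have "(\<lambda>t. \<integral>\<^sup>+x. ?H (fst x, t) \<partial>D t) \<in> borel_measurable borel"
    by (rule nn_integral_measurable_subprob_algebra2[where N=borel]) measurable
  with 0 have "AE t in distr P borel T. (\<integral>\<^sup>+x. ?H (fst x, t) \<partial>D t) = 0"
    by (subst (asm) nn_integral_0_iff_AE) auto
  then show ?thesis
  proof eventually_elim
    fix t assume 0: "(\<integral>\<^sup>+x. ?H (fst x, t) \<partial>D t) = 0"
    have [measurable_cong]: "sets (D t) = sets borel"
      using measurable_space[OF D_meas, of t] by (simp add: space_prob_algebra)
    have "AE x in D t. ?H (fst x, t) = 0"
      using 0 by (subst (asm) nn_integral_0_iff_AE) measurable
    then show "AE a in distr (D t) borel fst. (a, t) \<in> G"
      by (subst AE_distr_iff) (auto simp: indicator_def elim!: eventually_mono)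
  qed
qed

lemma \<nu>_space: "\<nu> (a, t) \<in> space (prob_algebra borel)"
  using measurable_space[OF \<nu>, of "(a, t)"] by (simp add: space_pair_measure)

lemma sets_\<nu>[measurable_cong]: "sets (\<nu> (a, t)) = sets borel" and prob_\<nu>: "prob_space (\<nu> (a, t))"
  using \<nu>_space[of a t] by (auto simp: space_prob_algebra)

lemma Pair_\<psi>_section[measurable]: "(\<lambda>r. (a, \<psi> r)) \<in> borel \<rightarrow>\<^sub>M (borel :: ('a \<times> 'b) measure)"
  using measurable_compose[OF \<psi>_measurable Pair_borel] .

lemma prob_\<kappa>: "prob_space (\<kappa> a t)"
  by (rule prob_space.prob_space_distr[OF prob_\<nu>]) measurable

lemma E_eq_\<kappa>: "E t a = distr (\<kappa> a t) borel (Pair a)"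
  by (simp add: distr_distr comp_def)

lemma E_measurable: "(\<lambda>(t, a). E t a) \<in> borel \<Otimes>\<^sub>M borel \<rightarrow>\<^sub>M prob_algebra (borel :: ('a \<times> 'b) measure)"
proof -
  have 1: "(\<lambda>p. \<nu> (snd p, fst p)) \<in> (borel :: 'y measure) \<Otimes>\<^sub>M (borel :: 'a measure) \<rightarrow>\<^sub>M prob_algebra borel"
    by measurable
  have "(\<lambda>(p, r). (snd p, \<psi> r)) = (\<lambda>(a, r). (a, \<psi> r)) \<circ> (\<lambda>q :: ('y \<times> 'a) \<times> real. (snd (fst q), snd q))"
    by auto
  also have "\<dots> \<in> ((borel :: 'y measure) \<Otimes>\<^sub>M (borel :: 'a measure)) \<Otimes>\<^sub>M (borel :: real measure) \<rightarrow>\<^sub>M (borel :: ('a \<times> 'b) measure)"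
    by (rule measurable_comp[OF _ Pair_\<psi>]) measurable
  finally have 2: "(\<lambda>(p, r). (snd p, \<psi> r)) \<in> ((borel :: 'y measure) \<Otimes>\<^sub>M (borel :: 'a measure)) \<Otimes>\<^sub>M (borel :: real measure) \<rightarrow>\<^sub>M (borel :: ('a \<times> 'b) measure)" .
  show ?thesis
    using measurable_distr_prob_space2[OF 1 2] by (simp add: case_prod_beta)
qed

lemma E_section_measurable: "E t \<in> borel \<rightarrow>\<^sub>M prob_algebra (borel :: ('a \<times> 'b) measure)"
  using measurable_compose[OF measurable_Pair1'[of t borel borel] E_measurable] by simp

lemma AE_eq_bind:
  assumes D: "is_cond_law P T D" and D_meas[measurable]: "D \<in> borel \<rightarrow>\<^sub>M prob_algebra borel"
    and std: "standard_pair \<phi>' \<psi>' X0" and null': "emeasure P (- X0) = 0"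
  shows "AE t in distr P borel T. D t = distr (D t) borel fst \<bind> E t"
proof -
  interpret prob_space P by (rule prob_P)
  note [measurable] = E_measurable
  have \<alpha>[measurable]: "(\<lambda>t. distr (D t) borel fst) \<in> borel \<rightarrow>\<^sub>M prob_algebra borel"
    using measurable_compose[OF D_meas measurable_distr_prob_space[OF fst_borel]] .
  have D_sp: "D t \<in> space (prob_algebra borel)" and \<alpha>_sp: "distr (D t) borel fst \<in> space (prob_algebra borel)" for t
    using measurable_space[OF D_meas, of t] measurable_space[OF \<alpha>, of t] by auto
  have [measurable_cong]: "sets (D t) = sets borel" for t using D_sp[of t] by (simp add: space_prob_algebra)
  have "is_cond_law P T (\<lambda>t. distr (D t) borel fst \<bind> E t)"
    unfolding is_cond_law_def
  proof (rule disintegrationI)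
    show "countably_generated (distr P borel T)" using cg by (simp add: countably_generated_def)
    have "(\<lambda>t. distr (D t) borel fst \<bind> E t) \<in> borel \<rightarrow>\<^sub>M prob_algebra (borel :: ('a \<times> 'b) measure)"
      by (rule measurable_bind_prob_space2[OF \<alpha> E_measurable])
    moreover have "prob_algebra P = prob_algebra borel"
      unfolding prob_algebra_def subprob_algebra_cong[OF sets_P] ..
    ultimately show "(\<lambda>t. distr (D t) borel fst \<bind> E t) \<in> distr P borel T \<rightarrow>\<^sub>M prob_algebra P" by simp
    fix S B assume "S \<in> sets P" "B \<in> sets (distr P borel T)"
    then have S[measurable]: "S \<in> sets borel" and B[measurable]: "B \<in> sets borel" by (auto simp: sets_P)
    define H where "H x = emeasure (E (snd x) (fst x)) S * indicator B (snd x)" for x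
    have "(\<lambda>x. emeasure (E (snd x) (fst x)) S) \<in> borel_measurable ((borel :: 'a measure) \<Otimes>\<^sub>M (borel :: 'y measure))"
    proof -
      have "(\<lambda>x. E (snd x) (fst x)) = (\<lambda>(t, a). E t a) \<circ> (\<lambda>x. (snd x, fst x))" by auto
      also have "\<dots> \<in> (borel :: 'a measure) \<Otimes>\<^sub>M (borel :: 'y measure) \<rightarrow>\<^sub>M prob_algebra (borel :: ('a \<times> 'b) measure)"
        by (rule measurable_comp[OF _ E_measurable]) measurable
      finally show ?thesis
        using measurable_compose[OF measurable_prob_algebraD measurable_emeasure_subprob_algebra[OF S]] by blast
    qed
    then have H[measurable]: "H \<in> borel_measurable (borel \<Otimes>\<^sub>M borel)" unfolding H_def by measurable
    have "(\<integral>\<^sup>+t\<in>B. emeasure (distr (D t) borel fst \<bind> E t) S \<partial>distr P borel T)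
        = (\<integral>\<^sup>+t. \<integral>\<^sup>+x. H (fst x, t) \<partial>D t \<partial>distr P borel T)"
    proof (rule nn_integral_cong)
      fix t
      have Ha[measurable]: "(\<lambda>a. H (a, t)) \<in> borel_measurable borel" by measurable
      have Em: "(\<lambda>a. emeasure (E t a) S) \<in> borel_measurable borel"
        using measurable_compose[OF measurable_prob_algebraD[OF E_section_measurable] measurable_emeasure_subprob_algebra[OF S]] .
      have "emeasure (distr (D t) borel fst \<bind> E t) S = (\<integral>\<^sup>+a. emeasure (E t a) S \<partial>distr (D t) borel fst)"
        by (rule emeasure_bind_prob_algebra[OF \<alpha>_sp E_section_measurable S])
      then have "emeasure (distr (D t) borel fst \<bind> E t) S * indicator B t = (\<integral>\<^sup>+a. H (a, t) \<partial>distr (D t) borel fst)"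
        using Em by (simp add: H_def nn_integral_multc)
      also have "\<dots> = (\<integral>\<^sup>+x. H (fst x, t) \<partial>D t)" by (rule nn_integral_distr) measurable
      finally show "emeasure (distr (D t) borel fst \<bind> E t) S * indicator B t = (\<integral>\<^sup>+x. H (fst x, t) \<partial>D t)" .
    qed
    also have "\<dots> = (\<integral>\<^sup>+a. \<integral>\<^sup>+t. H (a, t) \<partial>distr P_B borel (\<lambda>b. T (a, b)) \<partial>P_A)"
      by (rule nn_integral_cond_law_transfer[OF D H])
    also have "\<dots> = (\<integral>\<^sup>+a. \<integral>\<^sup>+b. indicator (S \<inter> T -` B) (a, b) \<partial>P_B \<partial>P_A)"
    proof (rule nn_integral_cong)
      fix a
      have S': "Pair a -` S \<in> sets borel" using measurable_sets[OF Pair_borel S] by simp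
      have "(\<integral>\<^sup>+t. H (a, t) \<partial>distr P_B borel (\<lambda>b. T (a, b)))
          = (\<integral>\<^sup>+t\<in>B. emeasure (\<kappa> a t) (Pair a -` S) \<partial>distr P_B borel (\<lambda>b. T (a, b)))"
        using S by (intro nn_integral_cong) (simp add: H_def E_eq_\<kappa> emeasure_distr[OF _ S])
      also have "\<dots> = emeasure P_B (Pair a -` S \<inter> ((\<lambda>b. T (a, b)) -` B \<inter> space P_B))"
        using \<nu>_cond[of a] S' by (intro disintegration_set_nn_integral) (auto simp: is_cond_law_def)
      also have "\<dots> = (\<integral>\<^sup>+b. indicator (Pair a -` S \<inter> ((\<lambda>b. T (a, b)) -` B)) b \<partial>P_B)"
        using S' measurable_sets[OF section_borel B, of a] by (subst nn_integral_indicator) auto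
      finally show "(\<integral>\<^sup>+t. H (a, t) \<partial>distr P_B borel (\<lambda>b. T (a, b))) = (\<integral>\<^sup>+b. indicator (S \<inter> T -` B) (a, b) \<partial>P_B)"
        by (simp add: indicator_def)
    qed
    also have "\<dots> = (\<integral>\<^sup>+x. indicator (S \<inter> T -` B) x \<partial>P)"
      using measurable_sets[OF T_borel B] by (intro nn_integral_P[symmetric] borel_measurable_indicator) auto
    also have "\<dots> = emeasure P (S \<inter> (T -` B \<inter> space P))"
      using measurable_sets[OF T_borel B] by (subst nn_integral_indicator) (auto simp: space_P sets_P)
    finally show "(\<integral>\<^sup>+t\<in>B. emeasure (distr (D t) borel fst \<bind> E t) S \<partial>distr P borel T) = emeasure P (S \<inter> (T -` B \<inter> space P))" .
  qed auto
  then show ?thesis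
    by (rule standard_pair.is_cond_law_unique[OF std sets_P prob_P T_borel null' D])
qed

lemma fst_E: "AE x in E t a. fst x = a"
proof -
  have "{x :: 'a \<times> 'b. fst x = a} \<in> sets borel"
    by (intro borel_closed closed_Collect_eq continuous_intros)
  then show ?thesis by (subst AE_distr_iff) auto
qed

lemma is_cond_law_E:
  assumes Dt: "D \<in> space (prob_algebra borel)" and eq: "D = distr D borel fst \<bind> E t"
  shows "is_cond_law D fst (E t)"
proof -
  have sets_D: "sets D = sets borel" and prob_D: "prob_space D" using Dt by (auto simp: space_prob_algebra)
  note [measurable_cong] = sets_D
  have "distr D borel fst \<in> space (prob_algebra borel)"
    using prob_space.prob_space_distr[OF prob_D, of fst borel] by (simp add: space_prob_algebra)
  note em = emeasure_bind_prob_algebra[OF this E_section_measurable]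
  have pa: "prob_algebra D = prob_algebra borel"
    unfolding prob_algebra_def subprob_algebra_cong[OF sets_D] ..
  show ?thesis
    unfolding is_cond_law_def
  proof (rule disintegrationI_bind)
    show "E t \<in> distr D borel fst \<rightarrow>\<^sub>M prob_algebra D" using E_section_measurable by (simp add: pa)
    show "(\<integral>\<^sup>+a. emeasure (E t a) S \<partial>distr D borel fst) = emeasure D S" if "S \<in> sets D" for S
      using em[of S t] eq that by (simp add: sets_D)
    show "AE a in distr D borel fst. AE x in E t a. fst x = a" by (simp add: fst_E)
  qed simp
qed

lemma nn_integral_E:
  assumes Dt: "D \<in> space (prob_algebra borel)" and eq: "D = distr D borel fst \<bind> E t" and F: "F \<in> borel_measurable borel"
  shows "(\<integral>\<^sup>+x. F x \<partial>D) = (\<integral>\<^sup>+a. \<integral>\<^sup>+b. F (a, b) \<partial>\<kappa> a t \<partial>distr D borel fst)"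
proof -
  have sets_D: "sets D = sets borel" using Dt by (auto simp: space_prob_algebra)
  have "(\<integral>\<^sup>+x. F x \<partial>D) = (\<integral>\<^sup>+a. (\<integral>\<^sup>+x. F x \<partial>E t a) \<partial>distr D borel fst)"
    using is_cond_law_E[OF Dt eq] F sets_D
    unfolding is_cond_law_def disintegration_def by (simp cong: measurable_cong_sets)
  also have "\<dots> = (\<integral>\<^sup>+a. \<integral>\<^sup>+b. F (a, b) \<partial>\<kappa> a t \<partial>distr D borel fst)"
    unfolding E_eq_\<kappa> using F by (intro nn_integral_cong nn_integral_distr) auto
  finally show ?thesis .
qed

lemma joint_law_\<kappa>:
  assumes Dt: "D \<in> space (prob_algebra borel)" and eq: "D = distr D borel fst \<bind> E t"
  shows "joint_law (distr D borel fst) (\<lambda>a. \<kappa> a t) = D"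
proof (rule joint_law_eqI)
  show sets_D: "sets D = sets borel" using Dt by (auto simp: space_prob_algebra)
  fix S :: "('a \<times> 'b) set" assume "S \<in> sets borel"
  then show "(\<integral>\<^sup>+a. (\<integral>\<^sup>+b. indicator S (a, b) \<partial>\<kappa> a t) \<partial>distr D borel fst) = emeasure D S"
    using nn_integral_E[OF Dt eq, of "indicator S"] sets_D by simp
qed

text \<open>The event that \<open>T\<close> differs from \<open>t\<close> is null for
  \<open>D\<close>, so by \<open>nn_integral_E\<close> almost all its sections are null for
  \<open>\<kappa> a t\<close>.\<close>

lemma AE_AE_section_concentrated:
  assumes Dt: "D \<in> space (prob_algebra borel)" and eq: "D = distr D borel fst \<bind> E t"
    and conc: "AE x in D. T x = t" and sing: "{t} \<in> sets borel"
  shows "AE a in distr D borel fst. AE b in \<kappa> a t. T (a, b) = t"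
proof -
  have sets_D[measurable_cong]: "sets D = sets borel" using Dt by (auto simp: space_prob_algebra)
  note [measurable] = sing
  have "{x. T x \<noteq> t} = T -` (- {t}) \<inter> space borel" by auto
  also have "\<dots> \<in> sets borel" using sing by (intro measurable_sets[OF T_borel]) auto
  finally have N[measurable]: "{x. T x \<noteq> t} \<in> sets borel" .
  let ?F = "indicator {x. T x \<noteq> t} :: 'a \<times> 'b \<Rightarrow> ennreal"
  have "(\<integral>\<^sup>+x. ?F x \<partial>D) = (\<integral>\<^sup>+x. 0 \<partial>D)"
    using conc by (intro nn_integral_cong_AE) (auto elim!: eventually_mono)
  then have 0: "(\<integral>\<^sup>+a. \<integral>\<^sup>+b. ?F (a, b) \<partial>\<kappa> a t \<partial>distr D borel fst) = 0"
    using nn_integral_E[OF Dt eq, of ?F] by simp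
  have "(\<lambda>a. \<integral>\<^sup>+x. ?F x \<partial>E t a) \<in> borel_measurable borel"
    using measurable_compose[OF measurable_prob_algebraD[OF E_section_measurable] nn_integral_measurable_subprob_algebra[of ?F borel]] by simp
  moreover have "(\<integral>\<^sup>+x. ?F x \<partial>E t a) = (\<integral>\<^sup>+b. ?F (a, b) \<partial>\<kappa> a t)" for a
    unfolding E_eq_\<kappa> by (rule nn_integral_distr) auto
  ultimately have "(\<lambda>a. \<integral>\<^sup>+b. ?F (a, b) \<partial>\<kappa> a t) \<in> borel_measurable borel" by simp
  with 0 have "AE a in distr D borel fst. (\<integral>\<^sup>+b. ?F (a, b) \<partial>\<kappa> a t) = 0"
    by (subst (asm) nn_integral_0_iff_AE) auto
  then show ?thesis
  proof eventually_elim
    fix a assume "(\<integral>\<^sup>+b. ?F (a, b) \<partial>\<kappa> a t) = 0"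
    moreover have "(\<lambda>b. ?F (a, b)) \<in> borel_measurable borel" by measurable
    ultimately have "AE b in \<kappa> a t. ?F (a, b) = 0"
      by (subst (asm) nn_integral_0_iff_AE) auto
    then show "AE b in \<kappa> a t. T (a, b) = t"
      by eventually_elim (auto simp: indicator_def split: if_splits)
  qed
qed

lemma is_law_B_given_section_\<kappa>: "is_law_B_given_section P T \<kappa>"
  unfolding is_law_B_given_section_def
proof (intro conjI allI impI \<nu>_cond)
  fix f :: "'b \<Rightarrow> ennreal" assume f: "f \<in> borel_measurable borel"
  have "(\<lambda>x. distr (\<nu> x) borel \<psi>) \<in> borel \<Otimes>\<^sub>M borel \<rightarrow>\<^sub>M prob_algebra borel"
    using measurable_compose[OF \<nu> measurable_distr_prob_space[OF \<psi>_measurable]] .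
  from measurable_compose[OF measurable_prob_algebraD[OF this] nn_integral_measurable_subprob_algebra[OF f]]
  show "(\<lambda>(a, t). \<integral>\<^sup>+b. f b \<partial>\<kappa> a t) \<in> borel_measurable (borel \<Otimes>\<^sub>M borel)"
    by (simp add: case_prod_beta)
qed

lemma AE_section_law_eq:
  assumes \<kappa>': "is_law_B_given_section P T \<kappa>'"
  shows "AE t in distr P_B borel (\<lambda>b. T (a, b)). \<kappa>' a t = \<kappa> a t"
  using \<kappa>' \<nu>_cond[of a] prob_P_B null
  by (intro is_cond_law_unique) (auto simp: is_law_B_given_section_def)

text \<open>The agreement of two versions for each \<open>a\<close> and almost every
  \<open>t\<close> is transferred to almost every \<open>t\<close> and almost every
  \<open>a\<close>. This is where joint measurability of an arbitrary version
  \<open>\<kappa>'\<close> enters.\<close>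

lemma AE_AE_section_law_eq:
  assumes D: "is_cond_law P T D" and D_meas: "D \<in> borel \<rightarrow>\<^sub>M prob_algebra borel"
    and \<kappa>': "is_law_B_given_section P T \<kappa>'"
  shows "AE t in distr P borel T. AE a in distr (D t) borel fst. \<kappa>' a t = \<kappa> a t"
proof -
  have sets_\<kappa>': "sets (\<kappa>' a t) = sets borel" for a t
    using \<kappa>' by (auto simp: is_law_B_given_section_def is_cond_law_def disintegration_def)
  have meas: "(\<lambda>x. emeasure (\<kappa>'' (fst x) (snd x)) S) \<in> borel_measurable (borel \<Otimes>\<^sub>M borel)"
    if "is_law_B_given_section P T \<kappa>''" and S: "S \<in> sets borel" for \<kappa>'' S
  proof -
    have "sets (\<kappa>'' a t) = sets borel" for a t
      using that(1) by (auto simp: is_law_B_given_section_def is_cond_law_def disintegration_def)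
    moreover have "(\<lambda>(a, t). \<integral>\<^sup>+b. indicator S b \<partial>\<kappa>'' a t) \<in> borel_measurable (borel \<Otimes>\<^sub>M borel)"
      using that borel_measurable_indicator[OF S] unfolding is_law_B_given_section_def by blast
    ultimately show ?thesis using S by (simp add: case_prod_beta)
  qed
  note m' = meas[OF \<kappa>'] and m = meas[OF is_law_B_given_section_\<kappa>]
  have \<phi>q: "\<phi> -` {..q} \<in> sets borel" for q
    using measurable_sets[OF \<phi>_measurable, of "{..q}"] by simp
  have B0c: "- B0 \<in> sets borel" by measurable
  \<comment> \<open>The set where the two laws coincide is not visibly measurable. \<open>G\<close>
    is cut out by countably many measurable conditions that force coincidence through
    \<open>standard_measure_eqI\<close>; total mass 1 is among them because \<open>\<kappa>'\<close>
    is a probability only almost everywhere.\<close>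
  define G where "G = {x \<in> space (borel \<Otimes>\<^sub>M borel). emeasure (\<kappa>' (fst x) (snd x)) UNIV = 1
    \<and> emeasure (\<kappa>' (fst x) (snd x)) (- B0) = 0 \<and> emeasure (\<kappa> (fst x) (snd x)) (- B0) = 0
    \<and> (\<forall>q\<in>\<rat>. emeasure (\<kappa>' (fst x) (snd x)) (\<phi> -` {..q}) = emeasure (\<kappa> (fst x) (snd x)) (\<phi> -` {..q}))}"
  have "AE t in distr P borel T. AE a in distr (D t) borel fst. (a, t) \<in> G"
  proof (rule AE_cond_law_transfer[OF D D_meas])
    note [measurable] = m'[OF sets.top[of borel, unfolded space_borel]] m'[OF B0c] m[OF B0c] m'[OF \<phi>q] m[OF \<phi>q] countable_rat
    show "G \<in> sets (borel \<Otimes>\<^sub>M borel)"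
      unfolding G_def by measurable
    fix a
    have "AE t in distr P_B borel (\<lambda>b. T (a, b)). emeasure (\<kappa> a t) (- B0) = 0"
      using \<nu>_cond[of a] prob_P_B null by (intro is_cond_law_AE_null) auto
    with AE_section_law_eq[OF \<kappa>', of a]
    show "AE t in distr P_B borel (\<lambda>b. T (a, b)). (a, t) \<in> G"
    proof eventually_elim
      fix t assume "\<kappa>' a t = \<kappa> a t" "emeasure (\<kappa> a t) (- B0) = 0"
      moreover have "emeasure (\<kappa> a t) UNIV = 1"
        using prob_space.emeasure_space_1[OF prob_\<kappa>[of a t]] by simp
      ultimately show "(a, t) \<in> G" by (simp add: G_def space_pair_measure)
    qed
  qed
  then show ?thesis
  proof eventually_elim
    fix t assume "AE a in distr (D t) borel fst. (a, t) \<in> G"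
    then show "AE a in distr (D t) borel fst. \<kappa>' a t = \<kappa> a t"
    proof eventually_elim
      fix a assume "(a, t) \<in> G"
      then show "\<kappa>' a t = \<kappa> a t"
        using sets_eq_imp_space_eq[OF sets_\<kappa>', of a t]
        by (intro standard_measure_eqI sets_\<kappa>' prob_\<kappa> prob_spaceI) (auto simp: G_def)
    qed
  qed
qed

end

section \<open>Conditional laws of Radon probabilities and assembly of the theorem\<close>

lemma is_cond_law_exists:
  fixes P :: "'x::metric_space measure" and T :: "'x \<Rightarrow> 'y::metric_space"
  assumes cg: "countably_generated (borel :: 'y measure)"
    and P: "radon_measure P" "prob_space P" and T[measurable]: "T \<in> borel \<rightarrow>\<^sub>M borel"
  obtains D where "D \<in> borel \<rightarrow>\<^sub>M prob_algebra borel" "is_cond_law P T D"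
proof -
  have sets_P: "sets P = sets borel" using P by (simp add: radon_measure_def)
  obtain \<phi> \<psi> X0 where std: "standard_pair \<phi> \<psi> (X0 :: 'x set)" and null: "emeasure P (- X0) = 0"
    using radon_standard[OF P] by metis
  interpret standard_pair \<phi> \<psi> X0 by (rule std)
  \<comment> \<open>A single map is a kernel over a one-point parameter space.\<close>
  have T\<psi>: "(\<lambda>(a :: unit, r). T (\<psi> r)) \<in> count_space UNIV \<Otimes>\<^sub>M borel \<rightarrow>\<^sub>M borel" by measurable
  obtain \<nu> :: "unit \<times> 'y \<Rightarrow> real measure" where \<nu>: "\<nu> \<in> count_space UNIV \<Otimes>\<^sub>M borel \<rightarrow>\<^sub>M prob_algebra borel"
    and D: "\<And>a. a \<in> space (count_space UNIV) \<Longrightarrow> is_cond_law P T (\<lambda>t. distr (\<nu> (a, t)) borel \<psi>)"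
    using is_cond_law_kernel_exists[OF cg sets_P P(2) null T T\<psi>] by blast
  have "(\<lambda>t. \<nu> ((), t)) \<in> borel \<rightarrow>\<^sub>M prob_algebra borel"
    using measurable_compose[OF measurable_Pair1' \<nu>, of "()"] by simp
  then have "(\<lambda>t. distr (\<nu> ((), t)) borel \<psi>) \<in> borel \<rightarrow>\<^sub>M prob_algebra borel"
    using measurable_compose[OF _ measurable_distr_prob_space[OF \<psi>_measurable]] by blast
  with D[of "()"] show ?thesis by (intro that) auto
qed

lemma radon_is_cond_law_unique:
  fixes P :: "'x::metric_space measure" and T :: "'x \<Rightarrow> 'y::metric_space"
  assumes P: "radon_measure P" "prob_space P" and T: "T \<in> borel \<rightarrow>\<^sub>M borel"
    and D: "is_cond_law P T D" "is_cond_law P T D'"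
  shows "AE t in distr P borel T. D t = D' t"
proof -
  have sets_P: "sets P = sets borel" using P by (simp add: radon_measure_def)
  obtain \<phi> \<psi> X0 where std: "standard_pair \<phi> \<psi> (X0 :: 'x set)" and null: "emeasure P (- X0) = 0"
    using radon_standard[OF P] by metis
  show ?thesis by (rule standard_pair.is_cond_law_unique[OF std sets_P P(2) T null D])
qed

lemma is_cond_law_AE_concentrated:
  fixes P :: "'x::metric_space measure" and T :: "'x \<Rightarrow> 'y::metric_space"
  assumes sets_P: "sets P = sets borel" and P: "prob_space P" and T: "T \<in> borel \<rightarrow>\<^sub>M borel"
    and D: "is_cond_law P T D"
  shows "AE t in distr P borel T. prob_space (D t) \<and> emeasure (D t) {x. T x = t} = 1"
proof -
  have dis: "disintegration P T (distr P borel T) D" using D by (simp add: is_cond_law_def)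
  then have "AE t in distr P borel T. AE x in D t. T x = t" by (simp add: disintegration_def)
  then show ?thesis
    using is_cond_law_AE_prob[OF sets_P P T D]
  proof eventually_elim
    fix t assume conc: "AE x in D t. T x = t" and prob: "prob_space (D t)"
    have "{x. T x = t} = T -` {t} \<inter> space borel" by auto
    also have "\<dots> \<in> sets borel" by (intro measurable_sets[OF T]) simp
    also have "\<dots> = sets (D t)" using dis sets_P by (simp add: disintegration_def)
    finally have "emeasure (D t) {x. T x = t} = 1"
      using conc by (intro prob_space.emeasure_eq_1_AE[OF prob]) auto
    with prob show "prob_space (D t) \<and> emeasure (D t) {x. T x = t} = 1" by simp
  qed
qed

theorem lemma3p1:
  assumes "countably_generated (borel :: 'y::metric_space measure)"
    and "\<And>t :: 'y. {t} \<in> sets borel"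
  shows
    "(\<forall>(P :: 'x::metric_space measure) (T :: 'x \<Rightarrow> 'y).
        T \<in> borel \<rightarrow>\<^sub>M borel \<and> radon_measure P \<and> prob_space P \<and> prob_space (distr P borel T) \<longrightarrow>
        (\<exists>D. is_cond_law P T D \<and> (\<forall>t. prob_space (D t))) \<and>
        (\<forall>D D'. is_cond_law P T D \<and> is_cond_law P T D' \<longrightarrow>
           (AE t in distr P borel T. D t = D' t)) \<and>
        (\<forall>D. is_cond_law P T D \<longrightarrow>
           (AE t in distr P borel T. prob_space (D t) \<and> emeasure (D t) {x. T x = t} = 1)) \<and>
        (\<forall>D D'. is_cond_law P T D \<and> is_cond_law P T D' \<longrightarrow>
           (AE t in distr P borel T. \<forall>S\<in>sets borel.
              emeasure (D t) S > 0 \<longrightarrow> emeasure (D' t) S = emeasure (D t) S)))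
     \<and>
     (\<forall>(P :: ('a::metric_space \<times> 'b::metric_space) measure) (T :: 'a \<times> 'b \<Rightarrow> 'y)
        (ta :: 'y \<Rightarrow> 'a \<Rightarrow> 'y set).
        T \<in> borel \<rightarrow>\<^sub>M borel \<and> radon_measure P \<and> prob_space P \<and> prob_space (distr P borel T) \<and>
        is_product_law P \<and>
        (\<forall>a. (\<lambda>b. T (a, b)) \<in> borel \<rightarrow>\<^sub>M borel) \<and>
        (\<forall>t a. {x. T x = t \<and> fst x = a} = {x. fst x = a \<and> T (a, snd x) \<in> ta t a}) \<longrightarrow>
        (\<exists>\<alpha>. is_law_A_given_T P T \<alpha> \<and> (\<forall>t. prob_space (\<alpha> t))) \<and>
        (\<forall>\<alpha> \<alpha>'. is_law_A_given_T P T \<alpha> \<and> is_law_A_given_T P T \<alpha>' \<longrightarrow>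
           (AE t in distr P borel T. \<alpha> t = \<alpha>' t)) \<and>
        (\<exists>L. is_law_B_given_TA P T L \<and> (\<forall>t a. prob_space (L t a))) \<and>
        (\<forall>\<alpha> L L'. is_law_A_given_T P T \<alpha> \<and> is_law_B_given_TA P T L \<and> is_law_B_given_TA P T L' \<longrightarrow>
           (AE t in distr P borel T. AE a in \<alpha> t. L t a = L' t a)) \<and>
        (\<exists>\<kappa>. is_law_B_given_section P T \<kappa> \<and> (\<forall>a t. prob_space (\<kappa> a t))) \<and>
        (\<forall>\<kappa> \<kappa>'. is_law_B_given_section P T \<kappa> \<and> is_law_B_given_section P T \<kappa>' \<longrightarrow>
           (\<forall>a. AE t in distr (distr P borel snd) borel (\<lambda>b. T (a, b)). \<kappa> a t = \<kappa>' a t)) \<and>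
        (\<forall>D \<alpha> L \<kappa>. is_cond_law P T D \<and> is_law_A_given_T P T \<alpha> \<and>
             is_law_B_given_TA P T L \<and> is_law_B_given_section P T \<kappa> \<longrightarrow>
           (AE t in distr P borel T. AE a in \<alpha> t.
              L t a = \<kappa> a t \<and> (AE b in \<kappa> a t. T (a, b) \<in> ta t a)) \<and>
           (AE t in distr P borel T.
              joint_law (\<alpha> t) (L t) = D t \<and> joint_law (\<alpha> t) (\<lambda>a. \<kappa> a t) = D t)))"
proof (intro conjI allI impI; elim conjE)
  note cg = assms(1)
  {
    fix P :: "'x measure" and T :: "'x \<Rightarrow> 'y"
    assume T: "T \<in> borel \<rightarrow>\<^sub>M borel" and P: "radon_measure P" "prob_space P"
    have sets_P: "sets P = sets borel" using P by (simp add: radon_measure_def)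
    obtain D where D: "D \<in> borel \<rightarrow>\<^sub>M prob_algebra borel" "is_cond_law P T D"
      using is_cond_law_exists[OF cg P T] by blast
    have "prob_space (D t)" for t
      using measurable_space[OF D(1), of t] by (simp add: space_prob_algebra)
    with D show "\<exists>D. is_cond_law P T D \<and> (\<forall>t. prob_space (D t))" by blast
    fix D D' assume D: "is_cond_law P T D"
    show "AE t in distr P borel T. prob_space (D t) \<and> emeasure (D t) {x. T x = t} = 1"
      by (rule is_cond_law_AE_concentrated[OF sets_P P(2) T D])
    assume D': "is_cond_law P T D'"
    show unique: "AE t in distr P borel T. D t = D' t"
      by (rule radon_is_cond_law_unique[OF P T D D'])
    show "AE t in distr P borel T. \<forall>S\<in>sets borel.
        emeasure (D t) S > 0 \<longrightarrow> emeasure (D' t) S = emeasure (D t) S"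
      using unique by eventually_elim simp
  }
  fix P :: "('a \<times> 'b) measure" and T :: "'a \<times> 'b \<Rightarrow> 'y" and ta :: "'y \<Rightarrow> 'a \<Rightarrow> 'y set"
  assume T[measurable]: "T \<in> borel \<rightarrow>\<^sub>M borel" and P: "radon_measure P" "prob_space P"
    and product: "is_product_law P"
    and T_section: "\<forall>a. (\<lambda>b. T (a, b)) \<in> borel \<rightarrow>\<^sub>M borel"
    and ta: "\<forall>t a. {x. T x = t \<and> fst x = a} = {x. fst x = a \<and> T (a, snd x) \<in> ta t a}"
  have sets_P[measurable_cong]: "sets P = sets borel" using P by (simp add: radon_measure_def)
  have fst_borel[measurable]: "fst \<in> (borel :: ('a \<times> 'b) measure) \<rightarrow>\<^sub>M borel"
    and snd_borel[measurable]: "snd \<in> (borel :: ('a \<times> 'b) measure) \<rightarrow>\<^sub>M borel"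
    by (intro borel_measurable_continuous_onI continuous_intros)+
  let ?\<mu> = "distr P borel T" and ?PB = "distr P borel snd"
  have PB: "radon_measure ?PB" "prob_space ?PB"
    using P by (auto intro!: radon_measure_distr_continuous prob_space.prob_space_distr
        prob_space.finite_measure continuous_intros)
  obtain \<phi> :: "'b \<Rightarrow> real" and \<psi> B0 Q where std_B: "standard_pair \<phi> \<psi> (B0 :: 'b set)" and null_B: "emeasure ?PB (- B0) = 0"
    and Q: "countable Q" "\<And>r e. e > 0 \<Longrightarrow> \<exists>q\<in>Q. dist q (\<psi> r) < e"
    using radon_standard[OF PB] by metis
  interpret standard_pair \<phi> \<psi> B0 by (rule std_B)
  \<comment> \<open>Separability of the range of \<open>\<psi>\<close>, witnessed by
    \<open>Q\<close>, makes \<open>T (a, \<psi> r)\<close> product measurable although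
    \<open>T\<close> is only Borel.\<close>
  have Pair_\<psi>: "(\<lambda>(a, r). (a, \<psi> r)) \<in> borel \<Otimes>\<^sub>M borel \<rightarrow>\<^sub>M (borel :: ('a \<times> 'b) measure)"
    by (rule measurable_Pair_separable_range[OF \<psi>_measurable Q])
  have "(\<lambda>(a, r). T (a, \<psi> r)) = T \<circ> (\<lambda>(a, r). (a, \<psi> r))" by auto
  then have T\<psi>: "(\<lambda>(a, r). T (a, \<psi> r)) \<in> borel \<Otimes>\<^sub>M borel \<rightarrow>\<^sub>M borel"
    using measurable_comp[OF Pair_\<psi> T] by simp
  obtain \<nu> :: "'a \<times> 'y \<Rightarrow> real measure" where \<nu>: "\<nu> \<in> borel \<Otimes>\<^sub>M borel \<rightarrow>\<^sub>M prob_algebra borel"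
    and \<nu>_space: "\<And>a. a \<in> space borel \<Longrightarrow> is_cond_law ?PB (\<lambda>b. T (a, b)) (\<lambda>t. distr (\<nu> (a, t)) borel \<psi>)"
    using is_cond_law_kernel_exists[OF cg sets_distr PB(2) null_B T_section[rule_format] T\<psi>] by blast
  have \<nu>_cond: "is_cond_law ?PB (\<lambda>b. T (a, b)) (\<lambda>t. distr (\<nu> (a, t)) borel \<psi>)" for a
    by (rule \<nu>_space) simp
  interpret product_conditioning \<phi> \<psi> B0 P T \<nu>
    by (intro product_conditioning.intro product_conditioning_axioms.intro std_B)
      (fact cg sets_P P(2) product T null_B Pair_\<psi> \<nu> \<nu>_cond)+
  \<comment> \<open>A reference version that is a measurable probability kernel at every
    \<open>t\<close>. Arbitrary versions of all the conditional laws are compared with objects built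
    from it.\<close>
  obtain D0 where D0[measurable]: "D0 \<in> borel \<rightarrow>\<^sub>M prob_algebra borel" and D0_cond: "is_cond_law P T D0"
    using is_cond_law_exists[OF cg P T] by blast
  \<comment> \<open>A second standardisation, now of the product. Almost every \<open>D0 t\<close>
    inherits nullity of \<open>- X0\<close>, which gives uniqueness when \<open>D0 t\<close> itself
    is disintegrated along \<open>fst\<close>.\<close>
  obtain \<phi>' \<psi>' X0 where std: "standard_pair \<phi>' \<psi>' (X0 :: ('a \<times> 'b) set)" and null: "emeasure P (- X0) = 0"
    using radon_standard[OF P] by metis
  have D0_space: "D0 t \<in> space (prob_algebra borel)" for t using measurable_space[OF D0, of t] by simp
  then have sets_D0: "sets (D0 t) = sets borel" and prob_D0: "prob_space (D0 t)" for t
    by (auto simp: space_prob_algebra)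
  have bind: "AE t in ?\<mu>. D0 t = distr (D0 t) borel fst \<bind> E t"
    by (rule AE_eq_bind[OF D0_cond D0 std null])
  have null_D0: "AE t in ?\<mu>. emeasure (D0 t) (- X0) = 0"
    by (rule standard_pair.is_cond_law_AE_null[OF std sets_P P(2) T D0_cond null])
  have D_eq: "AE t in ?\<mu>. D t = D0 t" if "is_cond_law P T D" for D
    by (rule radon_is_cond_law_unique[OF P T that D0_cond])
  have \<alpha>_eq: "AE t in ?\<mu>. \<alpha> t = distr (D0 t) borel fst" if \<alpha>: "is_law_A_given_T P T \<alpha>" for \<alpha>
  proof -
    obtain D where D: "is_cond_law P T D" "\<And>t. \<alpha> t = distr (D t) borel fst"
      using \<alpha> by (auto simp: is_law_A_given_T_def)
    show ?thesis using D_eq[OF D(1)] by eventually_elim (simp add: D(2))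
  qed
  have snd_E: "distr (E t a) borel snd = \<kappa> a t" for t a
    by (simp add: distr_distr comp_def)
  have L0: "is_law_B_given_TA P T (\<lambda>t a. \<kappa> a t)"
    unfolding is_law_B_given_TA_def
  proof (intro exI conjI allI)
    show "AE t in ?\<mu>. is_cond_law (D0 t) fst (E t)"
      using bind by eventually_elim (rule is_cond_law_E[OF D0_space])
  qed (rule D0_cond, rule snd_E[symmetric])
  have L_eq: "AE t in ?\<mu>. AE a in distr (D0 t) borel fst. L t a = \<kappa> a t" if L: "is_law_B_given_TA P T L" for L
  proof -
    obtain D E' where D: "is_cond_law P T D" and E': "AE t in ?\<mu>. is_cond_law (D t) fst (E' t)"
      and L_def: "\<And>t a. L t a = distr (E' t a) borel snd"
      using L by (auto simp: is_law_B_given_TA_def)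
    show ?thesis
      using D_eq[OF D] E' bind null_D0
    proof eventually_elim
      fix t assume eq: "D t = D0 t" and E': "is_cond_law (D t) fst (E' t)"
        and b: "D0 t = distr (D0 t) borel fst \<bind> E t" and n: "emeasure (D0 t) (- X0) = 0"
      \<comment> \<open>Uniqueness is applied for fixed \<open>t\<close>, with \<open>D0 t\<close>
        as the base law and \<open>fst\<close> as the conditioning map.\<close>
      have "AE a in distr (D0 t) borel fst. E' t a = E t a"
        using E' is_cond_law_E[OF D0_space b]
        by (intro standard_pair.is_cond_law_unique[OF std sets_D0 prob_D0 fst_borel n]) (auto simp: eq)
      then show "AE a in distr (D0 t) borel fst. L t a = \<kappa> a t"
        by eventually_elim (simp only: L_def snd_E)
    qed
  qed
  show "\<exists>\<alpha>. is_law_A_given_T P T \<alpha> \<and> (\<forall>t. prob_space (\<alpha> t))"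
  proof (intro exI conjI allI)
    show "is_law_A_given_T P T (\<lambda>t. distr (D0 t) borel fst)"
      using D0_cond by (auto simp: is_law_A_given_T_def)
    show "prob_space (distr (D0 t) borel fst)" for t
      using sets_D0[of t] by (intro prob_space.prob_space_distr[OF prob_D0]) (simp cong: measurable_cong_sets)
  qed
  show "\<exists>L. is_law_B_given_TA P T L \<and> (\<forall>t a. prob_space (L t a))"
    using L0 prob_\<kappa> by blast
  show "\<exists>\<kappa>. is_law_B_given_section P T \<kappa> \<and> (\<forall>a t. prob_space (\<kappa> a t))"
    using is_law_B_given_section_\<kappa> prob_\<kappa> by blast
  {
    fix \<alpha> \<alpha>' assume "is_law_A_given_T P T \<alpha>" "is_law_A_given_T P T \<alpha>'"
    from this[THEN \<alpha>_eq] show "AE t in ?\<mu>. \<alpha> t = \<alpha>' t" by eventually_elim simp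
  next
    fix \<alpha> L L'
    assume \<alpha>: "is_law_A_given_T P T \<alpha>" and L: "is_law_B_given_TA P T L" "is_law_B_given_TA P T L'"
    show "AE t in ?\<mu>. AE a in \<alpha> t. L t a = L' t a"
      using \<alpha>_eq[OF \<alpha>] L[THEN L_eq]
    proof eventually_elim
      fix t assume \<alpha>t: "\<alpha> t = distr (D0 t) borel fst"
        and "AE a in distr (D0 t) borel fst. L t a = \<kappa> a t" "AE a in distr (D0 t) borel fst. L' t a = \<kappa> a t"
      from this(2,3) show "AE a in \<alpha> t. L t a = L' t a" unfolding \<alpha>t by eventually_elim simp
    qed
  next
    fix \<kappa>1 \<kappa>2 a
    assume \<kappa>: "is_law_B_given_section P T \<kappa>1" "is_law_B_given_section P T \<kappa>2"
    show "AE t in distr ?PB borel (\<lambda>b. T (a, b)). \<kappa>1 a t = \<kappa>2 a t"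
      using AE_section_law_eq[OF \<kappa>(1), of a] AE_section_law_eq[OF \<kappa>(2), of a]
      by eventually_elim simp
  next
    fix D \<alpha> L \<kappa>'
    assume D: "is_cond_law P T D" and \<alpha>: "is_law_A_given_T P T \<alpha>" and L: "is_law_B_given_TA P T L"
      and \<kappa>': "is_law_B_given_section P T \<kappa>'"
    note \<kappa>'_eq = AE_AE_section_law_eq[OF D0_cond D0 \<kappa>']
    have conc: "AE t in ?\<mu>. AE x in D0 t. T x = t"
      using D0_cond by (simp add: is_cond_law_def disintegration_def)
    \<comment> \<open>The identity that characterises \<open>ta\<close> is evaluated at the point
      \<open>(a, b)\<close>. It fixes \<open>ta t a\<close> only on values attained by the section
      of \<open>T\<close> at \<open>a\<close>, and these are the only values tested here.\<close>
    have in_ta: "T (a, b) \<in> ta t a \<longleftrightarrow> T (a, b) = t" for a b t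
    proof -
      have "(a, b) \<in> {x. T x = t \<and> fst x = a} \<longleftrightarrow> (a, b) \<in> {x. fst x = a \<and> T (a, snd x) \<in> ta t a}"
        using ta by (simp only:)
      then show ?thesis by simp
    qed
    show "AE t in ?\<mu>. AE a in \<alpha> t. L t a = \<kappa>' a t \<and> (AE b in \<kappa>' a t. T (a, b) \<in> ta t a)"
      using \<alpha>_eq[OF \<alpha>] L_eq[OF L] \<kappa>'_eq bind conc
    proof eventually_elim
      fix t assume \<alpha>t: "\<alpha> t = distr (D0 t) borel fst"
        and 1: "AE a in distr (D0 t) borel fst. L t a = \<kappa> a t"
        and 2: "AE a in distr (D0 t) borel fst. \<kappa>' a t = \<kappa> a t"
        and b: "D0 t = distr (D0 t) borel fst \<bind> E t" and c: "AE x in D0 t. T x = t"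
      have 3: "AE a in distr (D0 t) borel fst. AE b in \<kappa> a t. T (a, b) = t"
        by (rule AE_AE_section_concentrated[OF D0_space b c assms(2)])
      show "AE a in \<alpha> t. L t a = \<kappa>' a t \<and> (AE b in \<kappa>' a t. T (a, b) \<in> ta t a)"
        unfolding \<alpha>t in_ta using 1 2 3 by eventually_elim (simp only: simp_thms)
    qed
    show "AE t in ?\<mu>. joint_law (\<alpha> t) (L t) = D t \<and> joint_law (\<alpha> t) (\<lambda>a. \<kappa>' a t) = D t"
      using \<alpha>_eq[OF \<alpha>] L_eq[OF L] \<kappa>'_eq bind D_eq[OF D]
    proof eventually_elim
      fix t assume \<alpha>t: "\<alpha> t = distr (D0 t) borel fst"
        and 1: "AE a in distr (D0 t) borel fst. L t a = \<kappa> a t"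
        and 2: "AE a in distr (D0 t) borel fst. \<kappa>' a t = \<kappa> a t"
        and b: "D0 t = distr (D0 t) borel fst \<bind> E t" and Dt: "D t = D0 t"
      have "joint_law (\<alpha> t) (\<lambda>a. \<kappa> a t) = D t"
        unfolding \<alpha>t Dt by (rule joint_law_\<kappa>[OF D0_space b])
      moreover have "joint_law (\<alpha> t) (L t) = joint_law (\<alpha> t) (\<lambda>a. \<kappa> a t)"
        unfolding \<alpha>t by (rule joint_law_cong_AE[OF 1])
      moreover have "joint_law (\<alpha> t) (\<lambda>a. \<kappa>' a t) = joint_law (\<alpha> t) (\<lambda>a. \<kappa> a t)"
        unfolding \<alpha>t by (rule joint_law_cong_AE[OF 2])
      ultimately show "joint_law (\<alpha> t) (L t) = D t \<and> joint_law (\<alpha> t) (\<lambda>a. \<kappa>' a t) = D t" by simp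
    qed
  }
qed

end
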